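(* The map $\mathcal{I}$ is an invariant of (classical) pseudoknots. That is, if $D$ and $D'$ are two oriented pseudodiagrams representing the same pseudoknot, with Gauss diagrams $P$ and $P'$, then $\mathcal{I}(P)=\mathcal{I}(P')$ in $\mathbb{Z}\mathcal{C}$.
   Context: **Pseudodiagrams and pseudoknots.** An (oriented, one-component) pseudodiagram is a generic immersion of an oriented circle in the plane (finitely many singularities, all transverse double points) where each double point is either a *classical crossing*, with over/under information, or a *precrossing*, with no such information. A *pseudoknot* is an equivalence class of pseudodiagrams under the relation generated by planar isotopy and the following local moves (for all orientations of strands): - R1, R2, R3: the classical Reidemeister moves, involving only classical crossings. - PR1: create or remove a kink (an empty monogon) whose double point is a precrossing. - PR2: if two strands meet in a precrossing and in a classical crossing that together bound an empty bigon, the classical crossing may be moved to the other side of the precrossing; in terms of singular braids on two strands, $\sigma^{\pm1}\tau=\tau\sigma^{\pm1}$, where $\sigma$ is the classical crossing generator and $\tau$ the precrossing. - PR3: a strand passing over both strands of a precrossing (or under both strands), with classical crossings, may be slid across the precrossing, remaining over (respectively under). **Gauss diagram of a pseudodiagram.** It is an oriented (counterclockwise) circle parametrizing the curve, with a chord joining the two preimages of each double point. For a classical crossing, the chord is a *classical arrow* pointing from the over-strand to the under-strand and decorated with the sign $\pm1$ of the crossing. For a precrossing, the chord is a *precrossing arrow* without sign, pointing in the direction in which the classical arrow would point if the precrossing were resolved to a positive crossing. Gauss diagrams are considered up to orientation-preserving homeomorphism of the circle. Two chords *intersect* if their endpoints alternate on the circle. **The map $\mathcal{I}$.** Let $\mathbb{Z}\mathcal{C}$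 be the set of all chord diagrams (on an oriented circle, up to orientation-preserving homeomorphism) in which each chord is decorated with an integer. For such a Gauss diagram $P$, $\mathcal{I}(P)\in\mathbb{Z}\mathcal{C}$ is obtained as follows: 1. Replace with chords all arrows in $P$ that are associated to precrossings (i.e. delete all arrowheads on precrossing arrows). These chords are called *prechords*. 2. Decorate each prechord $c$ with the integer $i(c)$, the sum of the signs of the classical arrows that intersect $c$. 3. Delete all classical arrows. 4. Delete any prechords $c$ that have adjacent endpoints and $i(c)=0$. *)

theory Defs
  imports "HOL-Analysis.Analysis"
begin

section \<open>Pseudodiagrams\<close>

text \<open>
  The plane is \<^typ>\<open>complex\<close>, and the oriented circle is the real line modulo 1: a closed curve is
  a function of period 1 and a point of the circle is a real number up to an integer. Curves and
  maps of the plane are of class $C^1$.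
\<close>

definition cross :: "complex \<Rightarrow> complex \<Rightarrow> real" where
  "cross a b = Re a * Im b - Im a * Re b"

definition jacobian :: "(complex \<Rightarrow>\<^sub>L complex) \<Rightarrow> real" where
  "jacobian A = cross (blinfun_apply A 1) (blinfun_apply A \<i>)"

datatype passage = Plain | Over | Under | Pre

text \<open>
  The crossing data is attached to the preimages of the double points: \<open>Over\<close> and \<open>Under\<close> mark the
  two preimages of a classical crossing, \<open>Pre\<close> marks both preimages of a precrossing, and all
  parameters that are not preimages of a double point are marked \<open>Plain\<close>.
\<close>

record pdiagram =
  curve :: "real \<Rightarrow> complex"
  mark :: "real \<Rightarrow> passage"

definition vel :: "pdiagram \<Rightarrow> real \<Rightarrow> complex" where
  "vel D t = vector_derivative (curve D) (at t)"

definition crossing :: "pdiagram \<Rightarrow> real \<Rightarrow> real \<Rightarrow> bool" where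
  "crossing D u v \<longleftrightarrow> curve D u = curve D v \<and> u - v \<notin> \<int>"

definition pseudodiagram :: "pdiagram \<Rightarrow> bool" where
  "pseudodiagram D \<longleftrightarrow>
     (\<forall>t. curve D (t + 1) = curve D t) \<and>
     curve D C1_differentiable_on UNIV \<and>
     (\<forall>t. vel D t \<noteq> 0) \<and>
     finite {u \<in> {0..<1}. \<exists>v. crossing D u v} \<and>
     (\<forall>u v w. crossing D u v \<and> crossing D u w \<longrightarrow> v - w \<in> \<int>) \<and>
     (\<forall>u v. crossing D u v \<longrightarrow> cross (vel D u) (vel D v) \<noteq> 0) \<and>
     (\<forall>t. mark D (t + 1) = mark D t) \<and>
     (\<forall>u. mark D u = Plain \<longleftrightarrow> (\<nexists>v. crossing D u v)) \<and>
     (\<forall>u v. crossing D u v \<longrightarrow>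
        (mark D u, mark D v) \<in> {(Over, Under), (Under, Over), (Pre, Pre)})"


section \<open>Planar isotopy\<close>

definition C1_diffeo :: "(complex \<Rightarrow> complex) \<Rightarrow> (complex \<Rightarrow> complex \<Rightarrow>\<^sub>L complex) \<Rightarrow> bool" where
  "C1_diffeo \<phi> \<phi>' \<longleftrightarrow>
     bij \<phi> \<and>
     (\<forall>x. (\<phi> has_derivative blinfun_apply (\<phi>' x)) (at x)) \<and>
     continuous_on UNIV \<phi>' \<and>
     (\<forall>x. jacobian (\<phi>' x) \<noteq> 0)"

definition plane_isotopy :: "(real \<Rightarrow> complex \<Rightarrow> complex) \<Rightarrow> bool" where
  "plane_isotopy H \<longleftrightarrow>
     H 0 = id \<and>
     continuous_on ({0..1} \<times> UNIV) (\<lambda>(t, x). H t x) \<and>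
     (\<exists>H'. (\<forall>t\<in>{0..1}. C1_diffeo (H t) (H' t)) \<and>
           continuous_on ({0..1} \<times> UNIV) (\<lambda>(t, x). H' t x))"

text \<open>Orientation-preserving maps of the circle, given by their lifts to the real line.\<close>

definition circle_diffeo :: "(real \<Rightarrow> real) \<Rightarrow> bool" where
  "circle_diffeo f \<longleftrightarrow>
     (\<forall>t. f (t + 1) = f t + 1) \<and> f C1_differentiable_on UNIV \<and> (\<forall>t. deriv f t > 0)"

definition circle_homeo :: "(real \<Rightarrow> real) \<Rightarrow> bool" where
  "circle_homeo f \<longleftrightarrow>
     (\<forall>t. f (t + 1) = f t + 1) \<and> continuous_on UNIV f \<and> strict_mono f"

definition isotopic :: "pdiagram \<Rightarrow> pdiagram \<Rightarrow> bool" where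
  "isotopic D D' \<longleftrightarrow> pseudodiagram D \<and> pseudodiagram D' \<and>
     (\<exists>H f. plane_isotopy H \<and> circle_diffeo f \<and>
        curve D' = H 1 \<circ> curve D \<circ> f \<and> mark D' = mark D \<circ> f)"


section \<open>Local moves\<close>

text \<open>
  A local picture consists of \<open>n\<close> arcs, parametrized by \<open>{-1..1}\<close>, in the square \<open>square\<close>.
  \<open>replaces n c c' s r D D'\<close> says that the diagram \<open>D\<close> shows the arcs \<open>c\<close>, and the diagram \<open>D'\<close>
  the arcs \<open>c'\<close>, in one and the same disc, the image of the square under a diffeomorphism, and that
  \<open>D\<close> and \<open>D'\<close> agree elsewhere. Point \<open>t\<close> of arc \<open>k\<close> has the parameter \<open>s k + r k * t\<close>; the sign of
  \<open>r k\<close> is the orientation of the strand. The diffeomorphism may reverse the orientation of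
  the plane, so that every picture stands for its mirror image (in a line of the plane) as well.
\<close>

definition square :: "complex set" where
  "square = {z. \<bar>Re z\<bar> \<le> 1 \<and> \<bar>Im z\<bar> \<le> 1}"

definition window :: "nat \<Rightarrow> (nat \<Rightarrow> real) \<Rightarrow> (nat \<Rightarrow> real) \<Rightarrow> real set" where
  "window n s r = {u. \<exists>k<n. \<exists>t\<in>{-1..1}. frac u = frac (s k + r k * t)}"

definition replaces ::
  "nat \<Rightarrow> (nat \<Rightarrow> real \<Rightarrow> complex) \<Rightarrow> (nat \<Rightarrow> real \<Rightarrow> complex) \<Rightarrow> (nat \<Rightarrow> real) \<Rightarrow> (nat \<Rightarrow> real) \<Rightarrow>
   pdiagram \<Rightarrow> pdiagram \<Rightarrow> bool" where
  "replaces n c c' s r D D' \<longleftrightarrow> pseudodiagram D \<and> pseudodiagram D' \<and>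
     (\<forall>k<n. r k \<noteq> 0) \<and>
     inj_on (\<lambda>(k, t). frac (s k + r k * t)) ({..<n} \<times> {-1..1}) \<and>
     (\<exists>\<phi> \<phi>'. C1_diffeo \<phi> \<phi>' \<and>
        (\<forall>k<n. \<forall>t\<in>{-1..1}. curve D (s k + r k * t) = \<phi> (c k t) \<and>
                            curve D' (s k + r k * t) = \<phi> (c' k t)) \<and>
        (\<forall>u. u \<notin> window n s r \<longrightarrow> curve D u \<notin> \<phi> ` square \<and>
                                  curve D' u = curve D u \<and> mark D' u = mark D u))"

text \<open>
  \<open>layered n c s r L D\<close>: where two of the arcs meet, the one with the larger level \<open>L\<close> passes over
  the other, and arcs of equal level meet in precrossings. It is only used for arcs that are graphs
  over the real axis with \<open>Re (c k t) = t\<close>, so that crossings occur at a common value of \<open>t\<close>.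
\<close>

definition layered ::
  "nat \<Rightarrow> (nat \<Rightarrow> real \<Rightarrow> complex) \<Rightarrow> (nat \<Rightarrow> real) \<Rightarrow> (nat \<Rightarrow> real) \<Rightarrow> (nat \<Rightarrow> nat) \<Rightarrow> pdiagram \<Rightarrow> bool" where
  "layered n c s r L D \<longleftrightarrow>
     (\<forall>i<n. \<forall>j<n. \<forall>t\<in>{-1..1}. i \<noteq> j \<and> c i t = c j t \<longrightarrow>
        mark D (s i + r i * t) =
          (if L i > L j then Over else if L i < L j then Under else Pre))"

text \<open>
  The polynomials are chosen such that all double points are transverse and have the
  parameters $-1/2$, $0$ or $1/2$, and such that the two sides of a move have equal values and equal
  first derivatives at $t = -1$ and $t = 1$. The only double point of \<open>kink\<close> has the
  parameters $-1/2$ and $1/2$.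
\<close>

definition flat :: "nat \<Rightarrow> real \<Rightarrow> complex" where
  "flat k t = Complex t 0"

definition kink :: "nat \<Rightarrow> real \<Rightarrow> complex" where
  "kink k t = Complex (t * (1 - 16/9 * (1 - t\<^sup>2)\<^sup>2)) (1/2 * (1 - t\<^sup>2)\<^sup>2)"

definition parallel :: "nat \<Rightarrow> real \<Rightarrow> complex" where
  "parallel k t = (if k = 0 then Complex t 0 else Complex t (1/2))"

definition overlap :: "nat \<Rightarrow> real \<Rightarrow> complex" where
  "overlap k t = (if k = 0 then Complex t 0 else Complex t (1/2 - 8/9 * (1 - t\<^sup>2)\<^sup>2))"

definition triangle :: "real \<Rightarrow> nat \<Rightarrow> real \<Rightarrow> complex" where
  "triangle e k t =
     (if k = 0 then Complex t (t/2)
      else if k = 1 then Complex t (- t/2)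
      else Complex t (e * (4/9) * (1 - t\<^sup>2)\<^sup>2))"

definition bigon :: "nat \<Rightarrow> real \<Rightarrow> complex" where
  "bigon k t = (if k = 0 then Complex t 0 else Complex t (t\<^sup>2 - 1/4))"

definition move_R1 :: "pdiagram \<Rightarrow> pdiagram \<Rightarrow> bool" where
  "move_R1 D D' \<longleftrightarrow> (\<exists>s r. replaces 1 flat kink s r D D' \<and> mark D' (s 0 + r 0 * (1/2)) \<noteq> Pre)"

definition move_PR1 :: "pdiagram \<Rightarrow> pdiagram \<Rightarrow> bool" where
  "move_PR1 D D' \<longleftrightarrow> (\<exists>s r. replaces 1 flat kink s r D D' \<and> mark D' (s 0 + r 0 * (1/2)) = Pre)"

definition move_R2 :: "pdiagram \<Rightarrow> pdiagram \<Rightarrow> bool" where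
  "move_R2 D D' \<longleftrightarrow>
     (\<exists>s r L. replaces 2 parallel overlap s r D D' \<and> layered 2 overlap s r L D' \<and> L 0 \<noteq> L 1)"

definition move_R3 :: "pdiagram \<Rightarrow> pdiagram \<Rightarrow> bool" where
  "move_R3 D D' \<longleftrightarrow>
     (\<exists>s r L. replaces 3 (triangle 1) (triangle (-1)) s r D D' \<and>
        layered 3 (triangle 1) s r L D \<and> layered 3 (triangle (-1)) s r L D' \<and>
        L 0 \<noteq> L 1 \<and> L 0 \<noteq> L 2 \<and> L 1 \<noteq> L 2)"

definition move_PR3 :: "pdiagram \<Rightarrow> pdiagram \<Rightarrow> bool" where
  "move_PR3 D D' \<longleftrightarrow>
     (\<exists>s r L. replaces 3 (triangle 1) (triangle (-1)) s r D D' \<and>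
        layered 3 (triangle 1) s r L D \<and> layered 3 (triangle (-1)) s r L D' \<and>
        L 0 = L 1 \<and> L 0 \<noteq> L 2)"

text \<open>
  In the following move the curve does not change. The sign of the classical crossing is preserved
  because the other strand is over after the move: the two strands have exchanged their positions
  at the precrossing.
\<close>

definition move_PR2 :: "pdiagram \<Rightarrow> pdiagram \<Rightarrow> bool" where
  "move_PR2 D D' \<longleftrightarrow>
     (\<exists>s r a b. replaces 2 bigon bigon s r D D' \<and> (a, b) \<in> {(Over, Under), (Under, Over)} \<and>
        mark D (s 0 - r 0 * (1/2)) = a \<and> mark D (s 1 - r 1 * (1/2)) = b \<and>
        mark D (s 0 + r 0 * (1/2)) = Pre \<and> mark D (s 1 + r 1 * (1/2)) = Pre \<and>
        mark D' (s 0 - r 0 * (1/2)) = Pre \<and> mark D' (s 1 - r 1 * (1/2)) = Pre \<and>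
        mark D' (s 0 + r 0 * (1/2)) = b \<and> mark D' (s 1 + r 1 * (1/2)) = a)"

definition elementary :: "pdiagram \<Rightarrow> pdiagram \<Rightarrow> bool" where
  "elementary D D' \<longleftrightarrow> isotopic D D' \<or> move_R1 D D' \<or> move_R2 D D' \<or> move_R3 D D' \<or>
     move_PR1 D D' \<or> move_PR2 D D' \<or> move_PR3 D D'"

definition same_pseudoknot :: "pdiagram \<Rightarrow> pdiagram \<Rightarrow> bool" where
  "same_pseudoknot = equivclp elementary"


section \<open>Gauss diagrams\<close>

text \<open>
  The points of the circle are represented in \<open>{0..<1}\<close>. An arrow is given by its tail and its head,
  a classical arrow also by its sign.
\<close>

record gauss_diagram =
  classical :: "(real \<times> real \<times> int) set"
  precrossings :: "(real \<times> real) set"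

definition gauss :: "pdiagram \<Rightarrow> gauss_diagram" where
  "gauss D = \<lparr>
     classical = {(u, v, if cross (vel D u) (vel D v) > 0 then 1 else - 1) | u v.
       u \<in> {0..<1} \<and> v \<in> {0..<1} \<and> crossing D u v \<and> mark D u = Over \<and> mark D v = Under},
     precrossings = {(u, v).
       u \<in> {0..<1} \<and> v \<in> {0..<1} \<and> crossing D u v \<and> mark D u = Pre \<and> mark D v = Pre \<and>
       cross (vel D u) (vel D v) > 0}\<rparr>"

definition transport_gauss :: "(real \<Rightarrow> real) \<Rightarrow> gauss_diagram \<Rightarrow> gauss_diagram" where
  "transport_gauss f P = \<lparr>
     classical = (\<lambda>(u, v, e). (frac (f u), frac (f v), e)) ` classical P,
     precrossings = (\<lambda>(u, v). (frac (f u), frac (f v))) ` precrossings P\<rparr>"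

definition is_gauss_diagram_of :: "gauss_diagram \<Rightarrow> pdiagram \<Rightarrow> bool" where
  "is_gauss_diagram_of P D \<longleftrightarrow> (\<exists>f. circle_homeo f \<and> P = transport_gauss f (gauss D))"


section \<open>The invariant\<close>

text \<open>A chord is the set of its two endpoints.\<close>

type_synonym int_chord_diagram = "(real set \<times> int) set"

definition alternate :: "real \<Rightarrow> real \<Rightarrow> real \<Rightarrow> real \<Rightarrow> bool" where
  "alternate a b u v \<longleftrightarrow> (u \<in> {min a b<..<max a b}) \<noteq> (v \<in> {min a b<..<max a b})"

definition index :: "gauss_diagram \<Rightarrow> real \<Rightarrow> real \<Rightarrow> int" where
  "index P a b = (\<Sum>(u, v, e) \<in> {(u, v, e) \<in> classical P. alternate a b u v}. e)"

definition prechords :: "gauss_diagram \<Rightarrow> int_chord_diagram" where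
  "prechords P = {({a, b}, index P a b) | a b. (a, b) \<in> precrossings P}"

definition adjacent_ends :: "int_chord_diagram \<Rightarrow> real set \<Rightarrow> bool" where
  "adjacent_ends X c \<longleftrightarrow>
     (\<exists>a b. a < b \<and> c = {a, b} \<and>
        ((\<forall>x \<in> \<Union>(fst ` X). x \<notin> {a<..<b}) \<or> (\<forall>x \<in> \<Union>(fst ` X). x \<in> {a..b})))"

definition delete_chord :: "int_chord_diagram \<Rightarrow> int_chord_diagram \<Rightarrow> bool" where
  "delete_chord X Y \<longleftrightarrow> (\<exists>c. (c, 0) \<in> X \<and> adjacent_ends X c \<and> Y = X - {(c, 0)})"

text \<open>
  Deleting a chord can make the endpoints of another chord adjacent, so the deletion is repeated
  until no chord can be deleted. A single simultaneous deletion would not be invariant: three nested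
  precrossing kinks (circular word 1 2 3 3 2 1) would leave the chord 2.
\<close>

definition delete_all_spec :: "int_chord_diagram \<Rightarrow> int_chord_diagram \<Rightarrow> bool" where
  "delete_all_spec X Y \<longleftrightarrow> delete_chord\<^sup>*\<^sup>* X Y \<and> (\<nexists>Z. delete_chord Y Z)"

definition delete_all :: "int_chord_diagram \<Rightarrow> int_chord_diagram" where
  "delete_all X = (THE Y. delete_all_spec X Y)"

lemma delete_chord_diamond:
  assumes "delete_chord X Y" "delete_chord X Z" "Y \<noteq> Z"
  shows "\<exists>W. delete_chord Y W \<and> delete_chord Z W"
proof -
  obtain c where c: "(c, 0) \<in> X" "adjacent_ends X c" "Y = X - {(c, 0)}"
    using assms(1) unfolding delete_chord_def by blast
  obtain d where d: "(d, 0) \<in> X" "adjacent_ends X d" "Z = X - {(d, 0)}"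
    using assms(2) unfolding delete_chord_def by blast
  have "c \<noteq> d" using assms(3) c d by blast
  have "adjacent_ends Y d" "adjacent_ends Z c"
    using c d unfolding adjacent_ends_def by blast+
  then have "delete_chord Y (X - {(c, 0)} - {(d, 0)})" "delete_chord Z (X - {(d, 0)} - {(c, 0)})"
    using c d \<open>c \<noteq> d\<close> unfolding delete_chord_def by auto
  then show ?thesis by (metis Diff_insert insert_commute)
qed

lemma delete_all_unique:
  assumes "finite X"
  shows "\<exists>!Y. delete_all_spec X Y"
  using assms
proof (induction X rule: finite_psubset_induct)
  case (psubset X)
  have step: "\<exists>!Y. delete_all_spec Z Y" if "delete_chord X Z" for Z
    using that psubset.IH unfolding delete_chord_def by (metis Diff_subset Diff_iff insertI1 psubsetI)
  have down: "delete_all_spec X Y" if "delete_chord X Z" "delete_all_spec Z Y" for Y Z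
    using that unfolding delete_all_spec_def by (meson converse_rtranclp_into_rtranclp)
  have up: "\<exists>Z. delete_chord X Z \<and> delete_all_spec Z Y"
    if "delete_all_spec X Y" "delete_chord X Z0" for Y Z0
    using that unfolding delete_all_spec_def by (metis converse_rtranclpE)
  show ?case
  proof (cases "\<exists>Z. delete_chord X Z")
    case False
    then have "delete_all_spec X Y \<longleftrightarrow> Y = X" for Y
      unfolding delete_all_spec_def by (metis converse_rtranclpE rtranclp.rtrancl_refl)
    then show ?thesis by simp
  next
    case True
    then obtain Z where Z: "delete_chord X Z" by blast
    then obtain Y where Y: "delete_all_spec Z Y" using step by blast
    have "Y' = Y" if Y': "delete_all_spec X Y'" for Y'
    proof -
      obtain Z' where Z': "delete_chord X Z'" "delete_all_spec Z' Y'"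
        using up[OF Y' Z] by blast
      show ?thesis
      proof (cases "Z' = Z")
        case True
        then show ?thesis using step[OF Z] Y Z' by blast
      next
        case False
        then obtain W where W: "delete_chord Z W" "delete_chord Z' W"
          using delete_chord_diamond[OF Z Z'(1)] by blast
        have "finite W"
          using psubset.hyps Z W(1) unfolding delete_chord_def by auto
        moreover have "W \<subset> X"
          using Z W(1) unfolding delete_chord_def by blast
        ultimately obtain V where V: "delete_all_spec W V"
          using psubset.IH by blast
        have "delete_all_spec Z V" "delete_all_spec Z' V"
          using V W unfolding delete_all_spec_def by (meson converse_rtranclp_into_rtranclp)+
        then show ?thesis
          using step[OF Z] step[OF Z'(1)] Y Z'(2) by metis
      qed
    qed
    then show ?thesis using down[OF Z Y] by blast
  qed
qed

definition zc_class :: "int_chord_diagram \<Rightarrow> int_chord_diagram set" where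
  "zc_class X = {(\<lambda>(c, i). ((\<lambda>x. frac (f x)) ` c, i)) ` X | f. circle_homeo f}"

definition inv_I :: "gauss_diagram \<Rightarrow> int_chord_diagram set" where
  "inv_I P = zc_class (delete_all (prechords P))"

end

theory Submission
  imports Defs
begin

text \<open>
  The label of a prechord is a signed count of the classical arrows that alternate with it, so
  everything depends on how pairs of chords lie on the circle. Whether \<open>{u, v}\<close> alternates with
  \<open>{a, b}\<close> can be read off from the four integers \<open>\<lfloor>u - a\<rfloor>\<close>, \<open>\<lfloor>u - b\<rfloor>\<close>, \<open>\<lfloor>v - a\<rfloor>\<close>,
  \<open>\<lfloor>v - b\<rfloor>\<close>, where the points are replaced by arbitrary lifts to the real line; this is the
  predicate \<open>linked\<close>. The theorem then rests on three observations.

  A homeomorphism of the circle preserves these integers. It therefore carries labels to labels,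
  adjacent endpoints to adjacent endpoints and a complete sequence of deletions to a complete
  sequence of deletions, and the class of the result does not change (\<open>inv_I_transport\<close>). This
  makes the choice of a Gauss diagram of a given pseudodiagram irrelevant. It also settles planar
  isotopy: the Jacobian determinant of the isotopy stays positive, so crossings keep their signs,
  and the only effect on the Gauss diagram is the change of parameter (\<open>inv_I_isotopic\<close>).

  A local move changes the diagram only over a few disjoint arcs of the circle, and
  \<open>\<lfloor>u - a\<rfloor>\<close> is constant while \<open>u\<close> runs through an arc that avoids \<open>a\<close> (\<open>floor_arc\<close>). In the moves
  R3, PR2 and PR3 a crossing with the parameter \<open>t\<close> on two arcs reappears with the parameter
  \<open>- t\<close>. Reflecting every arc in its midpoint thus carries the crossings of one diagram to those of
  the other, with their signs, and two chords can be linked differently afterwards only if they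
  have endpoints on a common arc. For R3 no prechord has an endpoint on an arc. For PR2 the
  prechord and the arrow of the picture trade places, and being linked is a symmetric relation;
  moreover the reflected prechord is moved back by a homeomorphism. For PR3 the two arrows of the
  transverse strand are the only ones whose relation to the prechord of the picture changes, and
  their contributions to its label change by opposite amounts (\<open>inv_I_PR3\<close>).

  The moves R1, R2 and PR1 create crossings. The arrow of a kink has its endpoints next to each
  other and is linked with no other chord. The two arrows of R2 are linked with the same prechords and
  have opposite signs. The precrossing of PR1 gives a prechord with label 0 and adjacent endpoints,
  which can be deleted first, and the result of the deletions does not depend on their order
  (\<open>delete_all_insert\<close>).

  Labels are computed as sums over ordered pairs of parameters (\<open>linking\<close>). Every arrow is then
  counted twice, but its direction, which PR2 reverses relative to the arcs, no longer matters.
\<close>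

section \<open>Alternating chords on the circle\<close>

text \<open>For a fixed chord with ends \<open>a\<close> and \<open>b\<close> the difference \<open>\<lfloor>u - a\<rfloor> - \<lfloor>u - b\<rfloor>\<close> has period 1 in
  \<open>u\<close> and takes two values, one on each of the two arcs into which the ends divide the circle. Unlike
  \<open>alternate\<close>, the comparison of two such differences makes sense for arbitrary lifts of the four
  points to the real line.\<close>

definition linked :: "real \<Rightarrow> real \<Rightarrow> real \<Rightarrow> real \<Rightarrow> bool" where
  "linked a b u v \<longleftrightarrow> \<lfloor>u - a\<rfloor> - \<lfloor>u - b\<rfloor> \<noteq> \<lfloor>v - a\<rfloor> - \<lfloor>v - b\<rfloor>"

lemma floor_diff_unit:
  fixes u a :: real
  assumes "u \<in> {0..<1}" "a \<in> {0..<1}"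
  shows "\<lfloor>u - a\<rfloor> = (if u < a then - 1 else 0)"
  using assms by (auto intro!: floor_unique)

lemma alternate_iff_linked:
  assumes "a \<in> {0..<1}" "b \<in> {0..<1}" "u \<in> {0..<1}" "v \<in> {0..<1}" "u \<notin> {a, b}" "v \<notin> {a, b}"
  shows "alternate a b u v \<longleftrightarrow> linked a b u v"
  using assms(5,6) unfolding alternate_def linked_def
  by (simp add: floor_diff_unit[OF assms(3) assms(1)] floor_diff_unit[OF assms(3) assms(2)]
      floor_diff_unit[OF assms(4) assms(1)] floor_diff_unit[OF assms(4) assms(2)] min_def max_def)

lemma floor_frac_diff: "\<lfloor>frac u - a\<rfloor> = \<lfloor>u - a\<rfloor> - \<lfloor>u\<rfloor>" "\<lfloor>u - frac a\<rfloor> = \<lfloor>u - a\<rfloor> + \<lfloor>a\<rfloor>"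
  for u a :: real
  unfolding frac_def by linarith+

lemma linked_frac [simp]:
  "linked (frac a) b u v = linked a b u v" "linked a (frac b) u v = linked a b u v"
  "linked a b (frac u) v = linked a b u v" "linked a b u (frac v) = linked a b u v"
  unfolding linked_def floor_frac_diff by auto

lemma floor_uminus:
  fixes x :: real
  assumes "x \<notin> \<int>"
  shows "\<lfloor>- x\<rfloor> = - 1 - \<lfloor>x\<rfloor>"
proof -
  have "x \<noteq> of_int \<lfloor>x\<rfloor>" using assms by (metis Ints_of_int)
  then show ?thesis using floor_minus[of x] ceiling_altdef[of x] by simp
qed

lemma linked_sym: "linked a b u v = linked b a u v" "linked a b u v = linked a b v u"
  unfolding linked_def by auto

section \<open>Homeomorphisms of the circle\<close>

lemma circle_homeo_int:
  assumes "circle_homeo f"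
  shows "f (t + of_int n) = f t + of_int n"
proof (induction n rule: int_induct[where k = 0])
  case (step1 i)
  have "f (t + of_int i + 1) = f (t + of_int i) + 1"
    using assms unfolding circle_homeo_def by blast
  with step1 show ?case by (simp add: algebra_simps)
next
  case (step2 i)
  have "f (t + of_int (i - 1) + 1) = f (t + of_int (i - 1)) + 1"
    using assms unfolding circle_homeo_def by blast
  with step2 show ?case by (simp add: algebra_simps)
qed simp

lemma frac_homeo_frac:
  assumes "circle_homeo f"
  shows "frac (f (frac x)) = frac (f x)"
proof -
  have "f x = f (frac x) + of_int \<lfloor>x\<rfloor>"
    using circle_homeo_int[OF assms, of "frac x" "\<lfloor>x\<rfloor>"] by (simp add: frac_def)
  then show ?thesis by (simp add: frac_def)
qed

text \<open>The integer \<open>\<lfloor>u - a\<rfloor>\<close> is the largest \<open>m\<close> with \<open>a + m \<le> u\<close>, and an increasing map that commutes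
  with integer translations respects this inequality.\<close>

lemma circle_homeo_floor:
  assumes "circle_homeo f"
  shows "\<lfloor>f u - f a\<rfloor> = \<lfloor>u - a\<rfloor>"
proof (rule floor_unique)
  have m: "strict_mono f" using assms unfolding circle_homeo_def by blast
  have "a + of_int \<lfloor>u - a\<rfloor> \<le> u" by linarith
  then have "f (a + of_int \<lfloor>u - a\<rfloor>) \<le> f u" using m by (simp add: strict_mono_less_eq)
  then show "of_int \<lfloor>u - a\<rfloor> \<le> f u - f a" by (simp add: circle_homeo_int[OF assms])
  have "u < a + of_int (\<lfloor>u - a\<rfloor> + 1)" by linarith
  then have "f u < f (a + of_int (\<lfloor>u - a\<rfloor> + 1))" using m by (simp add: strict_mono_less)
  then show "f u - f a < of_int \<lfloor>u - a\<rfloor> + 1"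
    using circle_homeo_int[OF assms, of a "\<lfloor>u - a\<rfloor> + 1"] by simp
qed

lemma linked_homeo:
  assumes f: "circle_homeo f"
  shows "linked (f a) (f b) (f u) (f v) = linked a b u v"
  unfolding linked_def circle_homeo_floor[OF f] ..

lemma circle_homeo_surj:
  assumes "circle_homeo f"
  shows "surj f"
proof -
  have "\<exists>x. f x = y" for y
  proof -
  define n where "n = \<lfloor>y - f 0\<rfloor>"
  have "f (of_int n) = f 0 + of_int n" "f (of_int (n + 1)) = f 0 + of_int (n + 1)"
    using circle_homeo_int[OF assms, of 0] by (metis add_0)+
  then have "f (of_int n) \<le> y" "y \<le> f (of_int (n + 1))" unfolding n_def by linarith+
  moreover have "continuous_on {of_int n .. of_int (n + 1)} f"
    using assms unfolding circle_homeo_def by (meson continuous_on_subset subset_UNIV)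
  ultimately show ?thesis using IVT'[of f "of_int n" y "of_int (n + 1)"] by auto
  qed
  then show ?thesis by (metis surjI surj_def)
qed

lemma circle_homeo_comp:
  assumes "circle_homeo f" "circle_homeo g"
  shows "circle_homeo (f \<circ> g)"
  using assms unfolding circle_homeo_def
  by (auto simp: strict_mono_def intro!: continuous_on_compose2[of UNIV f UNIV g])

text \<open>Continuity is automatic, because an increasing map of the line onto itself is continuous.\<close>

lemma circle_homeoI:
  assumes "\<And>t. f (t + 1) = f t + 1" "strict_mono f" "surj f"
  shows "circle_homeo f"
  using assms unfolding circle_homeo_def
  by (auto intro!: continuous_onI_mono simp: strict_mono_less_eq)

lemma circle_homeo_inv:
  assumes "circle_homeo f"
  shows "circle_homeo (inv f)"
proof (rule circle_homeoI)
  have m: "strict_mono f" using assms unfolding circle_homeo_def by blast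
  have s: "f (inv f y) = y" for y using circle_homeo_surj[OF assms] by (simp add: surj_f_inv_f)
  have i: "inv f (f x) = x" for x using m by (simp add: strict_mono_imp_inj_on)
  show "inv f (t + 1) = inv f t + 1" for t
    using circle_homeo_int[OF assms, of "inv f t" 1] i[of "inv f t + 1"] s[of t] by simp
  show "strict_mono (inv f)"
    unfolding strict_mono_def using s m by (metis strict_mono_less)
  show "surj (inv f)" using i by (metis surjI)
qed

lemma circle_homeo_inv_simps:
  assumes "circle_homeo f"
  shows "inv f (f x) = x" "f (inv f x) = x"
  using assms circle_homeo_surj[OF assms]
  by (auto simp: circle_homeo_def strict_mono_imp_inj_on surj_f_inv_f)

section \<open>Moving chord diagrams by homeomorphisms\<close>

definition transport :: "(real \<Rightarrow> real) \<Rightarrow> int_chord_diagram \<Rightarrow> int_chord_diagram" where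
  "transport f X = (\<lambda>(c, i). ((\<lambda>x. frac (f x)) ` c, i)) ` X"

text \<open>The class of a chord diagram is its orbit under the group of homeomorphisms of the circle.\<close>

lemma zc_class_transport:
  assumes f: "circle_homeo f"
  shows "zc_class (transport f X) = zc_class X"
proof -
  have comp: "transport g (transport f X) = transport (g \<circ> f) X" if "circle_homeo g" for g
    unfolding transport_def image_image
    by (rule image_cong) (auto simp only: image_image frac_homeo_frac[OF that] case_prod_unfold
        comp_apply fst_conv snd_conv)
  have zc: "zc_class Y = {transport g Y | g. circle_homeo g}" for Y
    unfolding zc_class_def transport_def by simp
  show ?thesis
  proof (intro equalityI subsetI)
    fix Y assume "Y \<in> zc_class (transport f X)"
    then show "Y \<in> zc_class X" unfolding zc using comp circle_homeo_comp[OF _ f] by auto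
  next
    fix Y assume "Y \<in> zc_class X"
    then obtain g where g: "circle_homeo g" "Y = transport g X" unfolding zc by auto
    have "(g \<circ> inv f) \<circ> f = g" by (auto simp: circle_homeo_inv_simps[OF f])
    then show "Y \<in> zc_class (transport f X)"
      unfolding zc using g comp circle_homeo_comp[OF g(1) circle_homeo_inv[OF f]] by force
  qed
qed

definition on_circle :: "int_chord_diagram \<Rightarrow> bool" where
  "on_circle X \<longleftrightarrow> \<Union>(fst ` X) \<subseteq> {0..<1}"

lemma on_circleD: "on_circle X \<Longrightarrow> (c, i) \<in> X \<Longrightarrow> c \<subseteq> {0..<1}"
  unfolding on_circle_def by (metis UN_subset_iff fst_conv)

text \<open>The endpoints have to be the representatives in \<open>{0..<1}\<close>, since these are the ones that
  \<^const>\<open>transport\<close> produces.\<close>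

lemma transport_inv:
  assumes f: "circle_homeo f" and X: "on_circle X"
  shows "transport (inv f) (transport f X) = X"
proof -
  have "(\<lambda>x. frac (inv f (frac (f x)))) ` c = c" if "(c, i) \<in> X" for c i
  proof -
    have "frac (inv f (frac (f x))) = x" if "x \<in> c" for x
    proof -
      have "x \<in> {0..<1}" using on_circleD[OF X \<open>(c, i) \<in> X\<close>] that by blast
      then show ?thesis
        by (simp add: frac_homeo_frac[OF circle_homeo_inv[OF f]] circle_homeo_inv_simps[OF f]
            frac_eq)
    qed
    then show ?thesis by simp
  qed
  then have "(\<lambda>p. ((\<lambda>x. frac (inv f (frac (f x)))) ` fst p, snd p)) ` X = id ` X"
    by (intro image_cong[OF refl]) (metis id_apply prod.collapse)
  then show ?thesis
    unfolding transport_def image_image case_prod_unfold by (simp add: image_image)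
qed

lemma on_circle_transport: "on_circle (transport f X)"
  unfolding on_circle_def transport_def by (auto simp: frac_lt_1)

text \<open>The ends of a chord are adjacent if one of the two arcs between them contains no other endpoint,
  that is, if all other endpoints lie on the same side of the chord. In this form the property is
  visibly invariant under homeomorphisms of the circle.\<close>

lemma adjacent_ends_iff:
  assumes X: "on_circle X" and c: "(c, i) \<in> X"
  shows "adjacent_ends X c \<longleftrightarrow>
    (\<exists>a b. a \<noteq> b \<and> c = {a, b} \<and>
      (\<forall>x \<in> \<Union>(fst ` X) - {a, b}. \<forall>y \<in> \<Union>(fst ` X) - {a, b}. \<not> linked a b x y))"
proof -
  have unit: "x \<in> {0..<1}" if "x \<in> \<Union>(fst ` X)" for x
    using X that unfolding on_circle_def by auto
  have key: "(\<forall>x \<in> \<Union>(fst ` X). x \<notin> {a<..<b}) \<or> (\<forall>x \<in> \<Union>(fst ` X). x \<in> {a..b}) \<longleftrightarrow>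
      (\<forall>x \<in> \<Union>(fst ` X) - {a, b}. \<forall>y \<in> \<Union>(fst ` X) - {a, b}. \<not> linked a b x y)"
    (is "?L \<longleftrightarrow> ?R") if ab: "a < b" "c = {a, b}" for a b
  proof -
    have e: "a \<in> {0..<1}" "b \<in> {0..<1}" using c ab by (force intro!: unit)+
    have "?R \<longleftrightarrow> (\<forall>x \<in> \<Union>(fst ` X) - {a, b}. \<forall>y \<in> \<Union>(fst ` X) - {a, b}. \<not> alternate a b x y)"
      using e unit alternate_iff_linked by (metis DiffD1 DiffD2)
    also have "\<dots> \<longleftrightarrow> (\<forall>x \<in> \<Union>(fst ` X) - {a, b}. x \<notin> {a<..<b}) \<or>
        (\<forall>x \<in> \<Union>(fst ` X) - {a, b}. x \<in> {a<..<b})"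
      using ab(1) unfolding alternate_def by (simp add: min_def max_def) blast
    also have "\<dots> \<longleftrightarrow> ?L"
    proof -
      have "x \<notin> {a<..<b}" if "x \<in> {a, b}" for x using that by auto
      moreover have "x \<in> {a..b} \<longleftrightarrow> x \<in> {a, b} \<or> x \<in> {a<..<b}" for x using ab(1) by auto
      ultimately show ?thesis by (metis Diff_iff)
    qed
    finally show ?thesis ..
  qed
  show ?thesis
  proof
    assume "adjacent_ends X c"
    then show "\<exists>a b. a \<noteq> b \<and> c = {a, b} \<and>
      (\<forall>x \<in> \<Union>(fst ` X) - {a, b}. \<forall>y \<in> \<Union>(fst ` X) - {a, b}. \<not> linked a b x y)"
      unfolding adjacent_ends_def using key by (metis order_less_irrefl)
  next
    assume "\<exists>a b. a \<noteq> b \<and> c = {a, b} \<and>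
      (\<forall>x \<in> \<Union>(fst ` X) - {a, b}. \<forall>y \<in> \<Union>(fst ` X) - {a, b}. \<not> linked a b x y)"
    then obtain a0 b0 where ab0: "a0 \<noteq> b0" "c = {a0, b0}"
        "\<forall>x \<in> \<Union>(fst ` X) - {a0, b0}. \<forall>y \<in> \<Union>(fst ` X) - {a0, b0}. \<not> linked a0 b0 x y"
      by blast
    define a b where "a = min a0 b0" and "b = max a0 b0"
    have ab: "a < b" "c = {a, b}"
      using ab0 by (auto simp: a_def b_def min_def max_def)
    have "{a, b} = {a0, b0}" "linked a b = linked a0 b0"
      using linked_sym(1)[of a0 b0] by (auto simp: a_def b_def min_def max_def)
    then have "\<forall>x \<in> \<Union>(fst ` X) - {a, b}. \<forall>y \<in> \<Union>(fst ` X) - {a, b}. \<not> linked a b x y"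
      using ab0(3) by simp
    then show "adjacent_ends X c" unfolding adjacent_ends_def using key ab by blast
  qed
qed

lemma frac_homeo_inj:
  assumes f: "circle_homeo f" and "x \<in> {0..<1}" "y \<in> {0..<1}" "frac (f x) = frac (f y)"
  shows "x = y"
proof -
  have "frac (inv f (frac (f x))) = frac (inv f (frac (f y)))" using assms(4) by simp
  then have "frac x = frac y"
    by (simp add: frac_homeo_frac[OF circle_homeo_inv[OF f]] circle_homeo_inv_simps[OF f])
  then show ?thesis using assms by (simp add: frac_eq[THEN iffD2])
qed

lemma delete_chord_transport:
  assumes f: "circle_homeo f" and X: "on_circle X" and XY: "delete_chord X Y"
  shows "delete_chord (transport f X) (transport f Y)"
proof -
  let ?t = "\<lambda>(c, i). ((\<lambda>x. frac (f x)) ` c, i :: int)"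
  obtain c where c: "(c, 0) \<in> X" "adjacent_ends X c" "Y = X - {(c, 0)}"
    using XY unfolding delete_chord_def by blast
  obtain a b where ab: "a \<noteq> b" "c = {a, b}"
      "\<forall>x \<in> \<Union>(fst ` X) - {a, b}. \<forall>y \<in> \<Union>(fst ` X) - {a, b}. \<not> linked a b x y"
    using c(2) unfolding adjacent_ends_iff[OF X c(1)] by blast
  have unit: "x \<in> {0..<1}" if "x \<in> \<Union>(fst ` X)" for x
    using X that unfolding on_circle_def by auto
  have e: "a \<in> \<Union>(fst ` X)" "b \<in> \<Union>(fst ` X)" using c(1) ab(2) by force+
  have E: "\<Union>(fst ` transport f X) = (\<lambda>x. frac (f x)) ` \<Union>(fst ` X)"
    unfolding transport_def by force
  have mem: "((\<lambda>x. frac (f x)) ` c, 0) \<in> transport f X"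
    using c(1) unfolding transport_def by force
  have "adjacent_ends (transport f X) ((\<lambda>x. frac (f x)) ` c)"
    unfolding adjacent_ends_iff[OF on_circle_transport mem] E
  proof (intro exI conjI ballI)
    show "frac (f a) \<noteq> frac (f b)" using frac_homeo_inj[OF f unit unit] e ab(1) by blast
    show "(\<lambda>x. frac (f x)) ` c = {frac (f a), frac (f b)}" using ab(2) by simp
    fix x y
    assume "x \<in> (\<lambda>x. frac (f x)) ` \<Union> (fst ` X) - {frac (f a), frac (f b)}"
      "y \<in> (\<lambda>x. frac (f x)) ` \<Union> (fst ` X) - {frac (f a), frac (f b)}"
    then obtain x' y' where "x = frac (f x')" "y = frac (f y')"
        "x' \<in> \<Union> (fst ` X) - {a, b}" "y' \<in> \<Union> (fst ` X) - {a, b}"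
      by blast
    then show "\<not> linked (frac (f a)) (frac (f b)) x y"
      using ab(3) by (simp add: linked_homeo[OF f])
  qed
  moreover have "transport f Y = transport f X - {((\<lambda>x. frac (f x)) ` c, 0)}"
  proof -
    have "inj_on ?t X"
      using transport_inv[OF f] X
    proof -
      have "(\<lambda>x. frac (inv f x)) ` (\<lambda>x. frac (f x)) ` d = d" if "(d, i) \<in> X" for d i
      proof -
        have "on_circle {(d, i)}" using on_circleD[OF X that] unfolding on_circle_def by simp
        from transport_inv[OF f this] show ?thesis unfolding transport_def by auto
      qed
      then show ?thesis by (intro inj_onI) (clarsimp, metis)
    qed
    then have "?t ` (X - {(c, 0)}) = ?t ` X - ?t ` {(c, 0)}"
      using c(1) by (intro inj_on_image_set_diff[of _ X]) auto
    then show ?thesis unfolding transport_def c(3) by simp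
  qed
  ultimately show ?thesis unfolding delete_chord_def using mem by blast
qed

lemma delete_chord_subset: "delete_chord X Y \<Longrightarrow> Y \<subseteq> X"
  unfolding delete_chord_def by auto

lemma delete_chords_subset: "delete_chord\<^sup>*\<^sup>* X Y \<Longrightarrow> Y \<subseteq> X"
  by (induction rule: rtranclp_induct) (auto dest: delete_chord_subset)

lemma on_circle_subset: "on_circle X \<Longrightarrow> Y \<subseteq> X \<Longrightarrow> on_circle Y"
  unfolding on_circle_def by blast

lemma delete_all_eqI:
  assumes "finite X" "delete_all_spec X Y"
  shows "delete_all X = Y"
  unfolding delete_all_def using delete_all_unique[OF assms(1)] assms(2) by (rule the1_equality)

lemma delete_all_spec_delete_all:
  assumes "finite X"
  shows "delete_all_spec X (delete_all X)"
  unfolding delete_all_def by (rule theI'[OF delete_all_unique[OF assms]])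

text \<open>No chord of the transported result can be deleted, because the inverse homeomorphism would carry
  this deletion back.\<close>

lemma delete_all_transport:
  assumes f: "circle_homeo f" and X: "on_circle X" and fin: "finite X"
  shows "delete_all (transport f X) = transport f (delete_all X)"
proof (rule delete_all_eqI)
  let ?Y = "delete_all X"
  have Y: "delete_chord\<^sup>*\<^sup>* X ?Y" "\<nexists>Z. delete_chord ?Y Z"
    using delete_all_spec_delete_all[OF fin] unfolding delete_all_spec_def by auto
  show "finite (transport f X)" using fin unfolding transport_def by simp
  have "delete_chord\<^sup>*\<^sup>* (transport f X) (transport f Y)" if "delete_chord\<^sup>*\<^sup>* X Y" for Y
    using that
  proof (induction rule: rtranclp_induct)
    case (step Y Z)
    have "on_circle Y" using delete_chords_subset[OF step(1)] X on_circle_subset by blast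
    from delete_chord_transport[OF f this step(2)] step(3) show ?case by simp
  qed simp
  then have "delete_chord\<^sup>*\<^sup>* (transport f X) (transport f ?Y)" using Y(1) by blast
  moreover have "\<nexists>Z. delete_chord (transport f ?Y) Z"
  proof
    assume "\<exists>Z. delete_chord (transport f ?Y) Z"
    then obtain Z where "delete_chord (transport f ?Y) Z" by blast
    from delete_chord_transport[OF circle_homeo_inv[OF f] on_circle_transport this]
    have "delete_chord (transport (inv f) (transport f ?Y)) (transport (inv f) Z)" .
    moreover have "on_circle ?Y" using delete_chords_subset[OF Y(1)] X on_circle_subset by blast
    ultimately show False using Y(2) transport_inv[OF f] by auto
  qed
  ultimately show "delete_all_spec (transport f X) (transport f ?Y)"
    unfolding delete_all_spec_def by blast
qed

section \<open>The invariant of a homeomorphic image of a Gauss diagram\<close>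

text \<open>An arrow and a precrossing must not share an endpoint: only then \<^const>\<open>alternate\<close> agrees with
  \<^const>\<open>linked\<close> for them.\<close>

definition wf_gauss :: "gauss_diagram \<Rightarrow> bool" where
  "wf_gauss P \<longleftrightarrow> finite (classical P) \<and> finite (precrossings P) \<and>
     (\<forall>(u, v, e) \<in> classical P. u \<in> {0..<1} \<and> v \<in> {0..<1}) \<and>
     (\<forall>(a, b) \<in> precrossings P. a \<in> {0..<1} \<and> b \<in> {0..<1}) \<and>
     (\<forall>(a, b) \<in> precrossings P. \<forall>(u, v, e) \<in> classical P. u \<notin> {a, b} \<and> v \<notin> {a, b})"

lemma wf_gaussD:
  assumes "wf_gauss P"
  shows "(u, v, e) \<in> classical P \<Longrightarrow> u \<in> {0..<1}" "(u, v, e) \<in> classical P \<Longrightarrow> v \<in> {0..<1}"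
    "(a, b) \<in> precrossings P \<Longrightarrow> a \<in> {0..<1}" "(a, b) \<in> precrossings P \<Longrightarrow> b \<in> {0..<1}"
    "(a, b) \<in> precrossings P \<Longrightarrow> (u, v, e) \<in> classical P \<Longrightarrow> u \<notin> {a, b} \<and> v \<notin> {a, b}"
  using assms unfolding wf_gauss_def by blast+

lemma index_eq_linked_sum:
  assumes wf: "wf_gauss P" and ab: "(a, b) \<in> precrossings P"
  shows "index P a b = (\<Sum>(u, v, e) \<in> classical P. if linked a b u v then e else 0)"
proof -
  have eq: "alternate a b u v \<longleftrightarrow> linked a b u v" if "(u, v, e) \<in> classical P" for u v e
    using wf_gaussD[OF wf] wf_gaussD(5)[OF wf ab that] ab that by (intro alternate_iff_linked) blast+
  have "index P a b = (\<Sum>p \<in> {p \<in> classical P. linked a b (fst p) (fst (snd p))}. snd (snd p))"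
    unfolding index_def by (rule sum.cong) (auto simp: eq)
  also have "\<dots> = (\<Sum>p \<in> classical P. if linked a b (fst p) (fst (snd p)) then snd (snd p) else 0)"
    using wf unfolding wf_gauss_def by (intro sum.inter_filter) blast
  finally show ?thesis by (simp add: case_prod_unfold)
qed

lemma wf_gauss_transport:
  assumes f: "circle_homeo f" and wf: "wf_gauss P"
  shows "wf_gauss (transport_gauss f P)"
proof -
  have "frac (f u) \<noteq> frac (f a)"
    if "u \<in> {0..<1}" "a \<in> {0..<1}" "u \<noteq> a" for u a
    using frac_homeo_inj[OF f that(1,2)] that(3) by blast
  then show ?thesis
    using wf unfolding wf_gauss_def transport_gauss_def
    by (simp add: case_prod_unfold frac_lt_1)
qed

lemma prechords_transport:
  assumes f: "circle_homeo f" and wf: "wf_gauss P"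
  shows "prechords (transport_gauss f P) = transport f (prechords P)"
proof -
  let ?g = "\<lambda>(u, v, e :: int). (frac (f u), frac (f v), e)"
  have inj: "inj_on ?g (classical P)"
  proof (rule inj_onI)
    fix p q assume pq: "p \<in> classical P" "q \<in> classical P" "?g p = ?g q"
    obtain u v e u' v' e' where eq: "p = (u, v, e)" "q = (u', v', e')" by (metis prod_cases3)
    with pq have mem: "(u, v, e) \<in> classical P" "(u', v', e') \<in> classical P"
      and fr: "frac (f u) = frac (f u')" "frac (f v) = frac (f v')" "e = e'" by auto
    have "u = u'"
      by (rule frac_homeo_inj[OF f wf_gaussD(1)[OF wf mem(1)] wf_gaussD(1)[OF wf mem(2)] fr(1)])
    moreover have "v = v'"
      by (rule frac_homeo_inj[OF f wf_gaussD(2)[OF wf mem(1)] wf_gaussD(2)[OF wf mem(2)] fr(2)])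
    ultimately show "p = q" using eq fr(3) by simp
  qed
  have idx: "index (transport_gauss f P) (frac (f a)) (frac (f b)) = index P a b"
    if "(a, b) \<in> precrossings P" for a b
  proof -
    have m: "(frac (f a), frac (f b)) \<in> precrossings (transport_gauss f P)"
      using that unfolding transport_gauss_def by force
    have "index (transport_gauss f P) (frac (f a)) (frac (f b)) =
        (\<Sum>p \<in> ?g ` classical P. case p of (u, v, e) \<Rightarrow> if linked (f a) (f b) u v then e else 0)"
      unfolding index_eq_linked_sum[OF wf_gauss_transport[OF f wf] m]
      by (simp add: transport_gauss_def)
    also have "\<dots> = (\<Sum>(u, v, e) \<in> classical P. if linked a b u v then e else 0)"
      by (subst sum.reindex[OF inj], rule sum.cong[OF refl]) (auto simp: linked_homeo[OF f])
    finally show ?thesis by (simp add: index_eq_linked_sum[OF wf that])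
  qed
  have pc: "prechords Q = (\<lambda>p. ({fst p, snd p}, index Q (fst p) (snd p))) ` precrossings Q" for Q
    unfolding prechords_def by force
  have "precrossings (transport_gauss f P) = (\<lambda>p. (frac (f (fst p)), frac (f (snd p)))) ` precrossings P"
    unfolding transport_gauss_def by (simp add: case_prod_unfold)
  then show ?thesis
    unfolding pc transport_def image_image by (simp add: image_image idx cong: image_cong)
qed

lemma on_circle_prechords: "wf_gauss P \<Longrightarrow> on_circle (prechords P)"
  unfolding on_circle_def prechords_def
  using wf_gaussD(3,4) by (auto simp: atLeastLessThan_iff[symmetric] simp del: atLeastLessThan_iff)

lemma finite_prechords: "wf_gauss P \<Longrightarrow> finite (prechords P)"
proof -
  assume "wf_gauss P"
  moreover have "prechords P = (\<lambda>p. ({fst p, snd p}, index P (fst p) (snd p))) ` precrossings P"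
    unfolding prechords_def by force
  ultimately show ?thesis unfolding wf_gauss_def by simp
qed

lemma inv_I_transport:
  assumes "circle_homeo f" "wf_gauss P"
  shows "inv_I (transport_gauss f P) = inv_I P"
  unfolding inv_I_def prechords_transport[OF assms]
    delete_all_transport[OF assms(1) on_circle_prechords[OF assms(2)] finite_prechords[OF assms(2)]]
  by (rule zc_class_transport[OF assms(1)])

section \<open>Counting crossings of a diagram in both orders\<close>

lemma cross_swap: "cross b a = - cross a b"
  unfolding cross_def by (simp add: algebra_simps)

lemma crossing_sym: "crossing D u v \<Longrightarrow> crossing D v u"
  unfolding crossing_def by (metis Ints_minus minus_diff_eq)

lemma gauss_wf:
  assumes D: "pseudodiagram D"
  shows "wf_gauss (gauss D)"
proof -
  let ?X = "{u \<in> {0..<1}. \<exists>v. crossing D u v}"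
  have fin: "finite ?X" using D unfolding pseudodiagram_def by blast
  have "classical (gauss D) \<subseteq> ?X \<times> ?X \<times> {1, - 1}"
    unfolding gauss_def using crossing_sym by auto
  then have c: "finite (classical (gauss D))"
    by (rule finite_subset) (intro finite_SigmaI fin finite.intros)
  have "precrossings (gauss D) \<subseteq> ?X \<times> ?X"
    unfolding gauss_def using crossing_sym by auto
  then have p: "finite (precrossings (gauss D))"
    by (rule finite_subset) (intro finite_SigmaI fin)
  have "u \<notin> {a, b} \<and> v \<notin> {a, b}"
    if "(a, b) \<in> precrossings (gauss D)" "(u, v, e) \<in> classical (gauss D)" for a b u v e
  proof -
    have "mark D a = Pre" "mark D b = Pre" "mark D u = Over" "mark D v = Under"
      using that unfolding gauss_def by auto
    then show ?thesis by auto
  qed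
  moreover have "u \<in> {0..<1} \<and> v \<in> {0..<1}" if "(u, v, e) \<in> classical (gauss D)" for u v e
    using that unfolding gauss_def by auto
  moreover have "a \<in> {0..<1} \<and> b \<in> {0..<1}" if "(a, b) \<in> precrossings (gauss D)" for a b
    using that unfolding gauss_def by auto
  ultimately show ?thesis unfolding wf_gauss_def using c p by blast
qed

text \<open>The sign of a classical crossing in terms of the mark of its first passage. It is symmetric in the
  two passages: exchanging them reverses both the orientation of the pair of velocities and the
  answer to the question whether the first passage is the upper one.\<close>

definition double_sign :: "pdiagram \<Rightarrow> real \<Rightarrow> real \<Rightarrow> int" where
  "double_sign D u v = (if (mark D u = Over) = (cross (vel D u) (vel D v) > 0) then 1 else - 1)"

definition classical_pairs :: "pdiagram \<Rightarrow> (real \<times> real) set" where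
  "classical_pairs D = {(u, v). u \<in> {0..<1} \<and> v \<in> {0..<1} \<and> crossing D u v \<and>
     mark D u \<in> {Over, Under}}"

definition precrossing_pairs :: "pdiagram \<Rightarrow> (real \<times> real) set" where
  "precrossing_pairs D = {(u, v). u \<in> {0..<1} \<and> v \<in> {0..<1} \<and> crossing D u v \<and> mark D u = Pre}"

definition linking :: "pdiagram \<Rightarrow> real \<Rightarrow> real \<Rightarrow> int" where
  "linking D a b = (\<Sum>(u, v) \<in> classical_pairs D. if linked a b u v then double_sign D u v else 0)"

lemma finite_pairs:
  assumes D: "pseudodiagram D"
  shows "finite (classical_pairs D)" "finite (precrossing_pairs D)"
proof -
  let ?X = "{u \<in> {0..<1}. \<exists>v. crossing D u v}"
  have fin: "finite ?X" using D unfolding pseudodiagram_def by blast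
  have "classical_pairs D \<subseteq> ?X \<times> ?X" "precrossing_pairs D \<subseteq> ?X \<times> ?X"
    unfolding classical_pairs_def precrossing_pairs_def using crossing_sym by auto
  then show "finite (classical_pairs D)" "finite (precrossing_pairs D)"
    using fin by (meson finite_SigmaI finite_subset)+
qed

lemma crossing_marks:
  assumes "pseudodiagram D" "crossing D u v"
  shows "(mark D u, mark D v) \<in> {(Over, Under), (Under, Over), (Pre, Pre)}"
  using assms unfolding pseudodiagram_def by blast

lemma crossing_transverse:
  assumes "pseudodiagram D" "crossing D u v"
  shows "cross (vel D u) (vel D v) \<noteq> 0"
  using assms unfolding pseudodiagram_def by blast

lemma double_sign_sym:
  assumes "pseudodiagram D" "crossing D u v" "mark D u \<noteq> Pre"
  shows "double_sign D v u = double_sign D u v"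
  using crossing_marks[OF assms(1,2)] crossing_transverse[OF assms(1,2)] assms(3)
    cross_swap[of "vel D v" "vel D u"]
  unfolding double_sign_def by auto

text \<open>The ordered pairs whose first passage is the upper one correspond to the classical arrows, and the
  remaining pairs contribute the same sum.\<close>

lemma linking_eq_index:
  assumes D: "pseudodiagram D" and ab: "(a, b) \<in> precrossings (gauss D)"
  shows "linking D a b = 2 * index (gauss D) a b"
proof -
  let ?O = "{p \<in> classical_pairs D. mark D (fst p) = Over}"
  let ?U = "{p \<in> classical_pairs D. mark D (fst p) = Under}"
  let ?s = "\<lambda>p. double_sign D (fst p) (snd p)"
  let ?l = "\<lambda>p. if linked a b (fst p) (snd p) then ?s p else 0"
  have fin: "finite ?O" "finite ?U" using finite_pairs(1)[OF D] by auto
  have split: "classical_pairs D = ?O \<union> ?U" unfolding classical_pairs_def by auto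
  have U: "?U = prod.swap ` ?O"
    using crossing_sym crossing_marks[OF D] unfolding classical_pairs_def by force
  have "linking D a b = sum ?l (?O \<union> ?U)"
    unfolding linking_def using split by (simp add: case_prod_unfold)
  also have "\<dots> = sum ?l ?O + sum ?l ?U"
    by (rule sum.union_disjoint) (use fin in auto)
  also have "sum ?l ?U = (\<Sum>p\<in>?O. ?l (prod.swap p))"
    unfolding U by (subst sum.reindex) auto
  also have "\<dots> = sum ?l ?O"
    by (rule sum.cong)
      (auto simp: linked_sym(2)[of a b] double_sign_sym[OF D] classical_pairs_def
        dest: crossing_sym)
  also have "sum ?l ?O = index (gauss D) a b"
  proof -
    have img: "classical (gauss D) = (\<lambda>p. (fst p, snd p, ?s p)) ` ?O" (is "_ = ?g ` _")
    proof (intro equalityI subsetI)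
      fix q assume "q \<in> classical (gauss D)"
      then obtain u v where q: "q = (u, v, if cross (vel D u) (vel D v) > 0 then 1 else - 1)"
        "u \<in> {0..<1}" "v \<in> {0..<1}" "crossing D u v" "mark D u = Over"
        unfolding gauss_def by auto
      then have "(u, v) \<in> ?O" "q = ?g (u, v)" unfolding classical_pairs_def double_sign_def by auto
      then show "q \<in> ?g ` ?O" by (rule rev_image_eqI)
    next
      fix q assume "q \<in> ?g ` ?O"
      then obtain u v where q: "q = ?g (u, v)" "(u, v) \<in> ?O" by auto
      then show "q \<in> classical (gauss D)"
        using crossing_marks[OF D, of u v] unfolding gauss_def classical_pairs_def double_sign_def
        by auto
    qed
    have "inj_on ?g ?O" by (rule inj_onI) auto
    then show ?thesis
      unfolding index_eq_linked_sum[OF gauss_wf[OF D] ab] img by (subst sum.reindex) simp_all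
  qed
  finally show ?thesis by simp
qed

lemma linking_sym: "linking D a b = linking D b a"
  unfolding linking_def by (simp add: linked_sym(1)[of a b])

lemma linking_frac [simp]: "linking D (frac a) b = linking D a b" "linking D a (frac b) = linking D a b"
  unfolding linking_def by simp_all

text \<open>The direction of a precrossing arrow disappears in its prechord, so that both orders of its
  endpoints may be admitted.\<close>

lemma prechords_eq_linking:
  assumes D: "pseudodiagram D"
  shows "prechords (gauss D) = (\<lambda>(a, b). ({a, b}, linking D a b div 2)) ` precrossing_pairs D"
    (is "_ = ?g ` _")
proof (intro equalityI subsetI)
  fix q assume "q \<in> prechords (gauss D)"
  then obtain a b where q: "q = ({a, b}, index (gauss D) a b)" "(a, b) \<in> precrossings (gauss D)"
    unfolding prechords_def by auto
  then have "(a, b) \<in> precrossing_pairs D" unfolding gauss_def precrossing_pairs_def by auto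
  moreover have "q = ?g (a, b)" using q linking_eq_index[OF D q(2)] by simp
  ultimately show "q \<in> ?g ` precrossing_pairs D" by (rule rev_image_eqI)
next
  fix q assume "q \<in> ?g ` precrossing_pairs D"
  then obtain a b where q: "q = ?g (a, b)" "(a, b) \<in> precrossing_pairs D" by auto
  then have ab: "a \<in> {0..<1}" "b \<in> {0..<1}" "crossing D a b" "mark D a = Pre" "mark D b = Pre"
    using crossing_marks[OF D, of a b] unfolding precrossing_pairs_def by auto
  then have "(a, b) \<in> precrossings (gauss D) \<or> (b, a) \<in> precrossings (gauss D)"
    using crossing_transverse[OF D ab(3)] cross_swap[of "vel D a" "vel D b"] crossing_sym[OF ab(3)]
    unfolding gauss_def by auto
  then show "q \<in> prechords (gauss D)"
  proof
    assume m: "(a, b) \<in> precrossings (gauss D)"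
    then have "q = ({a, b}, index (gauss D) a b)" using q linking_eq_index[OF D m] by simp
    with m show ?thesis unfolding prechords_def by blast
  next
    assume m: "(b, a) \<in> precrossings (gauss D)"
    then have "q = ({b, a}, index (gauss D) b a)"
      using q linking_eq_index[OF D m] linking_sym[of D a b] by auto
    with m show ?thesis unfolding prechords_def by blast
  qed
qed

lemma inv_I_eqI:
  assumes "circle_homeo f" "pseudodiagram D"
    and "prechords (gauss D') = transport f (prechords (gauss D))"
  shows "inv_I (gauss D') = inv_I (gauss D)"
  using assms delete_all_transport[OF assms(1) on_circle_prechords finite_prechords]
    zc_class_transport[OF assms(1)] gauss_wf[OF assms(2)]
  unfolding inv_I_def by metis

section \<open>Velocities and planar isotopy\<close>

lemma cross_blinfun:
  "cross (blinfun_apply A a) (blinfun_apply A b) = jacobian A * cross a b"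
proof -
  have e: "blinfun_apply A z = Re z *\<^sub>R blinfun_apply A 1 + Im z *\<^sub>R blinfun_apply A \<i>" for z
  proof -
    have "z = Re z *\<^sub>R 1 + Im z *\<^sub>R \<i>" by (simp add: complex_eq_iff)
    then show ?thesis by (metis blinfun.add_right blinfun.scaleR_right)
  qed
  show ?thesis
    unfolding e[of a] e[of b] jacobian_def cross_def by (simp add: algebra_simps)
qed

lemma cross_scaleR: "cross (r *\<^sub>R a) (s *\<^sub>R b) = r * s * cross a b"
  unfolding cross_def by (simp add: algebra_simps)

lemma has_vel:
  assumes "pseudodiagram D"
  shows "(curve D has_vector_derivative vel D t) (at t)"
  using assms unfolding pseudodiagram_def vel_def C1_differentiable_on_def
  by (metis UNIV_I vector_derivative_at)

lemma continuous_jacobian: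
  assumes "continuous_on S A"
  shows "continuous_on S (\<lambda>x. jacobian (A x))"
  unfolding jacobian_def cross_def by (intro continuous_intros assms)

text \<open>Along the isotopy the Jacobian determinant at \<open>x\<close> is continuous, starts with 1 and never vanishes.\<close>

lemma isotopy_jacobian_pos:
  fixes H :: "real \<Rightarrow> complex \<Rightarrow> complex"
  assumes "H 0 = id" and C1: "\<forall>t\<in>{0..1}. C1_diffeo (H t) (H' t)"
    and cont: "continuous_on ({0..1} \<times> UNIV) (\<lambda>(t, x). H' t x)"
  shows "jacobian (H' 1 x) > 0"
proof -
  have "continuous_on {0..1} (\<lambda>t. (\<lambda>(t, x). H' t x) (t, x))"
    by (rule continuous_on_compose2[OF cont]) (auto intro!: continuous_intros)
  then have c: "continuous_on {0..1} (\<lambda>t. jacobian (H' t x))"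
    by (intro continuous_jacobian) simp
  have nz: "jacobian (H' t x) \<noteq> 0" if "t \<in> {0..1}" for t
    using C1 that unfolding C1_diffeo_def by blast
  have "(id has_derivative blinfun_apply (H' 0 x)) (at x)"
  proof -
    have "C1_diffeo (H 0) (H' 0)" using C1 by simp
    then show ?thesis using assms(1) unfolding C1_diffeo_def by simp
  qed
  then have "blinfun_apply (H' 0 x) = id"
    by (metis has_derivative_id has_derivative_unique id_def)
  then have "jacobian (H' 0 x) = 1" unfolding jacobian_def cross_def by simp
  then have "\<not> jacobian (H' 1 x) < 0"
    using IVT2'[of "\<lambda>t. jacobian (H' t x)" 1 0 0] c nz by force
  with nz[of 1] show ?thesis by simp
qed

lemma circle_diffeo_derivative:
  assumes "circle_diffeo f"
  shows "(f has_real_derivative deriv f t) (at t)" "deriv f t > 0"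
proof -
  obtain g where "(f has_vector_derivative g t) (at t)"
    using assms unfolding circle_diffeo_def C1_differentiable_on_def by blast
  then have "(f has_real_derivative g t) (at t)"
    by (simp add: has_real_derivative_iff_has_vector_derivative)
  then show "(f has_real_derivative deriv f t) (at t)" by (metis DERIV_imp_deriv)
  show "deriv f t > 0" using assms unfolding circle_diffeo_def by blast
qed

lemma circle_homeo_of_diffeo:
  assumes f: "circle_diffeo f"
  shows "circle_homeo f"
  unfolding circle_homeo_def
proof (intro conjI)
  show "\<forall>t. f (t + 1) = f t + 1" using f unfolding circle_diffeo_def by blast
  show "continuous_on UNIV f"
    using circle_diffeo_derivative(1)[OF f] by (meson DERIV_isCont continuous_at_imp_continuous_on)
  show "strict_mono f"
    unfolding strict_mono_def
    by (metis DERIV_pos_imp_increasing circle_diffeo_derivative[OF f])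
qed

lemma pd_periodic:
  assumes "pseudodiagram D"
  shows "curve D (t + of_int n) = curve D t" "mark D (t + of_int n) = mark D t"
proof -
  have p: "curve D (t + 1) = curve D t" "mark D (t + 1) = mark D t" for t
    using assms unfolding pseudodiagram_def by auto
  have "curve D (t + of_int n) = curve D t \<and> mark D (t + of_int n) = mark D t"
  proof (induction n rule: int_induct[where k = 0])
    case (step1 i)
    then show ?case using p[of "t + of_int i"] by (simp add: add.assoc)
  next
    case (step2 i)
    then show ?case using p[of "t + of_int (i - 1)"] by (simp add: algebra_simps)
  qed simp
  then show "curve D (t + of_int n) = curve D t" "mark D (t + of_int n) = mark D t" by auto
qed

lemma pd_frac:
  assumes "pseudodiagram D"
  shows "curve D (frac t) = curve D t" "mark D (frac t) = mark D t" "vel D (frac t) = vel D t"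
proof -
  have e: "t = frac t + of_int \<lfloor>t\<rfloor>" for t :: real by (simp add: frac_def)
  show "curve D (frac t) = curve D t" "mark D (frac t) = mark D t"
    using pd_periodic[OF assms, of "frac t" "\<lfloor>t\<rfloor>"] e[of t] by simp_all
  have "((\<lambda>u. u + of_int \<lfloor>t\<rfloor>) has_vector_derivative 1) (at (frac t))"
    by (auto intro!: derivative_eq_intros)
  moreover have "(curve D has_vector_derivative vel D t) (at (frac t + of_int \<lfloor>t\<rfloor>))"
    using has_vel[OF assms, of t] e[of t] by simp
  ultimately have "(curve D \<circ> (\<lambda>u. u + of_int \<lfloor>t\<rfloor>) has_vector_derivative 1 *\<^sub>R vel D t) (at (frac t))"
    by (rule vector_diff_chain_at)
  moreover have "curve D \<circ> (\<lambda>u. u + of_int \<lfloor>t\<rfloor>) = curve D"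
    using pd_periodic[OF assms] by auto
  ultimately show "vel D (frac t) = vel D t"
    unfolding vel_def[of D "frac t"] by (simp add: vector_derivative_at)
qed

lemma crossing_frac:
  assumes "pseudodiagram D"
  shows "crossing D (frac u) v = crossing D u v" "crossing D u (frac v) = crossing D u v"
proof -
  have shift: "x - of_int n \<in> \<int> \<longleftrightarrow> x \<in> \<int>" "x + of_int n \<in> \<int> \<longleftrightarrow> x \<in> \<int>" for x :: real and n
    by (metis Ints_add Ints_diff Ints_of_int diff_add_cancel add_diff_cancel_right')+
  have "frac u - v \<in> \<int> \<longleftrightarrow> u - v \<in> \<int>" "u - frac v \<in> \<int> \<longleftrightarrow> u - v \<in> \<int>"
    using shift(1)[of "u - v" "\<lfloor>u\<rfloor>"] shift(2)[of "u - v" "\<lfloor>v\<rfloor>"]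
    unfolding frac_def by (simp_all add: algebra_simps)
  then show "crossing D (frac u) v = crossing D u v" "crossing D u (frac v) = crossing D u v"
    unfolding crossing_def pd_frac[OF assms] by auto
qed

lemma frac_unit: "frac u \<in> {0..<1}" for u :: real
  by (simp add: frac_lt_1)

text \<open>The change of parameter of the isotopy is a homeomorphism of the circle that carries the Gauss
  diagram of \<open>D'\<close> to the Gauss diagram of \<open>D\<close>.\<close>

lemma inv_I_isotopic:
  assumes "isotopic D D'"
  shows "inv_I (gauss D) = inv_I (gauss D')"
proof -
  have D: "pseudodiagram D" and D': "pseudodiagram D'" using assms unfolding isotopic_def by auto
  obtain H f where H: "plane_isotopy H" and f: "circle_diffeo f"
    and cD: "curve D' = H 1 \<circ> curve D \<circ> f" and mD: "mark D' = mark D \<circ> f"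
    using assms unfolding isotopic_def by blast
  obtain H' where H0: "H 0 = id" and C1: "\<forall>t\<in>{0..1}. C1_diffeo (H t) (H' t)"
    and cont: "continuous_on ({0..1} \<times> UNIV) (\<lambda>(t, x). H' t x)"
    using H unfolding plane_isotopy_def by blast
  have pos: "jacobian (H' 1 x) > 0" for x by (rule isotopy_jacobian_pos[OF H0 C1 cont])
  have H1: "(H 1 has_derivative blinfun_apply (H' 1 x)) (at x)" "inj (H 1)" for x
    using C1 unfolding C1_diffeo_def by (auto simp: bij_is_inj)
  have fh: "circle_homeo f" by (rule circle_homeo_of_diffeo[OF f])
  have vel: "vel D' u = blinfun_apply (H' 1 (curve D (f u))) (deriv f u *\<^sub>R vel D (f u))" for u
  proof -
    have "(f has_vector_derivative deriv f u) (at u)"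
      using circle_diffeo_derivative(1)[OF f] by (simp add: has_real_derivative_iff_has_vector_derivative)
    then have "(curve D \<circ> f has_vector_derivative deriv f u *\<^sub>R vel D (f u)) (at u)"
      by (rule vector_diff_chain_at) (rule has_vel[OF D])
    then have "(H 1 \<circ> (curve D \<circ> f) has_vector_derivative
        blinfun_apply (H' 1 (curve D (f u))) (deriv f u *\<^sub>R vel D (f u))) (at u)"
      by (rule vector_derivative_diff_chain_within) (simp add: H1(1) has_derivative_at_withinI)
    then show ?thesis unfolding vel_def[of D'] cD by (simp add: comp_assoc vector_derivative_at)
  qed
  have sgn: "cross (vel D' u) (vel D' v) > 0 \<longleftrightarrow> cross (vel D (f u)) (vel D (f v)) > 0"
    if "curve D (f u) = curve D (f v)" for u v
    using pos[of "curve D (f v)"] circle_diffeo_derivative(2)[OF f, of u]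
      circle_diffeo_derivative(2)[OF f, of v]
    unfolding vel that cross_blinfun cross_scaleR by (auto simp: zero_less_mult_iff mult_less_0_iff)
  have Ints: "u - v \<in> \<int> \<longleftrightarrow> f u - f v \<in> \<int>" for u v
  proof
    assume "u - v \<in> \<int>"
    then obtain n where "u = v + of_int n" by (metis Ints_cases add.commute diff_add_cancel)
    then show "f u - f v \<in> \<int>" using circle_homeo_int[OF fh] by simp
  next
    assume "f u - f v \<in> \<int>"
    then obtain n where "f u = f v + of_int n" by (metis Ints_cases add.commute diff_add_cancel)
    then have "f u = f (v + of_int n)" using circle_homeo_int[OF fh] by simp
    then have "u = v + of_int n" by (metis circle_homeo_inv_simps(1)[OF fh])
    then show "u - v \<in> \<int>" by simp
  qed
  have cr: "crossing D' u v \<longleftrightarrow> crossing D (f u) (f v)" for u v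
    unfolding crossing_def cD using Ints[of u v] inj_eq[OF H1(2)] by simp
  have cr': "curve D (f u) = curve D (f v)" if "crossing D' u v" for u v
    using that unfolding cr unfolding crossing_def by blast
  have surj: "\<exists>x \<in> {0..<1}. u = frac (f x)" if "u \<in> {0..<1}" for u
  proof
    show "frac (inv f u) \<in> {0..<1}" by (rule frac_unit)
    show "u = frac (f (frac (inv f u)))"
      using that by (simp add: frac_homeo_frac[OF fh] circle_homeo_inv_simps[OF fh] frac_eq)
  qed
  have "gauss D = transport_gauss f (gauss D')"
  proof -
    have 1: "classical (gauss D) = classical (transport_gauss f (gauss D'))"
    proof (intro equalityI subsetI)
      fix q assume "q \<in> classical (gauss D)"
      then obtain u v where q: "q = (u, v, if cross (vel D u) (vel D v) > 0 then 1 else - 1)"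
        "u \<in> {0..<1}" "v \<in> {0..<1}" "crossing D u v" "mark D u = Over" "mark D v = Under"
        unfolding gauss_def by auto
      obtain x y where xy: "x \<in> {0..<1}" "u = frac (f x)" "y \<in> {0..<1}" "v = frac (f y)"
        using surj q by blast
      have c: "crossing D' x y" using q(4) unfolding cr xy crossing_frac[OF D] .
      have "(x, y, if cross (vel D' x) (vel D' y) > 0 then 1 else - 1) \<in> classical (gauss D')"
        using q(5,6) c xy(1,3) unfolding gauss_def xy mD pd_frac[OF D] by auto
      then show "q \<in> classical (transport_gauss f (gauss D'))"
        unfolding transport_gauss_def q(1) xy pd_frac[OF D] sgn[OF cr'[OF c]] by force
    next
      fix q assume "q \<in> classical (transport_gauss f (gauss D'))"
      then obtain x y where q: "q = (frac (f x), frac (f y), if cross (vel D' x) (vel D' y) > 0 then 1 else - 1)"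
        "crossing D' x y" "mark D' x = Over" "mark D' y = Under"
        unfolding gauss_def transport_gauss_def by auto
      show "q \<in> classical (gauss D)"
        unfolding q(1) sgn[OF cr'[OF q(2)]] gauss_def
        using q(2-4) frac_unit unfolding cr mD
        by (simp add: pd_frac[OF D] crossing_frac[OF D] frac_lt_1)
    qed
    have 2: "precrossings (gauss D) = precrossings (transport_gauss f (gauss D'))"
    proof (intro equalityI subsetI)
      fix q assume "q \<in> precrossings (gauss D)"
      then obtain u v where q: "q = (u, v)" "cross (vel D u) (vel D v) > 0"
        "u \<in> {0..<1}" "v \<in> {0..<1}" "crossing D u v" "mark D u = Pre" "mark D v = Pre"
        unfolding gauss_def by auto
      obtain x y where xy: "x \<in> {0..<1}" "u = frac (f x)" "y \<in> {0..<1}" "v = frac (f y)"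
        using surj q by blast
      have c: "crossing D' x y" using q(5) unfolding cr xy crossing_frac[OF D] .
      have "(x, y) \<in> precrossings (gauss D')"
        using q(2,6,7) c xy(1,3) sgn[OF cr'[OF c]] unfolding gauss_def xy mD pd_frac[OF D] by auto
      then show "q \<in> precrossings (transport_gauss f (gauss D'))"
        unfolding transport_gauss_def q(1) xy by force
    next
      fix q assume "q \<in> precrossings (transport_gauss f (gauss D'))"
      then obtain x y where q: "q = (frac (f x), frac (f y))"
        "crossing D' x y" "mark D' x = Pre" "mark D' y = Pre" "cross (vel D' x) (vel D' y) > 0"
        unfolding gauss_def transport_gauss_def by auto
      show "q \<in> precrossings (gauss D)"
        using q(5) unfolding q(1) sgn[OF cr'[OF q(2)]] gauss_def
        using q(2-4) frac_unit unfolding cr mD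
        by (simp add: pd_frac[OF D] crossing_frac[OF D] frac_lt_1)
    qed
    show ?thesis using 1 2 by simp
  qed
  then show ?thesis using inv_I_transport[OF fh gauss_wf[OF D']] by simp
qed

section \<open>Arcs on the circle\<close>

text \<open>On the way from \<open>p\<close> to \<open>q\<close> the floor of the difference to \<open>a\<close> can jump only at a translate of \<open>a\<close>
  by an integer.\<close>

lemma floor_const_between:
  fixes p q a :: real
  assumes "\<And>y. min p q \<le> y \<Longrightarrow> y \<le> max p q \<Longrightarrow> y - a \<notin> \<int>"
  shows "\<lfloor>p - a\<rfloor> = \<lfloor>q - a\<rfloor>" "\<lfloor>a - p\<rfloor> = \<lfloor>a - q\<rfloor>"
proof -
  have less: "\<not> \<lfloor>x - a\<rfloor> < \<lfloor>y - a\<rfloor>" if "{x, y} = {p, q}" for x y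
  proof
    assume l: "\<lfloor>x - a\<rfloor> < \<lfloor>y - a\<rfloor>"
    let ?z = "a + of_int \<lfloor>y - a\<rfloor>"
    have "x \<le> ?z" "?z \<le> y" using l by linarith+
    moreover have "min p q = min x y" "max p q = max x y" using that by (auto simp: doubleton_eq_iff min_def max_def)
    ultimately have "?z - a \<notin> \<int>" by (intro assms) auto
    then show False by simp
  qed
  show e: "\<lfloor>p - a\<rfloor> = \<lfloor>q - a\<rfloor>" using less[of p q] less[of q p] by fastforce
  have "p - a \<notin> \<int>" "q - a \<notin> \<int>" using assms[of p] assms[of q] by simp_all
  then show "\<lfloor>a - p\<rfloor> = \<lfloor>a - q\<rfloor>"
    using floor_uminus[of "p - a"] floor_uminus[of "q - a"] e by simp
qed

lemma frac_eq_iff_Ints: "frac u = frac v \<longleftrightarrow> u - v \<in> \<int>" for u v :: real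
proof
  assume "frac u = frac v"
  then have "u - v = of_int (\<lfloor>u\<rfloor> - \<lfloor>v\<rfloor>)" by (simp add: frac_def)
  then show "u - v \<in> \<int>" by (metis Ints_of_int)
next
  assume "u - v \<in> \<int>"
  then obtain m where "u = v + of_int m" by (metis Ints_cases add.commute diff_add_cancel)
  then show "frac u = frac v" by (simp add: frac_def)
qed

text \<open>The arcs of a local picture as subsets of the circle: arc \<open>k\<close> consists of the points
  \<open>s k + r k * t\<close> with \<open>t\<close> in \<open>{-1..1}\<close>, up to integers, and different arcs are disjoint.\<close>

locale strands =
  fixes n :: nat and s r :: "nat \<Rightarrow> real"
  assumes r_nonzero: "k < n \<Longrightarrow> r k \<noteq> 0"
    and disjoint: "inj_on (\<lambda>(k, t). frac (s k + r k * t)) ({..<n} \<times> {-1..1})"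
begin

abbreviation pt :: "nat \<Rightarrow> real \<Rightarrow> real" where
  "pt k t \<equiv> s k + r k * t"

abbreviation W :: "real set" where
  "W \<equiv> window n s r"

lemma pt_unique:
  assumes "i < n" "j < n" "t \<in> {-1..1}" "t' \<in> {-1..1}" "pt i t - pt j t' \<in> \<int>"
  shows "i = j \<and> t = t'"
  using inj_onD[OF disjoint, of "(i, t)" "(j, t')"] assms by (auto simp: frac_eq_iff_Ints)

lemma pt_unique':
  assumes "i < n" "j < n" "t \<in> {-1..1}" "t' \<in> {-1..1}" "pt i t + of_int m = pt j t' + of_int m'"
  shows "i = j \<and> t = t' \<and> m = m'"
proof -
  have "pt i t - pt j t' = of_int (m' - m)" using assms(5) by simp
  then have "i = j \<and> t = t'" using pt_unique[OF assms(1-4)] by (metis Ints_of_int)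
  then show ?thesis using assms(5) by simp
qed

lemma pt_in_window: "k < n \<Longrightarrow> t \<in> {-1..1} \<Longrightarrow> pt k t + of_int m \<in> W"
  unfolding window_def mem_Collect_eq frac_eq_iff_Ints
  by (rule exI[of _ k]) (auto intro!: bexI[of _ t])

lemma windowE:
  assumes "u \<in> W"
  obtains k t m where "k < n" "t \<in> {-1..1}" "u = pt k t + of_int m"
proof -
  obtain k t where k: "k < n" "t \<in> {-1..1}" "u - pt k t \<in> \<int>"
    using assms unfolding window_def by (auto simp: frac_eq_iff_Ints)
  then obtain m where "u - pt k t = of_int m" by (metis Ints_cases)
  then have "u = pt k t + of_int m" by simp
  with k that show ?thesis by blast
qed

lemma window_shift: "u + of_int m \<in> W \<longleftrightarrow> u \<in> W"
proof -
  have "frac (u + of_int m) = frac u" by (simp add: frac_def)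
  then show ?thesis unfolding window_def by simp
qed

lemma window_frac: "frac u \<in> W \<longleftrightarrow> u \<in> W"
  unfolding window_def by simp

lemma closed_window: "closed W"
proof -
  have "W = (\<Union>k<n. \<Union>x\<in>(\<lambda>t. pt k t) ` {-1..1}. \<Union>y\<in>\<int>. {x + y})" (is "_ = ?R")
  proof (intro equalityI subsetI)
    fix u assume "u \<in> W"
    then obtain k t m where "k < n" "t \<in> {-1..1}" "u = pt k t + of_int m" by (rule windowE)
    then show "u \<in> ?R"
      by (intro UN_I[of k] UN_I[of "pt k t"] UN_I[of "of_int m"]) (auto simp del: atLeastAtMost_iff)
  next
    fix u assume "u \<in> ?R"
    then obtain k t y where "k < n" "t \<in> {-1..1}" "y \<in> \<int>" "u = pt k t + y" by blast
    then show "u \<in> W" by (metis Ints_cases pt_in_window)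
  qed
  moreover have "closed (\<Union>x\<in>(\<lambda>t. pt k t) ` {-1..1}. \<Union>y\<in>\<int>. {x + y})" for k
    by (intro compact_closed_sums compact_continuous_image continuous_intros closed_Ints compact_Icc)
  ultimately show ?thesis by (metis (no_types, lifting) closed_UN finite_lessThan)
qed

text \<open>A longer arc would meet itself on the circle.\<close>

lemma r_small: "k < n \<Longrightarrow> \<bar>r k\<bar> < 1 / 2"
proof (rule ccontr)
  assume k: "k < n" and "\<not> \<bar>r k\<bar> < 1 / 2"
  then have a: "1 / \<bar>r k\<bar> \<le> 2" "1 / \<bar>r k\<bar> > 0" using r_nonzero[OF k] by (auto simp: field_simps)
  have "r k * (1 / \<bar>r k\<bar>) = 1 \<or> r k * (1 / \<bar>r k\<bar>) = - 1" using r_nonzero[OF k] by (auto simp: abs_if)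
  then have "pt k (- 1 + 1 / \<bar>r k\<bar>) - pt k (- 1) \<in> \<int>" by (auto simp: algebra_simps)
  then have "- 1 + 1 / \<bar>r k\<bar> = - 1" using k a by (intro conjunct2[OF pt_unique]) auto
  with a show False by simp
qed

text \<open>Seen from a point off an arc, all points of the arc lie in the same place.\<close>

lemma floor_arc:
  assumes k: "k < n" "t \<in> {-1..1}" "t' \<in> {-1..1}" and a: "\<And>\<tau>. \<tau> \<in> {-1..1} \<Longrightarrow> pt k \<tau> - a \<notin> \<int>"
  shows "\<lfloor>pt k t - a\<rfloor> = \<lfloor>pt k t' - a\<rfloor>" "\<lfloor>a - pt k t\<rfloor> = \<lfloor>a - pt k t'\<rfloor>"
proof -
  have "y - a \<notin> \<int>" if y: "min (pt k t) (pt k t') \<le> y" "y \<le> max (pt k t) (pt k t')" for y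
  proof -
    let ?\<tau> = "(y - s k) / r k"
    have abs: "\<bar>r k * t\<bar> \<le> \<bar>r k\<bar>" "\<bar>r k * t'\<bar> \<le> \<bar>r k\<bar>"
      using k by (auto simp: abs_mult intro!: mult_left_le)
    have "\<bar>y - s k\<bar> \<le> \<bar>r k\<bar>" using y abs unfolding min_def max_def by (auto split: if_splits)
    then have "\<bar>?\<tau>\<bar> \<le> 1" using r_nonzero[OF k(1)] by (simp only: abs_divide divide_le_eq) simp
    then have "?\<tau> \<in> {-1..1}" unfolding abs_le_iff by simp
    moreover have "pt k ?\<tau> = y" using r_nonzero[OF k(1)] by simp
    ultimately show ?thesis using a by metis
  qed
  then show "\<lfloor>pt k t - a\<rfloor> = \<lfloor>pt k t' - a\<rfloor>" "\<lfloor>a - pt k t\<rfloor> = \<lfloor>a - pt k t'\<rfloor>"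
    using floor_const_between by blast+
qed

lemma pt_off_window:
  assumes "k < n" "\<tau> \<in> {-1..1}" "a \<notin> W"
  shows "pt k \<tau> - a \<notin> \<int>"
proof
  assume "pt k \<tau> - a \<in> \<int>"
  then obtain m where "pt k \<tau> - a = of_int m" by (metis Ints_cases)
  then have "a = pt k \<tau> + of_int (- m)" by simp
  then show False using assms pt_in_window by metis
qed

lemma floor_arc_off_window:
  assumes "k < n" "t \<in> {-1..1}" "t' \<in> {-1..1}" "a \<notin> W"
  shows "\<lfloor>pt k t - a\<rfloor> = \<lfloor>pt k t' - a\<rfloor>" "\<lfloor>a - pt k t\<rfloor> = \<lfloor>a - pt k t'\<rfloor>"
  using floor_arc[OF assms(1-3)] pt_off_window[OF assms(1) _ assms(4)] by blast+

lemma floor_arc_arc: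
  assumes "k < n" "t \<in> {-1..1}" "t' \<in> {-1..1}" "j < n" "\<tau> \<in> {-1..1}" "j \<noteq> k"
  shows "\<lfloor>pt k t - pt j \<tau>\<rfloor> = \<lfloor>pt k t' - pt j \<tau>\<rfloor>" "\<lfloor>pt j \<tau> - pt k t\<rfloor> = \<lfloor>pt j \<tau> - pt k t'\<rfloor>"
  using floor_arc[OF assms(1-3), of "pt j \<tau>"] pt_unique[OF assms(1,4) _ assms(5)] assms(6)
  by blast+

text \<open>The reflection of every arc in its midpoint.\<close>

definition slide :: "real \<Rightarrow> real" where
  "slide u = (if u \<in> W
     then (THE v. \<exists>k<n. \<exists>t\<in>{-1..1}. \<exists>m::int. u = pt k t + of_int m \<and> v = pt k (- t) + of_int m)
     else u)"

lemma slide_pt: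
  assumes "k < n" "t \<in> {-1..1}"
  shows "slide (pt k t + of_int m) = pt k (- t) + of_int m"
proof -
  have "(THE v. \<exists>j<n. \<exists>\<tau>\<in>{-1..1}. \<exists>m'::int. pt k t + of_int m = pt j \<tau> + of_int m' \<and>
      v = pt j (- \<tau>) + of_int m') = pt k (- t) + of_int m"
  proof (rule the_equality)
    show "\<exists>j<n. \<exists>\<tau>\<in>{-1..1}. \<exists>m'::int. pt k t + of_int m = pt j \<tau> + of_int m' \<and>
      pt k (- t) + of_int m = pt j (- \<tau>) + of_int m'"
      using assms by blast
    fix v assume "\<exists>j<n. \<exists>\<tau>\<in>{-1..1}. \<exists>m'::int. pt k t + of_int m = pt j \<tau> + of_int m' \<and>
      v = pt j (- \<tau>) + of_int m'"
    then obtain j \<tau> m' where j: "j < n" "\<tau> \<in> {-1..1}" "pt k t + of_int m = pt j \<tau> + of_int m'"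
      "v = pt j (- \<tau>) + of_int m'" by blast
    from pt_unique'[OF assms(1) j(1) assms(2) j(2,3)] j(4)
    show "v = pt k (- t) + of_int m" by simp
  qed
  then show ?thesis unfolding slide_def using pt_in_window[OF assms] by simp
qed

lemma slide_pt0: "k < n \<Longrightarrow> t \<in> {-1..1} \<Longrightarrow> slide (pt k t) = pt k (- t)"
  using slide_pt[of k t 0] by simp

lemma slide_outside: "u \<notin> W \<Longrightarrow> slide u = u"
  unfolding slide_def by simp

lemma slide_int: "slide (u + of_int m) = slide u + of_int m"
proof (cases "u \<in> W")
  case True
  then obtain k t m' where k: "k < n" "t \<in> {-1..1}" "u = pt k t + of_int m'" by (rule windowE)
  then have "u + of_int m = pt k t + of_int (m' + m)" by simp
  then show ?thesis using slide_pt[OF k(1,2)] k(3) by (metis add.assoc of_int_add)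
next
  case False
  then show ?thesis by (simp add: slide_outside window_shift)
qed

lemma slide_slide: "slide (slide u) = u"
proof (cases "u \<in> W")
  case True
  then obtain k t m' where k: "k < n" "t \<in> {-1..1}" "u = pt k t + of_int m'" by (rule windowE)
  then show ?thesis using slide_pt[OF k(1), of t m'] slide_pt[OF k(1), of "- t" m'] by simp
qed (simp add: slide_outside)

lemma slide_window: "slide u \<in> W \<longleftrightarrow> u \<in> W"
proof -
  have "slide u \<in> W" if "u \<in> W" for u
  proof -
    obtain k t m' where k: "k < n" "t \<in> {-1..1}" "u = pt k t + of_int m'" using \<open>u \<in> W\<close> by (rule windowE)
    then show ?thesis using slide_pt[OF k(1,2)] pt_in_window[of k "- t" m'] by simp
  qed
  then show ?thesis using slide_slide by metis
qed

lemma frac_slide_frac: "frac (slide (frac u)) = frac (slide u)"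
proof -
  have "slide u = slide (frac u) + of_int \<lfloor>u\<rfloor>" using slide_int[of "frac u" "\<lfloor>u\<rfloor>"] by (simp add: frac_def)
  then show ?thesis by (simp add: frac_def)
qed

definition same_arc :: "real \<Rightarrow> real \<Rightarrow> bool" where
  "same_arc u a \<longleftrightarrow> (\<exists>k<n. \<exists>t\<in>{-1..1}. \<exists>t'\<in>{-1..1}. \<exists>m m'. u = pt k t + of_int m \<and> a = pt k t' + of_int m')"

text \<open>The two points can be reflected one after the other, and each of them moves along an arc that does
  not contain the other one.\<close>

lemma slide_floor:
  assumes "\<not> same_arc u a"
  shows "\<lfloor>slide u - slide a\<rfloor> = \<lfloor>u - a\<rfloor>"
proof -
  have shift: "\<lfloor>x + of_int m - y\<rfloor> = \<lfloor>x - y\<rfloor> + m" "\<lfloor>y - (x + of_int m)\<rfloor> = \<lfloor>y - x\<rfloor> - m" for x y :: real and m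
    by linarith+
  show ?thesis
  proof (cases "u \<in> W")
    case u: True
    then obtain k t m where k: "k < n" "t \<in> {-1..1}" "u = pt k t + of_int m" by (rule windowE)
    then have k': "- t \<in> {-1..1}" by auto
    show ?thesis
    proof (cases "a \<in> W")
      case True
      then obtain j \<tau> m' where j: "j < n" "\<tau> \<in> {-1..1}" "a = pt j \<tau> + of_int m'" by (rule windowE)
      have ne: "j \<noteq> k" using assms k j unfolding same_arc_def by blast
      have j': "- \<tau> \<in> {-1..1}" using j by auto
      show ?thesis
        unfolding k(3) j(3) slide_pt[OF k(1,2)] slide_pt[OF j(1,2)] shift
        using floor_arc_arc(1)[OF k(1,2) k' j(1,2) ne] floor_arc_arc(2)[OF j(1,2) j' k(1) k' ne[symmetric]]
        by simp
    next
      case False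
      then show ?thesis
        unfolding slide_outside[OF False] k(3) slide_pt[OF k(1,2)] shift
        using floor_arc_off_window(1)[OF k(1,2) k'] by simp
    qed
  next
    case u: False
    show ?thesis
    proof (cases "a \<in> W")
      case True
      then obtain j \<tau> m' where j: "j < n" "\<tau> \<in> {-1..1}" "a = pt j \<tau> + of_int m'" by (rule windowE)
      then have j': "- \<tau> \<in> {-1..1}" by auto
      show ?thesis
        unfolding slide_outside[OF u] j(3) slide_pt[OF j(1,2)] shift
        using floor_arc_off_window(2)[OF j(1,2) j' u] by simp
    qed (simp add: slide_outside u)
  qed
qed

lemma same_arc_outside: "u \<notin> W \<or> a \<notin> W \<Longrightarrow> \<not> same_arc u a"
  unfolding same_arc_def using pt_in_window by blast

end

section \<open>Diagrams that show a local picture\<close>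

text \<open>The plane is connected and the Jacobian determinant does not vanish, so it has the same sign
  everywhere.\<close>

lemma diffeo_sign:
  assumes "C1_diffeo \<phi> \<phi>'"
  shows "jacobian (\<phi>' x) > 0 \<longleftrightarrow> jacobian (\<phi>' y) > 0"
proof -
  have c: "continuous_on UNIV \<phi>'" and nz: "\<And>x. jacobian (\<phi>' x) \<noteq> 0"
    using assms unfolding C1_diffeo_def by auto
  have pos: "jacobian (\<phi>' y) > 0" if x: "jacobian (\<phi>' x) > 0" for x y
  proof -
    let ?j = "\<lambda>t :: real. jacobian (\<phi>' (x + of_real t * (y - x)))"
    have "continuous_on {0..1} ?j"
      by (intro continuous_jacobian continuous_on_compose2[OF c] continuous_intros) auto
    moreover have "?j 0 = jacobian (\<phi>' x)" "?j 1 = jacobian (\<phi>' y)" by auto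
    ultimately have "\<not> jacobian (\<phi>' y) < 0"
      using IVT2'[of ?j 1 0 0] nz x by force
    with nz show ?thesis by (metis linorder_neqE_linordered_idom)
  qed
  then show ?thesis by blast
qed

lemma mult_pos_iff: "x \<noteq> 0 \<Longrightarrow> y \<noteq> 0 \<Longrightarrow> x * y > 0 \<longleftrightarrow> (x > 0) = (y > 0)" for x y :: real
  by (auto simp: zero_less_mult_iff)

lemma divide_pos_iff: "x \<noteq> 0 \<Longrightarrow> y \<noteq> 0 \<Longrightarrow> x / y > 0 \<longleftrightarrow> (x > 0) = (y > 0)" for x y :: real
  by (auto simp: zero_less_divide_iff)

text \<open>The diagram \<open>D\<close> shows the arcs \<open>c\<close> with the velocities \<open>dc\<close>. The last assumption says that double
  points of the picture are not at the ends of arcs, so that the velocities of the curve at double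
  points are determined by the picture.\<close>

locale local_picture = strands n s r
  for n :: nat and s r :: "nat \<Rightarrow> real" +
  fixes c dc :: "nat \<Rightarrow> real \<Rightarrow> complex"
    and \<phi> :: "complex \<Rightarrow> complex" and \<phi>' :: "complex \<Rightarrow> complex \<Rightarrow>\<^sub>L complex"
    and D :: pdiagram
  assumes diagram: "pseudodiagram D"
    and diffeo: "C1_diffeo \<phi> \<phi>'"
    and shown: "k < n \<Longrightarrow> t \<in> {-1..1} \<Longrightarrow> curve D (pt k t) = \<phi> (c k t)"
    and outside: "u \<notin> W \<Longrightarrow> curve D u \<notin> \<phi> ` square"
    and in_square: "k < n \<Longrightarrow> t \<in> {-1..1} \<Longrightarrow> c k t \<in> square"
    and arc_derivative: "k < n \<Longrightarrow> t \<in> {-1<..<1} \<Longrightarrow> (c k has_vector_derivative dc k t) (at t)"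
    and interior: "i < n \<Longrightarrow> j < n \<Longrightarrow> t \<in> {-1..1} \<Longrightarrow> t' \<in> {-1..1} \<Longrightarrow> c i t = c j t' \<Longrightarrow>
      (i, t) \<noteq> (j, t') \<Longrightarrow> t \<in> {-1<..<1}"
begin

lemma crossing_pt:
  assumes "i < n" "j < n" "t \<in> {-1..1}" "t' \<in> {-1..1}"
  shows "crossing D (pt i t) (pt j t') \<longleftrightarrow> c i t = c j t' \<and> (i, t) \<noteq> (j, t')"
proof -
  have "inj \<phi>" using diffeo unfolding C1_diffeo_def by (simp add: bij_is_inj)
  then have "curve D (pt i t) = curve D (pt j t') \<longleftrightarrow> c i t = c j t'"
    using shown assms by (simp add: inj_eq)
  moreover have "pt i t - pt j t' \<notin> \<int> \<longleftrightarrow> (i, t) \<noteq> (j, t')"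
    using pt_unique[OF assms] by auto
  ultimately show ?thesis unfolding crossing_def by simp
qed

lemma crossing_shift: "crossing D (u + of_int m) (v + of_int m') = crossing D u v"
proof -
  have "frac (u + of_int m) = frac u" "frac (v + of_int m') = frac v" by (simp_all add: frac_def)
  then show ?thesis using crossing_frac[OF diagram] by metis
qed

lemma crossing_window:
  assumes "crossing D u v" "u \<in> W"
  shows "v \<in> W"
proof (rule ccontr)
  assume "v \<notin> W"
  obtain k t m where k: "k < n" "t \<in> {-1..1}" "u = pt k t + of_int m" using assms(2) by (rule windowE)
  then have "curve D u = \<phi> (c k t)" using pd_periodic(1)[OF diagram] shown by simp
  then have "curve D v \<in> \<phi> ` square"
    using assms(1) in_square[OF k(1,2)] unfolding crossing_def by (metis imageI)
  with outside[OF \<open>v \<notin> W\<close>] show False by simp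
qed

lemma crossing_in_windowE:
  assumes "crossing D u v" "u \<in> W"
  obtains i j t t' m m' where "i < n" "j < n" "t \<in> {-1<..<1}" "t' \<in> {-1<..<1}"
    "u = pt i t + of_int m" "v = pt j t' + of_int m'" "c i t = c j t'" "(i, t) \<noteq> (j, t')"
    "crossing D (pt i t) (pt j t')"
proof -
  obtain i t m where i: "i < n" "t \<in> {-1..1}" "u = pt i t + of_int m" using assms(2) by (rule windowE)
  obtain j t' m' where j: "j < n" "t' \<in> {-1..1}" "v = pt j t' + of_int m'"
    using crossing_window[OF assms] by (rule windowE)
  have cr: "crossing D (pt i t) (pt j t')" using assms(1) unfolding i(3) j(3) crossing_shift .
  then have e: "c i t = c j t'" "(i, t) \<noteq> (j, t')" unfolding crossing_pt[OF i(1) j(1) i(2) j(2)] by auto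
  show ?thesis
    using that[OF i(1) j(1) interior[OF i(1) j(1) i(2) j(2) e]
        interior[OF j(1) i(1) j(2) i(2) e(1)[symmetric] e(2)[symmetric]] i(3) j(3) e cr] .
qed

lemma vel_pt:
  assumes "k < n" "t \<in> {-1<..<1}"
  shows "vel D (pt k t) = (1 / r k) *\<^sub>R blinfun_apply (\<phi>' (c k t)) (dc k t)"
proof -
  have lin: "((\<lambda>t. pt k t) has_vector_derivative r k) (at t)"
    by (auto intro!: derivative_eq_intros simp: has_real_derivative_iff_has_vector_derivative[symmetric])
  have "((curve D \<circ> pt k) has_vector_derivative r k *\<^sub>R vel D (pt k t)) (at t)"
    by (rule vector_diff_chain_at[OF lin has_vel[OF diagram]])
  moreover have "((\<phi> \<circ> c k) has_vector_derivative blinfun_apply (\<phi>' (c k t)) (dc k t)) (at t)"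
    using diffeo arc_derivative[OF assms] unfolding C1_diffeo_def
    by (intro vector_derivative_diff_chain_within) (auto simp: has_derivative_at_withinI)
  then have "((curve D \<circ> pt k) has_vector_derivative blinfun_apply (\<phi>' (c k t)) (dc k t)) (at t)"
    by (rule has_vector_derivative_transform_within_open[where S = "{-1<..<1}"])
      (use assms shown[OF assms(1)] in auto)
  ultimately have "r k *\<^sub>R vel D (pt k t) = blinfun_apply (\<phi>' (c k t)) (dc k t)"
    by (rule vector_derivative_unique_at)
  then show ?thesis using r_nonzero[OF assms(1)]
    by (metis divide_inverse_commute mult.right_neutral scaleR_left_imp_eq scaleR_scaleR
        inverse_eq_divide right_inverse scaleR_one)
qed

lemma cross_vel_pt:
  assumes "i < n" "j < n" "t \<in> {-1<..<1}" "t' \<in> {-1<..<1}" "c i t = c j t'"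
  shows "cross (vel D (pt i t)) (vel D (pt j t')) =
    jacobian (\<phi>' (c i t)) * cross (dc i t) (dc j t') / (r i * r j)"
  unfolding vel_pt[OF assms(1,3)] vel_pt[OF assms(2,4)] assms(5)[symmetric] cross_scaleR cross_blinfun
  by simp

text \<open>
  The sign of a crossing is a product of four signs, which becomes a chain of equivalences of their
  positivity. The Jacobian determinant may be taken at the origin instead of the crossing.
\<close>

lemma cross_vel_pt_pos:
  assumes "i < n" "j < n" "t \<in> {-1<..<1}" "t' \<in> {-1<..<1}" "crossing D (pt i t) (pt j t')"
  shows "cross (vel D (pt i t)) (vel D (pt j t')) > 0 \<longleftrightarrow>
    (jacobian (\<phi>' 0) > 0) = ((r i > 0) = ((r j > 0) = (cross (dc i t) (dc j t') > 0)))"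
proof -
  have t: "t \<in> {-1..1}" "t' \<in> {-1..1}" using assms by auto
  have e: "c i t = c j t'" using assms crossing_pt[OF assms(1,2) t] by blast
  have nz: "cross (vel D (pt i t)) (vel D (pt j t')) \<noteq> 0"
    by (rule crossing_transverse[OF diagram assms(5)])
  define J where "J = jacobian (\<phi>' (c i t))"
  define x where "x = cross (dc i t) (dc j t')"
  have "J > 0 \<longleftrightarrow> jacobian (\<phi>' 0) > 0" unfolding J_def by (rule diffeo_sign[OF diffeo])
  moreover have "J * x / (r i * r j) \<noteq> 0"
    using nz unfolding cross_vel_pt[OF assms(1-4) e] J_def x_def .
  then have "J * x / (r i * r j) > 0 \<longleftrightarrow> (J > 0) = ((r i > 0) = ((r j > 0) = (x > 0)))"
    by (simp add: mult_pos_iff divide_pos_iff) blast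
  ultimately show ?thesis unfolding cross_vel_pt[OF assms(1-4) e] J_def x_def by simp
qed

end

lemma double_sign_frac:
  assumes "pseudodiagram D"
  shows "double_sign D (frac u) v = double_sign D u v" "double_sign D u (frac v) = double_sign D u v"
  unfolding double_sign_def pd_frac[OF assms] by auto

lemma double_sign_shift:
  assumes "pseudodiagram D"
  shows "double_sign D (u + of_int m) (v + of_int m') = double_sign D u v"
proof -
  have "frac (u + of_int m) = frac u" "frac (v + of_int m') = frac v" by (simp_all add: frac_def)
  then show ?thesis using double_sign_frac[OF assms] by metis
qed

section \<open>Replacing one picture by another\<close>

text \<open>The pictures share the window and the diffeomorphism but may show different arcs there.\<close>

locale replacement =
  strands n s r + P: local_picture n s r c dc \<phi> \<phi>' D + P': local_picture n s r c' dc' \<phi> \<phi>' D'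
  for n :: nat and s r :: "nat \<Rightarrow> real" and c dc c' dc' :: "nat \<Rightarrow> real \<Rightarrow> complex"
    and \<phi> \<phi>' and D D' :: pdiagram +
  assumes same: "u \<notin> W \<Longrightarrow> curve D' u = curve D u" "u \<notin> W \<Longrightarrow> mark D' u = mark D u"
begin

text \<open>The window is closed, so the curves agree in a neighbourhood of \<open>u\<close>.\<close>

lemma vel_outside:
  assumes "u \<notin> W"
  shows "vel D' u = vel D u"
proof -
  have "(curve D' has_vector_derivative vel D u) (at u)"
    by (rule has_vector_derivative_transform_within_open[OF has_vel[OF P.diagram], where S = "- W"])
      (use assms closed_window same in \<open>auto simp: open_Compl\<close>)
  then show ?thesis unfolding vel_def[of D'] by (rule vector_derivative_at)
qed

lemma crossing_outside: "u \<notin> W \<Longrightarrow> crossing D' u v \<longleftrightarrow> v \<notin> W \<and> crossing D u v"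
  using P.crossing_window[of v u] P'.crossing_window[of v u] same(1)[of u] same(1)[of v] crossing_sym
  unfolding crossing_def by metis

lemma double_sign_outside: "u \<notin> W \<Longrightarrow> v \<notin> W \<Longrightarrow> double_sign D' u v = double_sign D u v"
  unfolding double_sign_def using same vel_outside by simp

end

section \<open>Sliding all crossings of a picture\<close>

text \<open>The flag \<open>p\<close> selects the precrossings. A move treats both kinds of crossings in the same way, so they
  are better described together.\<close>

definition crossing_pairs :: "pdiagram \<Rightarrow> bool \<Rightarrow> (real \<times> real) set" where
  "crossing_pairs D p = {(u, v). u \<in> {0..<1} \<and> v \<in> {0..<1} \<and> crossing D u v \<and> (mark D u = Pre) = p}"

lemma crossing_pairs:
  assumes "pseudodiagram D"
  shows "classical_pairs D = crossing_pairs D False" "precrossing_pairs D = crossing_pairs D True"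
  unfolding classical_pairs_def precrossing_pairs_def crossing_pairs_def
  using crossing_marks[OF assms] by auto

lemma linked_cong:
  assumes "\<lfloor>u - a\<rfloor> = \<lfloor>u' - a'\<rfloor>" "\<lfloor>u - b\<rfloor> = \<lfloor>u' - b'\<rfloor>" "\<lfloor>v - a\<rfloor> = \<lfloor>v' - a'\<rfloor>" "\<lfloor>v - b\<rfloor> = \<lfloor>v' - b'\<rfloor>"
  shows "linked a b u v = linked a' b' u' v'"
  unfolding linked_def using assms by simp

lemma inv_I_eq_of_prechords:
  "prechords (gauss D) = prechords (gauss D') \<Longrightarrow> inv_I (gauss D) = inv_I (gauss D')"
  unfolding inv_I_def by simp

context strands
begin

definition slide_pair :: "real \<times> real \<Rightarrow> real \<times> real" where
  "slide_pair p = (frac (slide (fst p)), frac (slide (snd p)))"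

lemma slide_pair_slide_pair: "p \<in> {0..<1} \<times> {0..<1} \<Longrightarrow> slide_pair (slide_pair p) = p"
  unfolding slide_pair_def frac_slide_frac fst_conv snd_conv slide_slide
  by (cases p) (simp add: frac_eq[THEN iffD2])

end

text \<open>These are the moves in which a crossing of \<open>D\<close> with the parameters \<open>t\<close> and \<open>t'\<close> on two arcs
  corresponds to a crossing of \<open>D'\<close> with the parameters \<open>- t\<close> and \<open>- t'\<close>, of the same kind and with
  the same sign. Which strand is the upper one may change, as it does in PR2.\<close>

locale slide_move = replacement +
  assumes glue: "i < n \<Longrightarrow> j < n \<Longrightarrow> t \<in> {-1..1} \<Longrightarrow> t' \<in> {-1..1} \<Longrightarrow>
      c' i (- t) = c' j (- t') \<longleftrightarrow> c i t = c j t'"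
    and pre: "i < n \<Longrightarrow> j < n \<Longrightarrow> t \<in> {-1<..<1} \<Longrightarrow> t' \<in> {-1<..<1} \<Longrightarrow> crossing D (pt i t) (pt j t') \<Longrightarrow>
      mark D' (pt i (- t)) = Pre \<longleftrightarrow> mark D (pt i t) = Pre"
    and sgn: "i < n \<Longrightarrow> j < n \<Longrightarrow> t \<in> {-1<..<1} \<Longrightarrow> t' \<in> {-1<..<1} \<Longrightarrow> crossing D (pt i t) (pt j t') \<Longrightarrow>
      mark D (pt i t) \<noteq> Pre \<Longrightarrow>
      double_sign D' (pt i (- t)) (pt j (- t')) = double_sign D (pt i t) (pt j t')"
begin

lemma crossing_slide: "crossing D' (slide u) (slide v) \<longleftrightarrow> crossing D u v"
proof (cases "u \<in> W")
  case u: True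
  show ?thesis
  proof (cases "v \<in> W")
    case v: True
    obtain i t m where i: "i < n" "t \<in> {-1..1}" "u = pt i t + of_int m" using u by (rule windowE)
    obtain j t' m' where j: "j < n" "t' \<in> {-1..1}" "v = pt j t' + of_int m'" using v by (rule windowE)
    have "- t \<in> {-1..1}" "- t' \<in> {-1..1}" using i j by auto
    then show ?thesis
      unfolding i(3) j(3) slide_pt[OF i(1,2)] slide_pt[OF j(1,2)] P.crossing_shift P'.crossing_shift
      using P.crossing_pt[OF i(1) j(1) i(2) j(2)] P'.crossing_pt[OF i(1) j(1), of "- t" "- t'"]
        glue[OF i(1) j(1) i(2) j(2)] by simp
  next
    case False
    then show ?thesis
      using u P.crossing_window[of u v] P'.crossing_window[of "slide u" "slide v"] slide_window by blast
  qed
next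
  case u: False
  show ?thesis
  proof (cases "v \<in> W")
    case True
    then have "slide v \<in> W" using slide_window by blast
    with True u show ?thesis
      using P.crossing_window[of v u] crossing_sym crossing_outside[OF u] slide_outside[OF u] by metis
  next
    case False
    with u show ?thesis by (simp add: slide_outside crossing_outside)
  qed
qed

lemma mark_slide:
  assumes "crossing D u v"
  shows "mark D' (slide u) = Pre \<longleftrightarrow> mark D u = Pre"
proof (cases "u \<in> W")
  case True
  obtain i j t t' m m' where i: "i < n" "j < n" "t \<in> {-1<..<1}" "t' \<in> {-1<..<1}"
    "u = pt i t + of_int m" "v = pt j t' + of_int m'" "crossing D (pt i t) (pt j t')"
    by (rule P.crossing_in_windowE[OF assms True])
  have "t \<in> {-1..1}" using i by auto
  then show ?thesis
    unfolding i(5) slide_pt[OF i(1) \<open>t \<in> {-1..1}\<close>] pd_periodic[OF P.diagram] pd_periodic[OF P'.diagram]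
    using pre[OF i(1-4,7)] by simp
qed (simp add: slide_outside same)

lemma double_sign_slide:
  assumes "crossing D u v" "mark D u \<noteq> Pre"
  shows "double_sign D' (slide u) (slide v) = double_sign D u v"
proof (cases "u \<in> W")
  case True
  obtain i j t t' m m' where i: "i < n" "j < n" "t \<in> {-1<..<1}" "t' \<in> {-1<..<1}"
    "u = pt i t + of_int m" "v = pt j t' + of_int m'" "crossing D (pt i t) (pt j t')"
    by (rule P.crossing_in_windowE[OF assms(1) True])
  have t: "t \<in> {-1..1}" "t' \<in> {-1..1}" using i by auto
  have "mark D (pt i t) \<noteq> Pre" using assms(2) unfolding i(5) pd_periodic[OF P.diagram] .
  then show ?thesis
    unfolding i(5,6) slide_pt[OF i(1) t(1)] slide_pt[OF i(2) t(2)]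
      double_sign_shift[OF P.diagram] double_sign_shift[OF P'.diagram]
    using sgn[OF i(1-4,7)] by simp
next
  case False
  then have "v \<notin> W" using P.crossing_window[of v u] crossing_sym[OF assms(1)] by blast
  with False show ?thesis by (simp add: slide_outside double_sign_outside)
qed

lemma crossing_pairs_slide: "crossing_pairs D' q = slide_pair ` crossing_pairs D q"
proof -
  have 1: "slide_pair p \<in> crossing_pairs D' q" if "p \<in> crossing_pairs D q" for p
  proof -
    obtain u v where p: "p = (u, v)" "crossing D u v" "(mark D u = Pre) = q"
      using \<open>p \<in> crossing_pairs D q\<close> unfolding crossing_pairs_def by blast
    then show ?thesis
      using frac_unit[of "slide u"] frac_unit[of "slide v"] crossing_slide[of u v] mark_slide[OF p(2)]
      unfolding crossing_pairs_def slide_pair_def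
      by (simp add: crossing_frac[OF P'.diagram] pd_frac[OF P'.diagram])
  qed
  have 2: "slide_pair p \<in> crossing_pairs D q" if "p \<in> crossing_pairs D' q" for p
  proof -
    obtain u v where p: "p = (u, v)" "crossing D' u v" "(mark D' u = Pre) = q"
      using \<open>p \<in> crossing_pairs D' q\<close> unfolding crossing_pairs_def by blast
    have cr: "crossing D (slide u) (slide v)" using crossing_slide[of "slide u" "slide v"] p(2)
      unfolding slide_slide by simp
    then show ?thesis
      using p frac_unit[of "slide u"] frac_unit[of "slide v"] mark_slide[OF cr]
      unfolding crossing_pairs_def slide_pair_def slide_slide
      by (simp add: crossing_frac[OF P.diagram] pd_frac[OF P.diagram])
  qed
  have unit: "crossing_pairs X q \<subseteq> {0..<1} \<times> {0..<1}" for X unfolding crossing_pairs_def by auto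
  show ?thesis
  proof (intro equalityI subsetI)
    fix p assume p: "p \<in> crossing_pairs D' q"
    then have "slide_pair (slide_pair p) = p" using unit[of D'] by (intro slide_pair_slide_pair) blast
    with 2[OF p] show "p \<in> slide_pair ` crossing_pairs D q" by (metis imageI)
  qed (use 1 in blast)
qed

lemma linking_slide:
  "linking D' (slide a) (slide b) =
    (\<Sum>(u, v) \<in> classical_pairs D.
       if linked (slide a) (slide b) (slide u) (slide v) then double_sign D u v else 0)"
proof -
  have inj: "inj_on slide_pair (classical_pairs D)"
    by (rule inj_on_inverseI[of _ slide_pair])
      (auto simp: classical_pairs_def intro!: slide_pair_slide_pair)
  have eq: "classical_pairs D' = slide_pair ` classical_pairs D"
    using crossing_pairs_slide crossing_pairs[OF P.diagram] crossing_pairs[OF P'.diagram] by simp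
  show ?thesis
    unfolding linking_def eq sum.reindex[OF inj]
  proof (rule sum.cong[OF refl])
    fix p assume p: "p \<in> classical_pairs D"
    obtain u v where uv: "p = (u, v)" by (cases p)
    have "crossing D u v" "mark D u \<noteq> Pre" using p uv unfolding classical_pairs_def by auto
    then have "double_sign D' (slide u) (slide v) = double_sign D u v" by (rule double_sign_slide)
    then show "((\<lambda>(u, v). if linked (slide a) (slide b) u v then double_sign D' u v else 0) \<circ> slide_pair) p =
       (case p of (u, v) \<Rightarrow> if linked (slide a) (slide b) (slide u) (slide v) then double_sign D u v else 0)"
      unfolding uv by (simp add: slide_pair_def double_sign_frac[OF P'.diagram])
  qed
qed

lemma linked_slide:
  assumes "\<not> same_arc u a" "\<not> same_arc u b" "\<not> same_arc v a" "\<not> same_arc v b"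
  shows "linked (slide a) (slide b) (slide u) (slide v) = linked a b u v"
  by (intro linked_cong slide_floor assms)

lemma linking_slide_outside:
  assumes "a \<notin> W" "b \<notin> W"
  shows "linking D' a b = linking D a b"
proof -
  have "linking D' (slide a) (slide b) = linking D a b"
    unfolding linking_slide unfolding linking_def
    by (intro sum.cong refl) (auto simp: linked_slide same_arc_outside assms)
  then show ?thesis by (simp add: slide_outside assms)
qed

end

section \<open>The arcs of the moves\<close>

text \<open>This is what \<^locale>\<open>local_picture\<close> requires of the arcs alone.\<close>

definition arc_system :: "nat \<Rightarrow> (nat \<Rightarrow> real \<Rightarrow> complex) \<Rightarrow> (nat \<Rightarrow> real \<Rightarrow> complex) \<Rightarrow> bool" where
  "arc_system n c dc \<longleftrightarrow>
     (\<forall>k<n. \<forall>t\<in>{-1..1}. c k t \<in> square) \<and>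
     (\<forall>k<n. \<forall>t\<in>{-1<..<1}. (c k has_vector_derivative dc k t) (at t)) \<and>
     (\<forall>i<n. \<forall>j<n. \<forall>t\<in>{-1..1}. \<forall>t'\<in>{-1..1}. c i t = c j t' \<longrightarrow> (i, t) \<noteq> (j, t') \<longrightarrow> t \<in> {-1<..<1})"

lemma local_pictureI:
  assumes "strands n s r" "arc_system n c dc" "pseudodiagram D" "C1_diffeo \<phi> \<phi>'"
    and "\<And>k t. k < n \<Longrightarrow> t \<in> {-1..1} \<Longrightarrow> curve D (s k + r k * t) = \<phi> (c k t)"
    and "\<And>u. u \<notin> window n s r \<Longrightarrow> curve D u \<notin> \<phi> ` square"
  shows "local_picture n s r c dc \<phi> \<phi>' D"
proof (rule local_picture.intro[OF assms(1)], rule local_picture_axioms.intro)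
  fix i j t t' assume h: "i < n" "j < n" "t \<in> {-1..1}" "t' \<in> {-1..1}" "c i t = c j t'" "(i, t) \<noteq> (j, t')"
  then show "t \<in> {-1<..<1}" using assms(2) unfolding arc_system_def by metis
qed (use assms in \<open>auto simp: arc_system_def\<close>)

lemma replacesE:
  assumes "replaces n c c' s r D D'" "arc_system n c dc" "arc_system n c' dc'"
  obtains \<phi> \<phi>' where "replacement n s r c dc c' dc' \<phi> \<phi>' D D'"
proof -
  have st: "strands n s r"
    using assms(1) unfolding replaces_def by unfold_locales auto
  obtain \<phi> \<phi>' where p: "C1_diffeo \<phi> \<phi>'"
    "\<forall>k<n. \<forall>t\<in>{-1..1}. curve D (s k + r k * t) = \<phi> (c k t) \<and> curve D' (s k + r k * t) = \<phi> (c' k t)"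
    "\<forall>u. u \<notin> window n s r \<longrightarrow> curve D u \<notin> \<phi> ` square \<and> curve D' u = curve D u \<and> mark D' u = mark D u"
    and D: "pseudodiagram D" "pseudodiagram D'"
    using assms(1) unfolding replaces_def by blast
  have "local_picture n s r c dc \<phi> \<phi>' D" "local_picture n s r c' dc' \<phi> \<phi>' D'"
    using p by (auto intro!: local_pictureI[OF st] assms(2,3) D)
  then have "replacement n s r c dc c' dc' \<phi> \<phi>' D D'"
    using p(3) by (intro replacement.intro replacement_axioms.intro st) auto
  then show ?thesis by (rule that)
qed

lemma has_vector_derivative_Complex:
  assumes "(x has_real_derivative x') (at t)" "(y has_real_derivative y') (at t)"
  shows "((\<lambda>t. Complex (x t) (y t)) has_vector_derivative Complex x' y') (at t)"
proof -
  have "((\<lambda>t. of_real (x t) + \<i> * of_real (y t)) has_vector_derivative of_real x' + \<i> * of_real y') (at t)"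
    by (intro has_vector_derivative_add has_vector_derivative_mult_right has_vector_derivative_of_real
        assms)
  then show ?thesis by (simp add: Complex_eq)
qed

text \<open>Arcs that are graphs over the real axis meet over a common point of the axis.\<close>

lemma arc_system_graph:
  assumes c: "\<And>k t. k < n \<Longrightarrow> c k t = Complex t (y k t)"
    and bound: "\<And>k t. k < n \<Longrightarrow> t \<in> {-1..1} \<Longrightarrow> \<bar>y k t\<bar> \<le> 1"
    and deriv: "\<And>k t. k < n \<Longrightarrow> (y k has_real_derivative y' k t) (at t)"
    and meet: "\<And>i j t. i < n \<Longrightarrow> j < n \<Longrightarrow> i \<noteq> j \<Longrightarrow> t \<in> {-1..1} \<Longrightarrow> y i t = y j t \<Longrightarrow> t \<in> {-1<..<1}"
  shows "arc_system n c (\<lambda>k t. Complex 1 (y' k t))"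
  unfolding arc_system_def
proof (intro conjI allI impI ballI)
  fix k t assume k: "k < n"
  show "c k t \<in> square" if "t \<in> {-1..1}" using that c[OF k] bound[OF k that] by (auto simp: square_def)
  have "((\<lambda>t. Complex t (y k t)) has_vector_derivative Complex 1 (y' k t)) (at t)"
    by (rule has_vector_derivative_Complex[OF DERIV_ident deriv[OF k]])
  then show "(c k has_vector_derivative Complex 1 (y' k t)) (at t)"
    by (simp add: c[OF k, abs_def])
next
  fix i j t t' assume h: "i < n" "j < n" "t \<in> {-1..1}" "t' \<in> {-1..1}" "c i t = c j t'" "(i, t) \<noteq> (j, t')"
  then show "t \<in> {-1<..<1}" using c meet[of i j t] by auto
qed

lemma square_le_one: "t \<in> {-1..1} \<Longrightarrow> 0 \<le> 1 - t\<^sup>2 \<and> 1 - t\<^sup>2 \<le> 1" for t :: real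
  by (simp add: abs_square_le_1 abs_le_iff)

lemma square_square_le_one: "t \<in> {-1..1} \<Longrightarrow> 0 \<le> (1 - t\<^sup>2)\<^sup>2 \<and> (1 - t\<^sup>2)\<^sup>2 \<le> 1" for t :: real
  using square_le_one[of t] by (simp add: power_le_one)

lemma half_squared: "t\<^sup>2 = 1/4 \<longleftrightarrow> t = 1/2 \<or> t = - (1/2)" for t :: real
proof -
  have "t\<^sup>2 = 1/4 \<longleftrightarrow> t\<^sup>2 = (1/2)\<^sup>2" by (simp add: power2_eq_square)
  then show ?thesis by (simp add: power2_eq_iff)
qed

lemma bump_eq_iff:
  fixes t :: real
  assumes "t \<in> {-1..1}"
  shows "(1 - t\<^sup>2)\<^sup>2 = 9/16 \<longleftrightarrow> t = 1/2 \<or> t = - (1/2)"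
proof -
  have "(1 - t\<^sup>2)\<^sup>2 = 9/16 \<longleftrightarrow> (1 - t\<^sup>2)\<^sup>2 = (3/4)\<^sup>2" by (simp add: power2_eq_square)
  also have "\<dots> \<longleftrightarrow> 1 - t\<^sup>2 = 3/4" using square_le_one[OF assms] by (subst power2_eq_iff_nonneg) auto
  also have "\<dots> \<longleftrightarrow> t\<^sup>2 = 1/4" by auto
  finally show ?thesis unfolding half_squared .
qed

lemma line_meets_bump:
  fixes t :: real
  assumes "t \<in> {-1..1}"
  shows "t / 2 = 4/9 * (1 - t\<^sup>2)\<^sup>2 \<longleftrightarrow> t = 1/2"
proof
  assume e: "t / 2 = 4/9 * (1 - t\<^sup>2)\<^sup>2"
  have "0 \<le> (1 - t\<^sup>2)\<^sup>2" by simp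
  with e have "0 \<le> t" by linarith
  moreover have "t \<le> 1" using assms by simp
  ultimately have t: "0 \<le> t" "t \<le> 1" by blast+
  \<comment> \<open>the difference of the two sides is a quartic with the linear factor \<open>2 * t - 1\<close>, and the cubic
    cofactor has no zero in the unit interval\<close>
  have "(2 * t - 1) * (4 * t^3 + 2 * t\<^sup>2 - 7 * t - 8) = 0"
    using e by (simp add: algebra_simps power2_eq_square power3_eq_cube)
  moreover have "t^3 \<le> t" "t\<^sup>2 \<le> t"
    using t power_decreasing[of 1 3 t] power_decreasing[of 1 2 t] by auto
  then have "4 * t^3 + 2 * t\<^sup>2 - 7 * t - 8 \<noteq> 0" using t by linarith
  ultimately show "t = 1/2" by simp
next
  assume t: "t = 1/2"
  show "t / 2 = 4/9 * (1 - t\<^sup>2)\<^sup>2" unfolding t by (simp add: power2_eq_square)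
qed

definition triangle_height :: "real \<Rightarrow> nat \<Rightarrow> real \<Rightarrow> real" where
  "triangle_height e k t = (if k = 0 then t/2 else if k = 1 then - t/2 else e * (4/9) * (1 - t\<^sup>2)\<^sup>2)"

definition triangle_slope :: "real \<Rightarrow> nat \<Rightarrow> real \<Rightarrow> real" where
  "triangle_slope e k t = (if k = 0 then 1/2 else if k = 1 then - 1/2 else - e * (16/9) * t * (1 - t\<^sup>2))"

lemma triangle_eq: "triangle e k t = Complex t (triangle_height e k t)"
  unfolding triangle_def triangle_height_def by simp

lemma triangle_meet:
  assumes e: "e = 1 \<or> e = - 1" and "i < 3" "j < 3" "i \<noteq> j" "t \<in> {-1..1}"
  shows "triangle_height e i t = triangle_height e j t \<longleftrightarrow>
    ({i, j} = {0, 1} \<and> t = 0) \<or> ({i, j} = {0, 2} \<and> t = e/2) \<or> ({i, j} = {1, 2} \<and> t = - e/2)"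
proof -
  have "i = 0 \<or> i = 1 \<or> i = 2" "j = 0 \<or> j = 1 \<or> j = 2" using assms by auto
  then show ?thesis
    using line_meets_bump[of t] line_meets_bump[of "- t"] e assms(4,5)
    unfolding triangle_height_def by (elim disjE) (auto simp: doubleton_eq_iff)
qed

lemma arc_system_triangle:
  assumes e: "e = 1 \<or> e = - 1"
  shows "arc_system 3 (triangle e) (\<lambda>k t. Complex 1 (triangle_slope e k t))"
proof (rule arc_system_graph[OF triangle_eq])
  fix k and t :: real assume "t \<in> {-1..1}"
  then show "\<bar>triangle_height e k t\<bar> \<le> 1"
    using square_square_le_one[of t] e unfolding triangle_height_def by (auto simp: abs_mult)
next
  fix k t
  show "(triangle_height e k has_real_derivative triangle_slope e k t) (at t)"
    unfolding triangle_height_def triangle_slope_def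
    by (auto intro!: derivative_eq_intros simp: power2_eq_square field_simps)
next
  fix i j and t :: real
  assume h: "i < 3" "j < 3" "i \<noteq> j" "t \<in> {-1..1}" "triangle_height e i t = triangle_height e j t"
  have "t = 0 \<or> t = e/2 \<or> t = - e/2" using triangle_meet[OF e h(1-4)] h(5) by blast
  then show "t \<in> {-1<..<1}" using e by auto
qed

definition bigon_height :: "nat \<Rightarrow> real \<Rightarrow> real" where
  "bigon_height k t = (if k = 0 then 0 else t\<^sup>2 - 1/4)"

lemma bigon_eq: "bigon k t = Complex t (bigon_height k t)"
  unfolding bigon_def bigon_height_def by simp

lemma bigon_meet:
  assumes "i < 2" "j < 2" "i \<noteq> j"
  shows "bigon_height i t = bigon_height j t \<longleftrightarrow> t = 1/2 \<or> t = - (1/2)"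
proof -
  have "i = 0 \<or> i = 1" "j = 0 \<or> j = 1" using assms by auto
  then show ?thesis using assms(3) half_squared[of t] unfolding bigon_height_def by auto
qed

lemma arc_system_bigon:
  "arc_system 2 bigon (\<lambda>k t. Complex 1 (if k = 0 then 0 else 2 * t))"
proof (rule arc_system_graph[OF bigon_eq])
  fix k and t :: real assume "t \<in> {-1..1}"
  then have "\<bar>t\<^sup>2 - 1/4\<bar> \<le> 1" using square_le_one[of t] by linarith
  then show "\<bar>bigon_height k t\<bar> \<le> 1" unfolding bigon_height_def by simp
next
  fix k t
  show "(bigon_height k has_real_derivative (if k = 0 then 0 else 2 * t)) (at t)"
    unfolding bigon_height_def by (auto intro!: derivative_eq_intros)
next
  fix i j and t :: real
  assume h: "i < 2" "j < 2" "i \<noteq> j" "t \<in> {-1..1}" "bigon_height i t = bigon_height j t"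
  have "t = 1/2 \<or> t = - (1/2)" using bigon_meet[OF h(1-3)] h(5) by blast
  then show "t \<in> {-1<..<1}" by auto
qed

definition overlap_height :: "nat \<Rightarrow> real \<Rightarrow> real" where
  "overlap_height k t = (if k = 0 then 0 else 1/2 - 8/9 * (1 - t\<^sup>2)\<^sup>2)"

definition overlap_slope :: "nat \<Rightarrow> real \<Rightarrow> real" where
  "overlap_slope k t = (if k = 0 then 0 else 32/9 * t * (1 - t\<^sup>2))"

lemma overlap_eq: "overlap k t = Complex t (overlap_height k t)"
  unfolding overlap_def overlap_height_def by simp

lemma overlap_meet:
  assumes "i < 2" "j < 2" "i \<noteq> j" "t \<in> {-1..1}"
  shows "overlap_height i t = overlap_height j t \<longleftrightarrow> t = 1/2 \<or> t = - (1/2)"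
proof -
  have "i = 0 \<or> i = 1" "j = 0 \<or> j = 1" using assms by auto
  then show ?thesis using assms(3) bump_eq_iff[OF assms(4)] unfolding overlap_height_def by auto
qed

lemma arc_system_overlap: "arc_system 2 overlap (\<lambda>k t. Complex 1 (overlap_slope k t))"
proof (rule arc_system_graph[OF overlap_eq])
  fix k and t :: real assume "t \<in> {-1..1}"
  then have "\<bar>1/2 - 8/9 * (1 - t\<^sup>2)\<^sup>2\<bar> \<le> 1" using square_square_le_one[of t] by linarith
  then show "\<bar>overlap_height k t\<bar> \<le> 1" unfolding overlap_height_def by simp
next
  fix k t
  show "(overlap_height k has_real_derivative overlap_slope k t) (at t)"
    unfolding overlap_height_def overlap_slope_def
    by (auto intro!: derivative_eq_intros simp: power2_eq_square field_simps)
next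
  fix i j and t :: real
  assume h: "i < 2" "j < 2" "i \<noteq> j" "t \<in> {-1..1}" "overlap_height i t = overlap_height j t"
  have "t = 1/2 \<or> t = - (1/2)" using overlap_meet[OF h(1-4)] h(5) by blast
  then show "t \<in> {-1<..<1}" by auto
qed

lemma arc_system_parallel: "arc_system 2 parallel (\<lambda>k t. Complex 1 0)"
proof (rule arc_system_graph[of _ _ "\<lambda>k t. if k = 0 then 0 else 1/2"])
  show "parallel k t = Complex t (if k = 0 then 0 else 1/2)" for k t
    unfolding parallel_def by simp
  fix i j :: nat and t :: real
  assume h: "i < 2" "j < 2" "i \<noteq> j" "(if i = 0 then 0 else 1/2) = (if j = 0 then 0 else 1/2 :: real)"
  then show "t \<in> {-1<..<1}" by (auto split: if_splits)
qed auto

lemma arc_system_flat: "arc_system 1 flat (\<lambda>k t. Complex 1 0)"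
  by (rule arc_system_graph[of _ _ "\<lambda>k t. 0"]) (auto simp: flat_def)

text \<open>Equal heights force \<open>t' = - t\<close>, since the height is a decreasing function of \<open>t\<^sup>2\<close>. As the
  horizontal coordinate is odd, it has to vanish at a double point.\<close>

lemma kink_double:
  assumes "t \<in> {-1..1}" "t' \<in> {-1..1}" "kink 0 t = kink 0 t'" "t \<noteq> t'"
  shows "t' = - t" "t = 1/2 \<or> t = - (1/2)"
proof -
  have y: "(1 - t\<^sup>2)\<^sup>2 = (1 - t'\<^sup>2)\<^sup>2"
    and x: "t * (1 - 16/9 * (1 - t\<^sup>2)\<^sup>2) = t' * (1 - 16/9 * (1 - t'\<^sup>2)\<^sup>2)"
    using assms(3) unfolding kink_def by auto
  from y have "1 - t\<^sup>2 = 1 - t'\<^sup>2"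
    using square_le_one[OF assms(1)] square_le_one[OF assms(2)] by (subst (asm) power2_eq_iff_nonneg) auto
  then show t': "t' = - t" using assms(4) by (simp add: power2_eq_iff)
  have "t \<noteq> 0" using t' assms(4) by auto
  then have "(1 - t\<^sup>2)\<^sup>2 = 9/16" using x unfolding t' by auto
  then show "t = 1/2 \<or> t = - (1/2)" unfolding bump_eq_iff[OF assms(1)] .
qed

lemma kink_ends: "kink 0 (1/2) = kink 0 (- (1/2))"
  unfolding kink_def by (simp add: power2_eq_square)

lemma arc_system_kink: "\<exists>dc. arc_system 1 kink dc"
proof -
  have sq: "kink k t \<in> square" if t: "t \<in> {-1..1}" for k and t :: real
  proof -
    have b: "0 \<le> (1 - t\<^sup>2)\<^sup>2" "(1 - t\<^sup>2)\<^sup>2 \<le> 1" using square_square_le_one[OF t] by auto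
    have "\<bar>t\<bar> * \<bar>1 - 16/9 * (1 - t\<^sup>2)\<^sup>2\<bar> \<le> 1 * 1"
      by (rule mult_mono) (use t b in \<open>auto simp: abs_le_iff\<close>)
    then show ?thesis using b unfolding kink_def square_def by (simp add: abs_mult)
  qed
  let ?d = "\<lambda>k t. Complex ((1 - 16/9 * (1 - t\<^sup>2)\<^sup>2) + t * (64/9 * t * (1 - t\<^sup>2))) (- 2 * t * (1 - t\<^sup>2))"
  have d: "(kink k has_vector_derivative ?d k t) (at t)" for k t
    unfolding kink_def
    by (intro has_vector_derivative_Complex)
      (auto intro!: derivative_eq_intros simp: power2_eq_square field_simps)
  have "t \<in> {-1<..<1}" if "t \<in> {-1..1}" "t' \<in> {-1..1}" "kink 0 t = kink 0 t'" "t \<noteq> t'" for t t'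
    using kink_double(2)[OF that] by auto
  then have "arc_system 1 kink ?d"
    unfolding arc_system_def using sq d by (simp only: less_one) blast
  then show ?thesis by blast
qed

section \<open>The moves of three strands\<close>

lemma linking_shift: "linking D (a + of_int m) (b + of_int m') = linking D a b"
proof -
  have "frac (a + of_int m) = frac a" "frac (b + of_int m') = frac b" by (simp_all add: frac_def)
  then show ?thesis using linking_frac by metis
qed

lemma sum_two_swapped_pairs:
  fixes g :: "'a \<times> 'a \<Rightarrow> int"
  assumes "distinct [x, y, z, w]" "g (y, x) = g (x, y)" "g (w, z) = g (z, w)"
  shows "sum g {(x, y), (y, x), (z, w), (w, z)} = 2 * (g (x, y) + g (z, w))"
  using assms by simp

context strands
begin

lemma frac_pt_eq:
  assumes "i < n" "j < n" "t \<in> {-1..1}" "t' \<in> {-1..1}"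
  shows "frac (pt i t) = frac (pt j t') \<longleftrightarrow> i = j \<and> t = t'"
  unfolding frac_eq_iff_Ints using pt_unique[OF assms] by auto

lemma linked_slide_frac [simp]:
  "linked a b (slide (frac u)) v = linked a b (slide u) v"
  "linked a b u (slide (frac v)) = linked a b u (slide v)"
  by (metis linked_frac frac_slide_frac)+

end

context slide_move
begin

text \<open>Only the crossings of the picture can be linked differently with a pair of points.\<close>

lemma linking_difference:
  "linking D' (slide a) (slide b) - linking D a b =
    (\<Sum>(u, v) \<in> {p \<in> classical_pairs D. fst p \<in> W}.
      (if linked (slide a) (slide b) (slide u) (slide v) then double_sign D u v else 0) -
      (if linked a b u v then double_sign D u v else 0))"
proof -
  let ?g = "\<lambda>(u, v). (if linked (slide a) (slide b) (slide u) (slide v) then double_sign D u v else 0) -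
      (if linked a b u v then double_sign D u v else 0)"
  have "linking D' (slide a) (slide b) - linking D a b = sum ?g (classical_pairs D)"
    unfolding linking_slide unfolding linking_def by (simp add: case_prod_unfold sum_subtractf)
  also have "\<dots> = sum ?g {p \<in> classical_pairs D. fst p \<in> W}"
  proof (rule sum.mono_neutral_right)
    show "\<forall>p\<in>classical_pairs D - {p \<in> classical_pairs D. fst p \<in> W}. ?g p = 0"
    proof
      fix p assume p: "p \<in> classical_pairs D - {p \<in> classical_pairs D. fst p \<in> W}"
      obtain u v where uv: "p = (u, v)" by (cases p)
      have "crossing D v u" "u \<notin> W" using p uv crossing_sym unfolding classical_pairs_def by auto
      then have "u \<notin> W" "v \<notin> W" using P.crossing_window[of v u] by blast+
      then have "linked (slide a) (slide b) (slide u) (slide v) = linked a b u v"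
        by (intro linked_slide same_arc_outside) auto
      then show "?g p = 0" unfolding uv by simp
    qed
  qed (use finite_pairs(1)[OF P.diagram] in auto)
  finally show ?thesis .
qed

lemma prechords_fixed:
  assumes "\<And>a b. (a, b) \<in> precrossing_pairs D \<Longrightarrow>
    slide a = a \<and> slide b = b \<and> linking D' a b = linking D a b"
  shows "prechords (gauss D) = prechords (gauss D')"
proof -
  have "slide_pair p = p" if "p \<in> precrossing_pairs D" for p
  proof -
    obtain a b where p: "p = (a, b)" by (cases p)
    then have "a \<in> {0..<1}" "b \<in> {0..<1}" using that unfolding precrossing_pairs_def by auto
    then show ?thesis using assms that unfolding p slide_pair_def by (simp add: frac_eq[THEN iffD2])
  qed
  then have "slide_pair ` precrossing_pairs D = precrossing_pairs D" by simp
  then have "precrossing_pairs D' = precrossing_pairs D"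
    using crossing_pairs_slide[of True] crossing_pairs(2)[OF P.diagram] crossing_pairs(2)[OF P'.diagram]
    by simp
  then show ?thesis
    unfolding prechords_eq_linking[OF P.diagram] prechords_eq_linking[OF P'.diagram]
    using assms by (auto intro!: image_cong)
qed

end

abbreviation triangle_velocity :: "real \<Rightarrow> nat \<Rightarrow> real \<Rightarrow> complex" where
  "triangle_velocity e \<equiv> \<lambda>k t. Complex 1 (triangle_slope e k t)"

text \<open>The reflection in the origin exchanges the two sides of the move and reverses every arc.\<close>

lemma triangle_reflect: "triangle (- 1) k (- t) = - triangle 1 k t"
  unfolding triangle_def by (simp add: complex_eq_iff)

lemma triangle_velocity_reflect: "triangle_velocity (- 1) k (- t) = triangle_velocity 1 k t"
  unfolding triangle_slope_def by simp

lemma triangle_crossing: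
  assumes "triangle e i t = triangle e j t'" "(i, t) \<noteq> (j, t')"
  shows "t = t'" "i \<noteq> j"
  using assms unfolding triangle_eq by auto

lemma slide_move_triangle:
  assumes rep: "replaces 3 (triangle 1) (triangle (- 1)) s r D D'"
    and lay: "layered 3 (triangle 1) s r L D" "layered 3 (triangle (- 1)) s r L D'"
  obtains \<phi> \<phi>' where "slide_move 3 s r (triangle 1) (triangle_velocity 1)
    (triangle (- 1)) (triangle_velocity (- 1)) \<phi> \<phi>' D D'"
proof -
  obtain \<phi> \<phi>' where R: "replacement 3 s r (triangle 1) (triangle_velocity 1)
      (triangle (- 1)) (triangle_velocity (- 1)) \<phi> \<phi>' D D'"
    by (rule replacesE[OF rep arc_system_triangle arc_system_triangle]) auto
  then interpret replacement 3 s r "triangle 1" "triangle_velocity 1"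
      "triangle (- 1)" "triangle_velocity (- 1)" \<phi> \<phi>' D D' .
  have glue: "triangle (- 1) i (- t) = triangle (- 1) j (- t') \<longleftrightarrow> triangle 1 i t = triangle 1 j t'" for i j t t'
    unfolding triangle_reflect by simp
  have cr: "crossing D' (pt i (- t)) (pt j (- t'))" "mark D' (pt i (- t)) = mark D (pt i t)"
    if h: "i < 3" "j < 3" "t \<in> {-1<..<1}" "t' \<in> {-1<..<1}" "crossing D (pt i t) (pt j t')" for i j t t'
  proof -
    have t: "t \<in> {-1..1}" "t' \<in> {-1..1}" "- t \<in> {-1..1}" "- t' \<in> {-1..1}" using h by auto
    have e: "triangle 1 i t = triangle 1 j t'" "(i, t) \<noteq> (j, t')"
      using P.crossing_pt[OF h(1,2) t(1,2)] h(5) by auto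
    then show "crossing D' (pt i (- t)) (pt j (- t'))"
      using P'.crossing_pt[OF h(1,2) t(3,4)] glue by auto
    have "triangle 1 i t = triangle 1 j t" "i \<noteq> j" "triangle (- 1) i (- t) = triangle (- 1) j (- t)"
      using e triangle_crossing[OF e] glue by auto
    then show "mark D' (pt i (- t)) = mark D (pt i t)"
      using lay h(1,2) t unfolding layered_def by metis
  qed
  have "slide_move 3 s r (triangle 1) (triangle_velocity 1)
      (triangle (- 1)) (triangle_velocity (- 1)) \<phi> \<phi>' D D'"
  proof (intro slide_move.intro[OF R] slide_move_axioms.intro glue)
    fix i j :: nat and t t' :: real
    assume h: "i < 3" "j < 3" "t \<in> {-1<..<1}" "t' \<in> {-1<..<1}" "crossing D (pt i t) (pt j t')"
    show "(mark D' (pt i (- t)) = Pre) = (mark D (pt i t) = Pre)" using cr(2)[OF h] by simp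
    have "- t \<in> {-1<..<1}" "- t' \<in> {-1<..<1}" using h by auto
    then show "double_sign D' (pt i (- t)) (pt j (- t')) = double_sign D (pt i t) (pt j t')"
      unfolding double_sign_def cr(2)[OF h]
      using P.cross_vel_pt_pos[OF h] P'.cross_vel_pt_pos[OF h(1,2) _ _ cr(1)[OF h]]
      unfolding triangle_velocity_reflect by simp
  qed
  then show ?thesis by (rule that)
qed

text \<open>All crossings of the picture are classical because the levels are distinct, so no prechord has an
  endpoint in the window.\<close>

lemma inv_I_R3:
  assumes "move_R3 D D'"
  shows "inv_I (gauss D) = inv_I (gauss D')"
proof -
  obtain s r L where rep: "replaces 3 (triangle 1) (triangle (- 1)) s r D D'"
    and lay: "layered 3 (triangle 1) s r L D" "layered 3 (triangle (- 1)) s r L D'"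
    and L: "L 0 \<noteq> L 1" "L 0 \<noteq> L 2" "L 1 \<noteq> L 2"
    using assms unfolding move_R3_def by blast
  obtain \<phi> \<phi>' where "slide_move 3 s r (triangle 1) (triangle_velocity 1)
      (triangle (- 1)) (triangle_velocity (- 1)) \<phi> \<phi>' D D'"
    by (rule slide_move_triangle[OF rep lay])
  then interpret slide_move 3 s r "triangle 1" "triangle_velocity 1"
      "triangle (- 1)" "triangle_velocity (- 1)" \<phi> \<phi>' D D' .
  have off: "a \<notin> W" if cr: "crossing D a b" and pre: "mark D a = Pre" for a b
  proof
    assume "a \<in> W"
    from P.crossing_in_windowE[OF cr this] obtain i j t t' m m' where
      i: "i < 3" "j < 3" "t \<in> {-1<..<1}" "a = pt i t + of_int m"
        "triangle 1 i t = triangle 1 j t'" "(i, t) \<noteq> (j, t')" by metis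
    have "mark D (pt i t) = Pre" using pre unfolding i(4) pd_periodic[OF P.diagram] .
    moreover have "triangle 1 i t = triangle 1 j t" "i \<noteq> j" "t \<in> {-1..1}"
      using i triangle_crossing[OF i(5,6)] by auto
    then have "mark D (pt i t) = (if L i > L j then Over else if L i < L j then Under else Pre)"
      using lay(1) i(1,2) unfolding layered_def by blast
    moreover have "L i \<noteq> L j"
    proof -
      have "i = 0 \<or> i = 1 \<or> i = 2" "j = 0 \<or> j = 1 \<or> j = 2" using i by auto
      then show ?thesis using L \<open>i \<noteq> j\<close> by auto
    qed
    ultimately show False by (simp split: if_splits)
  qed
  show ?thesis
  proof (intro inv_I_eq_of_prechords prechords_fixed)
    fix a b assume "(a, b) \<in> precrossing_pairs D"
    then have "crossing D a b" "mark D a = Pre" unfolding precrossing_pairs_def by auto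
    then have "a \<notin> W" "b \<notin> W" using off P.crossing_window[of b a] crossing_sym by blast+
    then show "slide a = a \<and> slide b = b \<and> linking D' a b = linking D a b"
      by (simp add: slide_outside linking_slide_outside)
  qed
qed

text \<open>The prechord of the picture joins the midpoints of arcs 0 and 1. It stays where it is, while each of
  the two arrows of the transverse strand 2 has one endpoint, on arc 0 or 1, that passes from one side
  of the midpoint to the other. So each arrow changes from linked to unlinked with the prechord or
  conversely. The two arrows change in the same way if \<open>r 0\<close> and \<open>r 1\<close> have equal signs, and in
  opposite ways otherwise. On the other hand, strand 2 meets the other two strands from opposite sides
  of the picture and is above both or below both, so the arrows have opposite signs exactly if
  \<open>r 0\<close> and \<open>r 1\<close> have equal signs. In both cases the label of the prechord does not change.\<close>

lemma inv_I_PR3: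
  assumes "move_PR3 D D'"
  shows "inv_I (gauss D) = inv_I (gauss D')"
proof -
  obtain s r L where rep: "replaces 3 (triangle 1) (triangle (- 1)) s r D D'"
    and lay: "layered 3 (triangle 1) s r L D" "layered 3 (triangle (- 1)) s r L D'"
    and L: "L 0 = L 1" "L 0 \<noteq> L 2"
    using assms unfolding move_PR3_def by blast
  obtain \<phi> \<phi>' where "slide_move 3 s r (triangle 1) (triangle_velocity 1)
      (triangle (- 1)) (triangle_velocity (- 1)) \<phi> \<phi>' D D'"
    by (rule slide_move_triangle[OF rep lay])
  then interpret slide_move 3 s r "triangle 1" "triangle_velocity 1"
      "triangle (- 1)" "triangle_velocity (- 1)" \<phi> \<phi>' D D' .
  let ?F = "\<lambda>k t. frac (pt k t)"
  have mark: "mark D (pt i t) = (if L i > L j then Over else if L i < L j then Under else Pre)"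
    if "i < 3" "j < 3" "i \<noteq> j" "t \<in> {-1..1}" "triangle 1 i t = triangle 1 j t" for i j t
    using lay(1) that unfolding layered_def by blast
  have meet: "triangle 1 i t = triangle 1 j t \<longleftrightarrow>
      ({i, j} = {0, 1} \<and> t = 0) \<or> ({i, j} = {0, 2} \<and> t = 1/2) \<or> ({i, j} = {1, 2} \<and> t = - (1/2))"
    if "i < 3" "j < 3" "i \<noteq> j" "t \<in> {-1..1}" for i j t
    using triangle_meet[OF _ that, of 1] unfolding triangle_eq by simp
  have cross: "crossing D (pt i t) (pt j t)" if "i < 3" "j < 3" "i \<noteq> j" "t \<in> {-1..1}" "triangle 1 i t = triangle 1 j t" for i j t
    using P.crossing_pt that by simp
  have picture: "\<exists>i j t m m'. i < 3 \<and> j < 3 \<and> i \<noteq> j \<and> t \<in> {-1..1} \<and>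
      a = pt i t + of_int m \<and> b = pt j t + of_int m' \<and> triangle 1 i t = triangle 1 j t \<and>
      mark D a = mark D (pt i t)"
    if cr: "crossing D a b" and W: "a \<in> W" for a b
  proof -
    from P.crossing_in_windowE[OF cr W] obtain i j t t' m m' where
      i: "i < 3" "j < 3" "t \<in> {-1<..<1}" "a = pt i t + of_int m" "b = pt j t' + of_int m'"
        "triangle 1 i t = triangle 1 j t'" "(i, t) \<noteq> (j, t')" by metis
    have "t \<in> {-1..1}" using i by auto
    moreover have "mark D a = mark D (pt i t)" unfolding i(4) pd_periodic[OF P.diagram] ..
    ultimately show ?thesis using i triangle_crossing[OF i(6,7)] by blast
  qed
  have m02: "triangle 1 0 (1/2) = triangle 1 2 (1/2)" "triangle 1 1 (- (1/2)) = triangle 1 2 (- (1/2))"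
    using meet[of 0 2 "1/2"] meet[of 1 2 "- (1/2)"] by auto
  have c0: "crossing D (pt 0 (1/2)) (pt 2 (1/2))" and c1: "crossing D (pt 1 (- (1/2))) (pt 2 (- (1/2)))"
    by (rule cross; use m02 in simp)+
  have k0: "mark D (pt 0 (1/2)) = (if L 0 > L 2 then Over else if L 0 < L 2 then Under else Pre)"
   and k1: "mark D (pt 1 (- (1/2))) = (if L 1 > L 2 then Over else if L 1 < L 2 then Under else Pre)"
    by (rule mark; use m02 in simp)+
  have n0: "mark D (pt 0 (1/2)) \<noteq> Pre" "mark D (pt 1 (- (1/2))) \<noteq> Pre" using k0 k1 L by auto
  let ?S = "{(?F 0 (1/2), ?F 2 (1/2)), (?F 2 (1/2), ?F 0 (1/2)),
      (?F 1 (- (1/2)), ?F 2 (- (1/2))), (?F 2 (- (1/2)), ?F 1 (- (1/2)))}"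
  have S: "{p \<in> classical_pairs D. fst p \<in> W} = ?S"
  proof (intro equalityI subsetI)
    fix p assume p: "p \<in> {p \<in> classical_pairs D. fst p \<in> W}"
    obtain u v where uv: "p = (u, v)" by (cases p)
    have u: "u \<in> {0..<1}" "v \<in> {0..<1}" "crossing D u v" "mark D u \<noteq> Pre" "u \<in> W"
      using p uv unfolding classical_pairs_def by auto
    obtain i j t m m' where i: "i < 3" "j < 3" "i \<noteq> j" "t \<in> {-1..1}" "u = pt i t + of_int m"
      "v = pt j t + of_int m'" "triangle 1 i t = triangle 1 j t" "mark D u = mark D (pt i t)"
      using picture[OF u(3,5)] by blast
    have "L i \<noteq> L j" using mark[OF i(1-4,7)] i(8) u(4) by auto
    then have "({i, j} = {0, 2} \<and> t = 1/2) \<or> ({i, j} = {1, 2} \<and> t = - (1/2))"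
      using meet[OF i(1-4)] i(7) L(1) by (auto simp: doubleton_eq_iff)
    moreover have "u = ?F i t"
    proof -
      have "frac u = u" using u(1) by (simp add: frac_eq)
      then show ?thesis unfolding i(5) by (simp add: frac_def)
    qed
    moreover have "v = ?F j t"
    proof -
      have "frac v = v" using u(2) by (simp add: frac_eq)
      then show ?thesis unfolding i(6) by (simp add: frac_def)
    qed
    ultimately have "p = (?F i t, ?F j t)"
      "((i = 0 \<and> j = 2 \<or> i = 2 \<and> j = 0) \<and> t = 1/2) \<or> ((i = 1 \<and> j = 2 \<or> i = 2 \<and> j = 1) \<and> t = - (1/2))"
      unfolding uv by (simp_all add: doubleton_eq_iff)
    then show "p \<in> ?S" by (elim disjE conjE) simp_all
  next
    have inS: "(?F i t, ?F j t) \<in> {p \<in> classical_pairs D. fst p \<in> W} \<and> (?F j t, ?F i t) \<in> {p \<in> classical_pairs D. fst p \<in> W}"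
      if "i < 3" "j < 3" "t \<in> {-1..1}" "crossing D (pt i t) (pt j t)" "mark D (pt i t) \<noteq> Pre" for i j t
    proof -
      have "pt i t \<in> W" "pt j t \<in> W" using pt_in_window[of i t 0] pt_in_window[of j t 0] that by auto
      moreover have "mark D (pt j t) \<noteq> Pre" using crossing_marks[OF P.diagram that(4)] that(5) by auto
      ultimately show ?thesis using that crossing_sym[OF that(4)] frac_unit
        unfolding crossing_pairs(1)[OF P.diagram] crossing_pairs_def
        by (simp add: window_frac crossing_frac[OF P.diagram] pd_frac[OF P.diagram] frac_lt_1)
    qed
    fix p assume "p \<in> ?S"
    then show "p \<in> {p \<in> classical_pairs D. fst p \<in> W}"
      using inS[OF _ _ _ c0 n0(1)] inS[OF _ _ _ c1 n0(2)] by auto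
  qed
  define d0 where "d0 = double_sign D (pt 0 (1/2)) (pt 2 (1/2))"
  define d1 where "d1 = double_sign D (pt 1 (- (1/2))) (pt 2 (- (1/2)))"
  have sym: "double_sign D (pt 2 (1/2)) (pt 0 (1/2)) = d0" "double_sign D (pt 2 (- (1/2))) (pt 1 (- (1/2))) = d1"
    unfolding d0_def d1_def by (rule double_sign_sym[OF P.diagram]; use c0 c1 n0 in simp)+
  \<comment> \<open>strand 2 meets strands 0 and 1 from opposite sides, and the upper strand is the same\<close>
  have d: "d1 = (if (r 0 > 0) = (r 1 > 0) then - d0 else d0)"
  proof -
    have "cross (vel D (pt 0 (1/2))) (vel D (pt 2 (1/2))) > 0 \<longleftrightarrow>
        (jacobian (\<phi>' 0) > 0) = ((r 0 > 0) = ((r 2 > 0) = False))"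
      by (subst P.cross_vel_pt_pos) (use c0 in \<open>auto simp: cross_def triangle_slope_def power2_eq_square\<close>)
    moreover have "cross (vel D (pt 1 (- (1/2)))) (vel D (pt 2 (- (1/2)))) > 0 \<longleftrightarrow>
        (jacobian (\<phi>' 0) > 0) = ((r 1 > 0) = ((r 2 > 0) = True))"
      by (subst P.cross_vel_pt_pos) (use c1 in \<open>auto simp: cross_def triangle_slope_def power2_eq_square\<close>)
    moreover have "mark D (pt 0 (1/2)) = Over \<longleftrightarrow> mark D (pt 1 (- (1/2))) = Over"
      using k0 k1 L(1) by auto
    ultimately show ?thesis unfolding d0_def d1_def double_sign_def by auto
  qed
  have linking01: "linking D' (s 0) (s 1) = linking D (s 0) (s 1)"
  proof -
    have sl: "slide (s 0) = s 0" "slide (s 1) = s 1" using slide_pt0[of 0 0] slide_pt0[of 1 0] by auto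
    have sl2: "slide (pt 0 (1/2)) = pt 0 (- (1/2))" "slide (pt 2 (1/2)) = pt 2 (- (1/2))"
      "slide (pt 1 (- (1/2))) = pt 1 (1/2)" "slide (pt 2 (- (1/2))) = pt 2 (1/2)"
      using slide_pt0[of 0 "1/2"] slide_pt0[of 2 "1/2"] slide_pt0[of 1 "- (1/2)"] slide_pt0[of 2 "- (1/2)"]
      by auto
    define k where "k = \<lfloor>s 0 - s 1\<rfloor>"
    have "s 0 - s 1 \<notin> \<int>" using pt_unique[of 0 1 0 0] by auto
    then have k': "\<lfloor>s 1 - s 0\<rfloor> = - 1 - k" unfolding k_def using floor_uminus[of "s 0 - s 1"] by simp
    have f0: "\<lfloor>pt 0 t - s 1\<rfloor> = k" if "t \<in> {-1..1}" for t
      using floor_arc_arc(1)[of 0 t 0 1 0] that unfolding k_def by simp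
    have f1: "\<lfloor>pt 1 t - s 0\<rfloor> = - 1 - k" if "t \<in> {-1..1}" for t
      using floor_arc_arc(1)[of 1 t 0 0 0] that k' by simp
    have f2: "\<lfloor>pt 2 t - s 0\<rfloor> = \<lfloor>s 2 - s 0\<rfloor>" "\<lfloor>pt 2 t - s 1\<rfloor> = \<lfloor>s 2 - s 1\<rfloor>" if "t \<in> {-1..1}" for t
      using floor_arc_arc(1)[of 2 t 0 0 0] floor_arc_arc(1)[of 2 t 0 1 0] that by simp_all
    define q where "q = \<lfloor>s 2 - s 0\<rfloor> - \<lfloor>s 2 - s 1\<rfloor>"
    have q: "q = - k \<or> q = - 1 - k" unfolding q_def k_def by linarith
    have rr: "\<bar>r 0\<bar> < 1/2" "\<bar>r 1\<bar> < 1/2" "r 0 \<noteq> 0" "r 1 \<noteq> 0"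
      using r_small[of 0] r_small[of 1] r_nonzero[of 0] r_nonzero[of 1] by auto
    have own: "\<lfloor>pt 0 (1/2) - s 0\<rfloor> = (if r 0 > 0 then 0 else - 1)"
      "\<lfloor>pt 0 (- (1/2)) - s 0\<rfloor> = (if r 0 > 0 then - 1 else 0)"
      "\<lfloor>pt 1 (1/2) - s 1\<rfloor> = (if r 1 > 0 then 0 else - 1)"
      "\<lfloor>pt 1 (- (1/2)) - s 1\<rfloor> = (if r 1 > 0 then - 1 else 0)"
      using rr by (auto intro!: floor_unique)
    have h: "1/2 \<in> {-1..1::real}" "- (1/2) \<in> {-1..1::real}" by auto
    have l: "linked (s 0) (s 1) (pt 0 (1/2)) (pt 2 (1/2)) \<longleftrightarrow> (if r 0 > 0 then 0 else - 1) - k \<noteq> q"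
      "linked (s 0) (s 1) (pt 0 (- (1/2))) (pt 2 (- (1/2))) \<longleftrightarrow> (if r 0 > 0 then - 1 else 0) - k \<noteq> q"
      "linked (s 0) (s 1) (pt 1 (1/2)) (pt 2 (1/2)) \<longleftrightarrow> - 1 - k - (if r 1 > 0 then 0 else - 1) \<noteq> q"
      "linked (s 0) (s 1) (pt 1 (- (1/2))) (pt 2 (- (1/2))) \<longleftrightarrow> - 1 - k - (if r 1 > 0 then - 1 else 0) \<noteq> q"
      unfolding linked_def q_def own f0[OF h(1)] f0[OF h(2)] f1[OF h(1)] f1[OF h(2)]
        f2(1)[OF h(1)] f2(1)[OF h(2)] f2(2)[OF h(1)] f2(2)[OF h(2)] by (rule refl)+
    have "distinct (map (\<lambda>(k, t). ?F k t) [(0, 1/2), (2, 1/2), (1, - (1/2)), (2, - (1/2))])"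
      unfolding distinct_map by (intro conjI inj_on_subset[OF disjoint]) auto
    then have dist: "distinct [?F 0 (1/2), ?F 2 (1/2), ?F 1 (- (1/2)), ?F 2 (- (1/2))]"
      unfolding list.map case_prod_conv .
    have "linking D' (s 0) (s 1) - linking D (s 0) (s 1) =
       2 * ((if linked (s 0) (s 1) (pt 0 (- (1/2))) (pt 2 (- (1/2))) then d0 else 0) -
            (if linked (s 0) (s 1) (pt 0 (1/2)) (pt 2 (1/2)) then d0 else 0) +
            (if linked (s 0) (s 1) (pt 1 (1/2)) (pt 2 (1/2)) then d1 else 0) -
            (if linked (s 0) (s 1) (pt 1 (- (1/2))) (pt 2 (- (1/2))) then d1 else 0))"
    proof -
      have dd: "double_sign D (?F 0 (1/2)) (?F 2 (1/2)) = d0" "double_sign D (?F 2 (1/2)) (?F 0 (1/2)) = d0"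
        "double_sign D (?F 1 (- (1/2))) (?F 2 (- (1/2))) = d1" "double_sign D (?F 2 (- (1/2))) (?F 1 (- (1/2))) = d1"
        unfolding double_sign_frac[OF P.diagram] by (rule d0_def[symmetric] sym d1_def[symmetric])+
      let ?G = "\<lambda>(u, v). (if linked (s 0) (s 1) (slide u) (slide v) then double_sign D u v else 0) -
          (if linked (s 0) (s 1) u v then double_sign D u v else 0)"
      have G: "?G (?F 0 (1/2), ?F 2 (1/2)) =
            (if linked (s 0) (s 1) (pt 0 (- (1/2))) (pt 2 (- (1/2))) then d0 else 0) -
            (if linked (s 0) (s 1) (pt 0 (1/2)) (pt 2 (1/2)) then d0 else 0)"
        "?G (?F 1 (- (1/2)), ?F 2 (- (1/2))) =
            (if linked (s 0) (s 1) (pt 1 (1/2)) (pt 2 (1/2)) then d1 else 0) -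
            (if linked (s 0) (s 1) (pt 1 (- (1/2))) (pt 2 (- (1/2))) then d1 else 0)"
        unfolding case_prod_conv linked_slide_frac linked_frac dd sl2 by (rule refl)+
      have G': "?G (?F 2 (1/2), ?F 0 (1/2)) = ?G (?F 0 (1/2), ?F 2 (1/2))"
        "?G (?F 2 (- (1/2)), ?F 1 (- (1/2))) = ?G (?F 1 (- (1/2)), ?F 2 (- (1/2)))"
        unfolding case_prod_conv dd linked_sym(2)[of "s 0" "s 1" "slide (?F 2 _)"]
          linked_sym(2)[of "s 0" "s 1" "?F 2 _"] by (rule refl)+
      have "linking D' (s 0) (s 1) - linking D (s 0) (s 1) = sum ?G ?S"
        using linking_difference[of "s 0" "s 1"] unfolding sl S .
      also have "\<dots> = 2 * (?G (?F 0 (1/2), ?F 2 (1/2)) + ?G (?F 1 (- (1/2)), ?F 2 (- (1/2))))"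
        by (rule sum_two_swapped_pairs[OF dist G'])
      finally show ?thesis unfolding G by (simp add: algebra_simps)
    qed
    also have "\<dots> = 0" unfolding l using q rr(3,4) unfolding d by auto
    finally show ?thesis by simp
  qed
  show ?thesis
  proof (intro inv_I_eq_of_prechords prechords_fixed)
    fix a b assume "(a, b) \<in> precrossing_pairs D"
    then have ab: "crossing D a b" "mark D a = Pre" unfolding precrossing_pairs_def by auto
    show "slide a = a \<and> slide b = b \<and> linking D' a b = linking D a b"
    proof (cases "a \<in> W")
      case True
      obtain i j t m m' where i: "i < 3" "j < 3" "i \<noteq> j" "t \<in> {-1..1}" "a = pt i t + of_int m"
        "b = pt j t + of_int m'" "triangle 1 i t = triangle 1 j t" "mark D a = mark D (pt i t)"
        using picture[OF ab(1) True] by blast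
      have "L i = L j" using mark[OF i(1-4,7)] i(8) ab(2) by (auto split: if_splits)
      then have "{i, j} = {0, 1} \<and> t = 0"
        using meet[OF i(1-4)] i(7) L by (auto simp: doubleton_eq_iff)
      then have ij: "i = 0 \<and> j = 1 \<or> i = 1 \<and> j = 0" "t = 0" by (auto simp: doubleton_eq_iff)
      have "slide a = a" "slide b = b"
        unfolding i(5,6) slide_pt[OF i(1,4)] slide_pt[OF i(2,4)] using ij(2) by simp_all
      moreover have "linking D' a b = linking D a b"
        unfolding i(5,6) linking_shift using ij linking01 linking_sym[of _ "s 0" "s 1"] by auto
      ultimately show ?thesis by simp
    next
      case False
      then have "b \<notin> W" using P.crossing_window[of b a] crossing_sym[OF ab(1)] by blast
      with False show ?thesis by (simp add: slide_outside linking_slide_outside)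
    qed
  qed
qed

section \<open>Passing a classical crossing through a precrossing\<close>

lemma linked_shift:
  "linked (a + of_int i) (b + of_int j) (u + of_int k) (v + of_int l) = linked a b u v"
proof -
  have "frac (x + of_int m) = frac x" for x :: real and m by (simp add: frac_def)
  then show ?thesis using linked_frac by metis
qed

text \<open>If each chord has its ends on different sides of the other one, the same is true with the roles of
  the chords exchanged.\<close>

lemma linked_exchange:
  assumes "u - a \<notin> \<int>" "u - b \<notin> \<int>" "v - a \<notin> \<int>" "v - b \<notin> \<int>"
  shows "linked a b u v = linked u v a b"
  unfolding linked_def
  using floor_uminus[OF assms(1)] floor_uminus[OF assms(2)] floor_uminus[OF assms(3)] floor_uminus[OF assms(4)]
  by auto

text \<open>The homeomorphism is piecewise linear on the arc around \<open>\<sigma>\<close> and fixes the rest of the circle.\<close>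

lemma half_turn_homeo:
  fixes \<sigma> \<rho> :: real
  assumes \<rho>: "0 < \<rho>" "\<rho> < 1 / 2"
  obtains g where "circle_homeo g" "g (\<sigma> + \<rho> / 2) = \<sigma> - \<rho> / 2"
    "\<And>u. (\<And>m::int. \<bar>u - \<sigma> - of_int m\<bar> > \<rho>) \<Longrightarrow> g u = u"
proof -
  \<comment> \<open>lines of slope \<open>1/3\<close> and 3 through the fixed points \<open>- \<rho>\<close> and \<open>\<rho>\<close>, which meet over \<open>\<rho> / 2\<close>
    at the height \<open>- \<rho> / 2\<close>; \<open>h'\<close> is the inverse of \<open>h\<close>, and \<open>n t\<close> counts the period around \<open>\<sigma>\<close> to
    which \<open>t\<close> belongs\<close>
  define h where "h x = min x (max ((x - 2 * \<rho>) / 3) (3 * x - 2 * \<rho>))" for x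
  define h' where "h' x = max x (min (3 * x + 2 * \<rho>) ((x + 2 * \<rho>) / 3))" for x
  define n where "n t = \<lfloor>t - \<sigma> + 1 / 2\<rfloor>" for t
  define g where "g t = \<sigma> + of_int (n t) + h (t - \<sigma> - of_int (n t))" for t
  have n: "- 1 / 2 \<le> t - \<sigma> - of_int (n t)" "t - \<sigma> - of_int (n t) < 1 / 2" for t
    unfolding n_def by linarith+
  have n_eq: "n t = m" if "- 1 / 2 \<le> t - \<sigma> - of_int m" "t - \<sigma> - of_int m < 1 / 2" for t m
    unfolding n_def by (rule floor_unique) (use that in linarith)+
  have mono: "h x < h y" if "x < y" for x y
    using that unfolding h_def min_def max_def by (auto split: if_splits)
  have range: "- 1 / 2 \<le> h x" "h x < 1 / 2" if "- 1 / 2 \<le> x" "x < 1 / 2" for x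
    using that \<rho> unfolding h_def min_def max_def by (auto split: if_splits)
  have range': "- 1 / 2 \<le> h' x" "h' x < 1 / 2" if "- 1 / 2 \<le> x" "x < 1 / 2" for x
    using that \<rho> unfolding h'_def min_def max_def by (auto split: if_splits)
  have inv: "h (h' x) = x" for x
    using \<rho> unfolding h_def h'_def min_def max_def by (auto split: if_splits) (simp add: field_simps)
  have "circle_homeo g"
  proof (rule circle_homeoI)
    show "g (t + 1) = g t + 1" for t
    proof -
      have "n (t + 1) = n t + 1" unfolding n_def by linarith
      then show ?thesis unfolding g_def by (simp add: algebra_simps)
    qed
    show "strict_mono g"
    proof (rule strict_monoI)
      fix x y :: real assume "x < y"
      then have "n x \<le> n y" unfolding n_def by (intro floor_mono) simp
      then consider "n x = n y" | "n x + 1 \<le> n y" by linarith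
      then show "g x < g y"
      proof cases
        case 1
        then show ?thesis using mono[of "x - \<sigma> - of_int (n x)" "y - \<sigma> - of_int (n x)"] \<open>x < y\<close>
          unfolding g_def by simp
      next
        case 2
        then have "of_int (n x) + 1 \<le> (of_int (n y) :: real)" by linarith
        with range(2)[OF n[of x]] range(1)[OF n[of y]] show ?thesis unfolding g_def by linarith
      qed
    qed
    have "g (\<sigma> + of_int (n y) + h' (y - \<sigma> - of_int (n y))) = y" for y
    proof -
      have "n (\<sigma> + of_int (n y) + h' (y - \<sigma> - of_int (n y))) = n y"
        by (rule n_eq) (use range'[OF n[of y]] in auto)
      then show ?thesis unfolding g_def by (simp add: inv)
    qed
    then show "surj g" by (rule surjI)
  qed
  moreover have "g (\<sigma> + \<rho> / 2) = \<sigma> - \<rho> / 2"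
  proof -
    have "n (\<sigma> + \<rho> / 2) = 0" by (rule n_eq) (use \<rho> in auto)
    then show ?thesis unfolding g_def h_def using \<rho> by (simp add: min_def max_def field_simps)
  qed
  moreover have "g u = u" if "\<And>m::int. \<bar>u - \<sigma> - of_int m\<bar> > \<rho>" for u
    using that[of "n u"] \<rho> unfolding g_def h_def min_def max_def by (auto split: if_splits)
  ultimately show ?thesis by (rule that)
qed

context strands
begin

text \<open>A reflection of an arc is not induced by a homeomorphism of the circle that fixes the complement of
  the arc, but its effect on the single point with the parameter \<open>1/2\<close> is.\<close>

lemma slide_homeo:
  assumes k: "k < n"
  obtains g where "circle_homeo g" "g (pt k (1 / 2)) = pt k (- (1 / 2))"
    "\<And>u. (\<And>\<tau>. \<tau> \<in> {-1..1} \<Longrightarrow> pt k \<tau> - u \<notin> \<int>) \<Longrightarrow> g u = u"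
proof -
  have r: "0 < \<bar>r k\<bar>" "\<bar>r k\<bar> < 1 / 2" using r_nonzero[OF k] r_small[OF k] by auto
  have far: "\<bar>u - s k - of_int m\<bar> > \<bar>r k\<bar>" if "\<And>\<tau>. \<tau> \<in> {-1..1} \<Longrightarrow> pt k \<tau> - u \<notin> \<int>" for u and m :: int
  proof (rule ccontr)
    assume "\<not> ?thesis"
    then have "\<bar>(u - s k - of_int m) / r k\<bar> \<le> 1" using r unfolding abs_divide by (simp add: divide_le_eq)
    then have "(u - s k - of_int m) / r k \<in> {-1..1}" unfolding abs_le_iff by simp
    from that[OF this] r have "- of_int m \<notin> (\<int> :: real set)" by simp
    then show False by simp
  qed
  show ?thesis
  proof (cases "r k > 0")
    case True
    obtain g where g: "circle_homeo g" "g (s k + r k / 2) = s k - r k / 2"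
      "\<And>u. (\<And>m::int. \<bar>u - s k - of_int m\<bar> > r k) \<Longrightarrow> g u = u"
      using half_turn_homeo[of "r k" "s k"] r True by auto
    show ?thesis by (rule that[of g]) (use g far True in auto)
  next
    case False
    then have neg: "\<bar>r k\<bar> = - r k" by simp
    obtain g where g: "circle_homeo g" "g (- s k + \<bar>r k\<bar> / 2) = - s k - \<bar>r k\<bar> / 2"
      "\<And>u. (\<And>m::int. \<bar>u - (- s k) - of_int m\<bar> > \<bar>r k\<bar>) \<Longrightarrow> g u = u"
      using half_turn_homeo[OF r, of "- s k"] by blast
    \<comment> \<open>the point moves in the positive direction, hence the conjugation with the reflection of the
      line\<close>
    define g' where "g' t = - g (- t)" for t
    have "circle_homeo g'"
    proof -
      have "g (- (t + 1)) = g (- t) - 1" for t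
        using circle_homeo_int[OF g(1), of "- t" "- 1"] by simp
      moreover have "continuous_on UNIV g'"
        using g(1) unfolding g'_def circle_homeo_def
        by (auto intro!: continuous_intros continuous_on_compose2[of UNIV g UNIV uminus])
      moreover have "strict_mono g'"
        using g(1) unfolding g'_def circle_homeo_def strict_mono_def by simp
      ultimately show ?thesis unfolding circle_homeo_def by (simp add: g'_def)
    qed
    moreover have "g' (pt k (1 / 2)) = pt k (- (1 / 2))"
      using g(2) unfolding g'_def neg by simp
    moreover have "g' u = u" if u: "\<And>\<tau>. \<tau> \<in> {-1..1} \<Longrightarrow> pt k \<tau> - u \<notin> \<int>" for u
    proof -
      have "\<bar>- u - (- s k) - of_int m\<bar> > \<bar>r k\<bar>" for m :: int
        using far[OF u, of "- m"] by (simp add: abs_minus_commute algebra_simps)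
      then show ?thesis using g(3)[of "- u"] unfolding g'_def by simp
    qed
    ultimately show ?thesis by (rule that)
  qed
qed

end

abbreviation bigon_velocity :: "nat \<Rightarrow> real \<Rightarrow> complex" where
  "bigon_velocity \<equiv> \<lambda>k t. Complex 1 (if k = 0 then 0 else 2 * t)"

lemma bigon_crossing:
  assumes "bigon i t = bigon j t'" "(i, t) \<noteq> (j, t')" "i < 2" "j < 2"
  shows "t' = t" "i = 0 \<and> j = 1 \<or> i = 1 \<and> j = 0" "t = 1 / 2 \<or> t = - (1 / 2)"
proof -
  have t: "t' = t" "bigon_height i t = bigon_height j t'" using assms(1) unfolding bigon_eq by auto
  then have "i \<noteq> j" using assms(2) by auto
  then show "t' = t" "i = 0 \<and> j = 1 \<or> i = 1 \<and> j = 0" "t = 1 / 2 \<or> t = - (1 / 2)"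
    using t bigon_meet[OF assms(3,4), of t] assms(3,4) by auto
qed

text \<open>The reflection carries the prechord of the picture to the place of its arrow and conversely. All
  labels are preserved, and the new positions of the endpoints of prechords are attained by a
  homeomorphism, because every arc contains only one such endpoint.\<close>

lemma inv_I_PR2:
  assumes "move_PR2 D D'"
  shows "inv_I (gauss D) = inv_I (gauss D')"
proof -
  obtain s r x y where rep: "replaces 2 bigon bigon s r D D'" and xy: "(x, y) \<in> {(Over, Under), (Under, Over)}"
    and m: "mark D (s 0 + r 0 * (- (1/2))) = x" "mark D (s 1 + r 1 * (- (1/2))) = y"
      "mark D (s 0 + r 0 * (1/2)) = Pre" "mark D (s 1 + r 1 * (1/2)) = Pre"
      "mark D' (s 0 + r 0 * (- (1/2))) = Pre" "mark D' (s 1 + r 1 * (- (1/2))) = Pre"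
      "mark D' (s 0 + r 0 * (1/2)) = y" "mark D' (s 1 + r 1 * (1/2)) = x"
    using assms unfolding move_PR2_def by auto
  obtain \<phi> \<phi>' where R: "replacement 2 s r bigon bigon_velocity bigon bigon_velocity \<phi> \<phi>' D D'"
    by (rule replacesE[OF rep arc_system_bigon arc_system_bigon])
  have glue: "bigon i (- t) = bigon j (- t') \<longleftrightarrow> bigon i t = bigon j t'" for i j t t'
    unfolding bigon_eq bigon_height_def by simp
  have "slide_move 2 s r bigon bigon_velocity bigon bigon_velocity \<phi> \<phi>' D D'"
  proof -
    interpret R: replacement 2 s r bigon bigon_velocity bigon bigon_velocity \<phi> \<phi>' D D' by (rule R)
    show ?thesis
    proof (intro slide_move.intro[OF R] slide_move_axioms.intro glue)
      fix i j :: nat and t t' :: real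
      assume h: "i < 2" "j < 2" "t \<in> {-1<..<1}" "t' \<in> {-1<..<1}"
        "crossing D (s i + r i * t) (s j + r j * t')"
      have t: "t \<in> {-1..1}" "t' \<in> {-1..1}" "- t \<in> {-1..1}" "- t' \<in> {-1..1}"
        "- t \<in> {-1<..<1}" "- t' \<in> {-1<..<1}" using h by auto
      have e: "bigon i t = bigon j t'" "(i, t) \<noteq> (j, t')"
        using R.P.crossing_pt[OF h(1,2) t(1,2)] h(5) by auto
      have cr: "crossing D' (s i + r i * (- t)) (s j + r j * (- t'))"
        using R.P'.crossing_pt[OF h(1,2) t(3,4)] glue e by auto
      note cases = bigon_crossing[OF e h(1,2)]
      show "(mark D' (s i + r i * (- t)) = Pre) = (mark D (s i + r i * t) = Pre)"
        using cases(3)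
      proof
        assume "t = 1/2" show ?thesis unfolding \<open>t = 1/2\<close> using cases(2) m xy by auto
      next
        assume "t = - (1/2)" show ?thesis unfolding \<open>t = - (1/2)\<close> using cases(2) m xy by auto
      qed
      assume np: "mark D (s i + r i * t) \<noteq> Pre"
      have "t \<noteq> 1/2"
      proof
        assume "t = 1/2" show False using np cases(2) m unfolding \<open>t = 1/2\<close> by auto
      qed
      then have t2: "t = - (1/2)" using cases(3) by blast
      have "mark D' (s i + r i * (- t)) = Over \<longleftrightarrow> mark D (s i + r i * t) \<noteq> Over"
        using cases(2) m xy unfolding t2 by auto
      moreover have "cross (bigon_velocity i (- t)) (bigon_velocity j (- t')) > 0 \<longleftrightarrow>
          \<not> cross (bigon_velocity i t) (bigon_velocity j t') > 0"
        using cases(2) unfolding cases(1) t2 by (auto simp: cross_def)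
      ultimately show "double_sign D' (s i + r i * (- t)) (s j + r j * (- t')) =
          double_sign D (s i + r i * t) (s j + r j * t')"
        unfolding double_sign_def R.P.cross_vel_pt_pos[OF h] R.P'.cross_vel_pt_pos[OF h(1,2) t(5,6) cr]
        by auto
    qed
  qed
  then interpret slide_move 2 s r bigon bigon_velocity bigon bigon_velocity \<phi> \<phi>' D D' .
  have picture: "\<exists>i j m m'. (i = 0 \<and> j = 1 \<or> i = 1 \<and> j = 0) \<and>
      a = pt i (if mark D a = Pre then 1/2 else - (1/2)) + of_int m \<and>
      b = pt j (if mark D a = Pre then 1/2 else - (1/2)) + of_int m'"
    if cr: "crossing D a b" and W: "a \<in> W" for a b
  proof -
    from P.crossing_in_windowE[OF cr W] obtain i j t t' k k' where
      i: "i < 2" "j < 2" "a = pt i t + of_int k" "b = pt j t' + of_int k'"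
        "bigon i t = bigon j t'" "(i, t) \<noteq> (j, t')" by metis
    note cases = bigon_crossing[OF i(5,6,1,2)]
    have "mark D a = mark D (pt i t)" unfolding i(3) pd_periodic[OF P.diagram] ..
    moreover have "(if mark D (pt i t) = Pre then 1/2 else - (1/2)) = t"
      using cases(3)
    proof
      assume "t = 1/2" show ?thesis unfolding \<open>t = 1/2\<close> using cases(2) m xy by auto
    next
      assume "t = - (1/2)" show ?thesis unfolding \<open>t = - (1/2)\<close> using cases(2) m xy by auto
    qed
    ultimately have q: "(if mark D a = Pre then 1/2 else - (1/2)) = t" by simp
    show ?thesis unfolding q using cases(2) i(3) i(4)[unfolded cases(1)] by blast
  qed
  have link: "linking D' (slide a) (slide b) = linking D a b" if ab: "(a, b) \<in> precrossing_pairs D" for a b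
  proof -
    have cr: "crossing D a b" "mark D a = Pre" using ab unfolding precrossing_pairs_def by auto
    show ?thesis
    proof (cases "a \<in> W")
      case True
      obtain i j k k' where i: "i = 0 \<and> j = 1 \<or> i = 1 \<and> j = 0"
        "a = pt i (1/2) + of_int k" "b = pt j (1/2) + of_int k'"
        using picture[OF cr(1) True] cr(2) by auto
      have ij: "i < 2" "j < 2" using i(1) by auto
      have sl: "slide (pt l (1/2) + of_int q) = pt l (- (1/2)) + of_int q"
        "slide (pt l (- (1/2)) + of_int q) = pt l (1/2) + of_int q" if "l < 2" for l q
        using slide_pt[OF that, of "1/2" q] slide_pt[OF that, of "- (1/2)" q] by auto
      have "linked (slide a) (slide b) (slide u) (slide v) = linked a b u v"
        if "(u, v) \<in> {p \<in> classical_pairs D. fst p \<in> W}" for u v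
      proof -
        have uv: "crossing D u v" "u \<in> W" "mark D u \<noteq> Pre" using that unfolding classical_pairs_def by auto
        obtain i' j' l l' where i': "i' = 0 \<and> j' = 1 \<or> i' = 1 \<and> j' = 0"
          "u = pt i' (- (1/2)) + of_int l" "v = pt j' (- (1/2)) + of_int l'"
          using picture[OF uv(1,2)] uv(3) by auto
        have ij': "i' < 2" "j' < 2" using i'(1) by auto
        have ne: "pt p t - pt q t' \<notin> \<int>" if "p < 2" "q < 2" "t \<in> {-1..1}" "t' \<in> {-1..1}" "t \<noteq> t'" for p q t t'
          using pt_unique[OF that(1-4)] that(5) by blast
        \<comment> \<open>the two chords trade places, and being linked is symmetric\<close>
        have "linked (pt i (- (1/2))) (pt j (- (1/2))) (pt i' (1/2)) (pt j' (1/2)) =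
            linked (pt i' (1/2)) (pt j' (1/2)) (pt i (- (1/2))) (pt j (- (1/2)))"
          by (intro linked_exchange ne ij ij') auto
        also have "\<dots> = linked (pt i (1/2)) (pt j (1/2)) (pt i' (- (1/2))) (pt j' (- (1/2)))"
          using i(1) i'(1) linked_sym(1)[of "pt 0 (1/2)" "pt 1 (1/2)"]
            linked_sym(2)[of _ _ "pt 0 (- (1/2))" "pt 1 (- (1/2))"] by auto
        finally show ?thesis
          unfolding i(2,3) i'(2,3) sl[OF ij(1)] sl[OF ij(2)] sl[OF ij'(1)] sl[OF ij'(2)] linked_shift .
      qed
      then have "linking D' (slide a) (slide b) - linking D a b = 0"
        unfolding linking_difference by (intro sum.neutral) auto
      then show ?thesis by simp
    next
      case False
      then have "b \<notin> W" using P.crossing_window[of b a] crossing_sym[OF cr(1)] by blast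
      with False show ?thesis by (simp add: slide_outside linking_slide_outside)
    qed
  qed
  obtain g0 where g0: "circle_homeo g0" "g0 (pt 0 (1/2)) = pt 0 (- (1/2))"
    "\<And>u. (\<And>\<tau>. \<tau> \<in> {-1..1} \<Longrightarrow> pt 0 \<tau> - u \<notin> \<int>) \<Longrightarrow> g0 u = u"
    by (rule slide_homeo[of 0]) auto
  obtain g1 where g1: "circle_homeo g1" "g1 (pt 1 (1/2)) = pt 1 (- (1/2))"
    "\<And>u. (\<And>\<tau>. \<tau> \<in> {-1..1} \<Longrightarrow> pt 1 \<tau> - u \<notin> \<int>) \<Longrightarrow> g1 u = u"
    by (rule slide_homeo[of 1]) auto
  let ?g = "g1 \<circ> g0"
  have g: "circle_homeo ?g" by (rule circle_homeo_comp[OF g1(1) g0(1)])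
  have gs: "frac (?g a) = frac (slide a)" if cr: "crossing D a b" "mark D a = Pre" for a b
  proof (cases "a \<in> W")
    case True
    obtain i k where i: "i = 0 \<or> i = 1" "a = pt i (1/2) + of_int k"
      using picture[OF cr(1) True] cr(2) by auto
    have "?g (pt i (1/2)) = pt i (- (1/2))"
    proof -
      have "g1 (pt 0 (- (1/2))) = pt 0 (- (1/2))"
        by (rule g1(3)) (use pt_unique[of 1 0 _ "- (1/2)"] in auto)
      moreover have "g0 (pt 1 (1/2)) = pt 1 (1/2)"
        by (rule g0(3)) (use pt_unique[of 0 1 _ "1/2"] in auto)
      ultimately show ?thesis using i(1) g0(2) g1(2) by auto
    qed
    moreover have "slide a = pt i (- (1/2)) + of_int k" using i slide_pt[of i "1/2" k] by auto
    ultimately show ?thesis unfolding i(2) circle_homeo_int[OF g] using i(2) by simp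
  next
    case False
    then have "g0 a = a" "g1 a = a" using g0(3)[of a] g1(3)[of a] pt_off_window[of 0 _ a] pt_off_window[of 1 _ a] by auto
    then show ?thesis using False by (simp add: slide_outside)
  qed
  have "prechords (gauss D') = transport ?g (prechords (gauss D))"
  proof -
    have pp: "precrossing_pairs D' = slide_pair ` precrossing_pairs D"
      using crossing_pairs_slide[of True] crossing_pairs(2)[OF P.diagram] crossing_pairs(2)[OF P'.diagram]
      by simp
    have eq: "{frac (slide a), frac (slide b)} = (\<lambda>x. frac (?g x)) ` {a, b}"
      "linking D' (frac (slide a)) (frac (slide b)) = linking D a b"
      if "(a, b) \<in> precrossing_pairs D" for a b
    proof -
      have "crossing D a b" "mark D a = Pre" using that unfolding precrossing_pairs_def by auto
      moreover from this have "crossing D b a" "mark D b = Pre"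
        using crossing_sym crossing_marks[OF P.diagram, of a b] by auto
      ultimately show "{frac (slide a), frac (slide b)} = (\<lambda>x. frac (?g x)) ` {a, b}" using gs by simp
      show "linking D' (frac (slide a)) (frac (slide b)) = linking D a b" using link[OF that] by simp
    qed
    show ?thesis
      unfolding prechords_eq_linking[OF P.diagram] prechords_eq_linking[OF P'.diagram] pp transport_def image_image
    proof (rule image_cong[OF refl])
      fix p assume p: "p \<in> precrossing_pairs D"
      obtain a b where ab: "p = (a, b)" by (cases p)
      show "(case slide_pair p of (a, b) \<Rightarrow> ({a, b}, linking D' a b div 2)) =
          (case case p of (a, b) \<Rightarrow> ({a, b}, linking D a b div 2) of (c, i) \<Rightarrow> ((\<lambda>x. frac (?g x)) ` c, i))"
        using eq[of a b] p unfolding ab slide_pair_def fst_conv snd_conv case_prod_conv by simp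
    qed
  qed
  then show ?thesis using inv_I_eqI[OF g P.diagram] by simp
qed

section \<open>Creating crossings\<close>

text \<open>The arcs of \<open>D\<close> are embedded and disjoint, so all crossings of the window are created by the move.\<close>

locale creation = replacement +
  assumes embedded: "i < n \<Longrightarrow> j < n \<Longrightarrow> t \<in> {-1..1} \<Longrightarrow> t' \<in> {-1..1} \<Longrightarrow> c i t = c j t' \<Longrightarrow> (i, t) = (j, t')"
begin

lemma old_crossing_outside:
  assumes "crossing D u v"
  shows "u \<notin> W" "v \<notin> W"
proof -
  have "a \<notin> W" if cr: "crossing D a b" for a b
  proof
    assume "a \<in> W"
    from P.crossing_in_windowE[OF cr this] obtain i j t t' where
      i: "i < n" "j < n" "t \<in> {-1<..<1}" "t' \<in> {-1<..<1}" "c i t = c j t'" "(i, t) \<noteq> (j, t')"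
      by metis
    then show False using embedded[of i j t t'] by auto
  qed
  then show "u \<notin> W" "v \<notin> W" using assms crossing_sym by blast+
qed

lemma crossing_pairs_created:
  "crossing_pairs D' q = crossing_pairs D q \<union> {p \<in> crossing_pairs D' q. fst p \<in> W}"
proof -
  have "(u, v) \<in> crossing_pairs D' q \<longleftrightarrow> (u, v) \<in> crossing_pairs D q" if "u \<notin> W" for u v
    using that crossing_outside[OF that] old_crossing_outside[of u v] same(2)[OF that]
    unfolding crossing_pairs_def by auto
  moreover have "u \<notin> W" if "(u, v) \<in> crossing_pairs D q" for u v
    using that old_crossing_outside(1) unfolding crossing_pairs_def by blast
  ultimately show ?thesis by fastforce
qed

lemma linking_created:
  "linking D' a b = linking D a b +
    (\<Sum>(u, v) \<in> {p \<in> classical_pairs D'. fst p \<in> W}. if linked a b u v then double_sign D' u v else 0)"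
proof -
  let ?g = "\<lambda>X (u, v). if linked a b u v then double_sign X u v else 0"
  let ?N = "{p \<in> classical_pairs D'. fst p \<in> W}"
  have old: "u \<notin> W \<and> v \<notin> W" if "(u, v) \<in> classical_pairs D" for u v
    using that old_crossing_outside unfolding classical_pairs_def by blast
  have "classical_pairs D' = classical_pairs D \<union> ?N"
    using crossing_pairs_created[of False] crossing_pairs(1)[OF P.diagram] crossing_pairs(1)[OF P'.diagram]
    by simp
  then have "linking D' a b = sum (?g D') (classical_pairs D \<union> ?N)" unfolding linking_def by simp
  also have "\<dots> = sum (?g D') (classical_pairs D) + sum (?g D') ?N"
    by (rule sum.union_disjoint)
      (use old finite_pairs(1)[OF P.diagram] finite_pairs(1)[OF P'.diagram] in auto)
  also have "sum (?g D') (classical_pairs D) = linking D a b"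
    unfolding linking_def by (rule sum.cong) (auto simp: double_sign_outside dest: old)
  finally show ?thesis .
qed

lemma old_prechord_outside:
  assumes "(a, b) \<in> precrossing_pairs D"
  shows "a \<notin> W" "b \<notin> W"
  using assms old_crossing_outside unfolding precrossing_pairs_def by blast+

text \<open>If only classical crossings are created, it suffices to compare the labels.\<close>

lemma prechords_unchanged:
  assumes "\<And>u v. crossing D' u v \<Longrightarrow> u \<in> W \<Longrightarrow> mark D' u \<noteq> Pre"
    and "\<And>a b. a \<notin> W \<Longrightarrow> b \<notin> W \<Longrightarrow> linking D' a b = linking D a b"
  shows "prechords (gauss D) = prechords (gauss D')"
proof -
  have "{p \<in> crossing_pairs D' True. fst p \<in> W} = {}"
    using assms(1) unfolding crossing_pairs_def by auto
  then have "precrossing_pairs D' = precrossing_pairs D"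
    using crossing_pairs_created[of True] crossing_pairs(2)[OF P.diagram] crossing_pairs(2)[OF P'.diagram]
    by (metis Un_empty_right)
  then show ?thesis
    unfolding prechords_eq_linking[OF P.diagram] prechords_eq_linking[OF P'.diagram]
    using assms(2) old_prechord_outside by (auto intro!: image_cong)
qed

end

lemma creation_kink:
  assumes "replaces 1 flat kink s r D D'"
  obtains dc \<phi> \<phi>' where "creation 1 s r flat (\<lambda>k t. Complex 1 0) kink dc \<phi> \<phi>' D D'"
proof -
  obtain dc where "arc_system 1 kink dc" using arc_system_kink by blast
  then obtain \<phi> \<phi>' where R: "replacement 1 s r flat (\<lambda>k t. Complex 1 0) kink dc \<phi> \<phi>' D D'"
    by (rule replacesE[OF assms arc_system_flat])
  have "creation 1 s r flat (\<lambda>k t. Complex 1 0) kink dc \<phi> \<phi>' D D'"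
    by (intro creation.intro[OF R] creation_axioms.intro) (auto simp: flat_def)
  then show ?thesis by (rule that)
qed

locale kink_creation = creation 1 s r flat dc kink dc' \<phi> \<phi>' D D'
  for s r :: "nat \<Rightarrow> real" and dc dc' \<phi> \<phi>' D D'
begin

lemma kink_crossing: "crossing D' (pt 0 (1/2)) (pt 0 (- (1/2)))"
  using P'.crossing_pt[of 0 0 "1/2" "- (1/2)"] kink_ends by simp

lemma created_crossing:
  assumes "crossing D' u v" "u \<in> W"
  obtains t m m' where "t = 1/2 \<or> t = - (1/2)" "u = pt 0 t + of_int m" "v = pt 0 (- t) + of_int m'"
proof -
  from P'.crossing_in_windowE[OF assms] obtain i j t t' m m' where
    i: "i < 1" "j < 1" "t \<in> {-1<..<1}" "t' \<in> {-1<..<1}" "u = pt i t + of_int m" "v = pt j t' + of_int m'"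
      "kink i t = kink j t'" "(i, t) \<noteq> (j, t')" by metis
  have "t \<in> {-1..1}" "t' \<in> {-1..1}" "kink 0 t = kink 0 t'" "t \<noteq> t'" using i by auto
  from kink_double[OF this] that[of t m m'] i show ?thesis by simp
qed

lemma created_mark:
  assumes "crossing D' u v" "u \<in> W"
  shows "mark D' u = Pre \<longleftrightarrow> mark D' (pt 0 (1/2)) = Pre"
proof -
  obtain t m m' where t: "t = 1/2 \<or> t = - (1/2)" "u = pt 0 t + of_int m" "v = pt 0 (- t) + of_int m'"
    by (rule created_crossing[OF assms])
  have "mark D' (pt 0 (1/2)) = Pre \<longleftrightarrow> mark D' (pt 0 (- (1/2))) = Pre"
    using crossing_marks[OF P'.diagram kink_crossing] by auto
  then show ?thesis using t(1) unfolding t(2) pd_periodic[OF P'.diagram] by blast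
qed

end

text \<open>Seen from a point off the arc, the two ends of the new arrow lie in the same place.\<close>

lemma inv_I_R1:
  assumes "move_R1 D D'"
  shows "inv_I (gauss D) = inv_I (gauss D')"
proof -
  obtain s r where rep: "replaces 1 flat kink s r D D'" and m: "mark D' (s 0 + r 0 * (1/2)) \<noteq> Pre"
    using assms unfolding move_R1_def by blast
  obtain dc \<phi> \<phi>' where "creation 1 s r flat (\<lambda>k t. Complex 1 0) kink dc \<phi> \<phi>' D D'"
    by (rule creation_kink[OF rep])
  then interpret kink_creation s r "\<lambda>k t. Complex 1 0" dc \<phi> \<phi>' D D' by (rule kink_creation.intro)
  show ?thesis
  proof (intro inv_I_eq_of_prechords prechords_unchanged)
    show "mark D' u \<noteq> Pre" if "crossing D' u v" "u \<in> W" for u v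
      using created_mark[OF that] m by simp
    fix a b assume ab: "a \<notin> W" "b \<notin> W"
    have "\<not> linked a b u v" if uv: "crossing D' u v" "u \<in> W" for u v
    proof -
      obtain t i j where t: "t = 1/2 \<or> t = - (1/2)" "u = pt 0 t + of_int i" "v = pt 0 (- t) + of_int j"
        by (rule created_crossing[OF uv])
      have "\<lfloor>pt 0 t - x\<rfloor> = \<lfloor>pt 0 (- t) - x\<rfloor>" if "x \<notin> W" for x
        by (rule floor_arc_off_window(1)) (use t(1) that in auto)
      then have "\<not> linked a b (pt 0 t) (pt 0 (- t))" using ab unfolding linked_def by simp
      then show ?thesis unfolding t(2,3) using linked_shift[of a 0 b 0] by simp
    qed
    then show "linking D' a b = linking D a b"
      unfolding linking_created by (auto intro!: sum.neutral simp: classical_pairs_def)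
  qed
qed

text \<open>By confluence the deletions may start with the chord \<open>c\<close>.\<close>

lemma delete_all_insert:
  assumes "finite X" "(c, 0) \<notin> X" "adjacent_ends (insert (c, 0) X) c"
  shows "delete_all (insert (c, 0) X) = delete_all X"
proof (rule delete_all_eqI)
  have "delete_chord (insert (c, 0) X) X" unfolding delete_chord_def using assms(2,3) by blast
  then show "delete_all_spec (insert (c, 0) X) (delete_all X)"
    using delete_all_spec_delete_all[OF assms(1)] unfolding delete_all_spec_def
    by (meson converse_rtranclp_into_rtranclp)
qed (use assms(1) in simp)

text \<open>The new prechord has label 0 and adjacent ends, since every other endpoint lies off the arc of the
  kink. The labels of the old prechords do not change because the new crossing is not classical.\<close>

lemma inv_I_PR1:
  assumes "move_PR1 D D'"
  shows "inv_I (gauss D) = inv_I (gauss D')"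
proof -
  obtain s r where rep: "replaces 1 flat kink s r D D'" and m: "mark D' (s 0 + r 0 * (1/2)) = Pre"
    using assms unfolding move_PR1_def by blast
  obtain dc \<phi> \<phi>' where "creation 1 s r flat (\<lambda>k t. Complex 1 0) kink dc \<phi> \<phi>' D D'"
    by (rule creation_kink[OF rep])
  then interpret kink_creation s r "\<lambda>k t. Complex 1 0" dc \<phi> \<phi>' D D' by (rule kink_creation.intro)
  define p q where "p = frac (pt 0 (1/2))" and "q = frac (pt 0 (- (1/2)))"
  have unit: "p \<in> {0..<1}" "q \<in> {0..<1}" unfolding p_def q_def by (rule frac_unit)+
  have pW: "p \<in> W" unfolding p_def window_frac using pt_in_window[of 0 "1/2" 0] by simp
  have qW: "q \<in> W" unfolding q_def window_frac using pt_in_window[of 0 "- (1/2)" 0] by simp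
  have pq: "p \<noteq> q" using frac_pt_eq[of 0 0 "1/2" "- (1/2)"] unfolding p_def q_def by simp
  have cr: "crossing D' p q" unfolding p_def q_def crossing_frac[OF P'.diagram] by (rule kink_crossing)
  have mp: "mark D' p = Pre" unfolding p_def pd_frac[OF P'.diagram] by (rule m)
  then have mq: "mark D' q = Pre" using crossing_marks[OF P'.diagram cr] by auto
  have link: "linking D' a b = linking D a b" for a b
  proof -
    have none: "{p \<in> classical_pairs D'. fst p \<in> W} = {}"
      using created_mark m unfolding classical_pairs_def by auto
    show ?thesis unfolding linking_created none by simp
  qed
  \<comment> \<open>the new chord does not separate points off the arc of the kink\<close>
  have apart: "\<not> linked p q u v" if "u \<notin> W" "v \<notin> W" for u v
  proof -
    have "\<lfloor>x - pt 0 (1/2)\<rfloor> = \<lfloor>x - pt 0 (- (1/2))\<rfloor>" if "x \<notin> W" for x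
      by (rule floor_arc_off_window(2)) (use that in auto)
    then have "\<not> linked (pt 0 (1/2)) (pt 0 (- (1/2))) u v" using that unfolding linked_def by simp
    then show ?thesis unfolding p_def q_def by simp
  qed
  have "linking D p q = 0"
    unfolding linking_def using apart old_crossing_outside
    by (auto intro!: sum.neutral simp: classical_pairs_def)
  then have zero: "linking D p q = 0" "linking D q p = 0" using linking_sym by metis+
  have new: "{x \<in> crossing_pairs D' True. fst x \<in> W} = {(p, q), (q, p)}"
  proof (intro equalityI subsetI)
    fix x assume x: "x \<in> {x \<in> crossing_pairs D' True. fst x \<in> W}"
    obtain u v where uv: "x = (u, v)" by (cases x)
    have u: "u \<in> {0..<1}" "v \<in> {0..<1}" "crossing D' u v" "u \<in> W"
      using x uv unfolding crossing_pairs_def by auto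
    obtain t i j where t: "t = 1/2 \<or> t = - (1/2)" "u = pt 0 t + of_int i" "v = pt 0 (- t) + of_int j"
      by (rule created_crossing[OF u(3,4)])
    have "frac u = u" "frac v = v" using u(1,2) by (simp_all add: frac_eq)
    moreover have "frac u = frac (pt 0 t)" "frac v = frac (pt 0 (- t))"
      unfolding t(2,3) by (simp_all add: frac_def)
    ultimately have xt: "x = (frac (pt 0 t), frac (pt 0 (- t)))" unfolding uv by simp
    show "x \<in> {(p, q), (q, p)}"
      using t(1)
    proof
      assume "t = 1/2" show ?thesis unfolding xt \<open>t = 1/2\<close> p_def q_def by simp
    next
      assume "t = - (1/2)" show ?thesis unfolding xt \<open>t = - (1/2)\<close> p_def q_def by simp
    qed
  next
    fix x assume "x \<in> {(p, q), (q, p)}"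
    then show "x \<in> {x \<in> crossing_pairs D' True. fst x \<in> W}"
      using unit pW qW cr mp mq crossing_sym[OF cr] unfolding crossing_pairs_def by auto
  qed
  let ?X = "prechords (gauss D)"
  have X': "prechords (gauss D') = insert ({p, q}, 0) ?X"
  proof -
    have "precrossing_pairs D' = precrossing_pairs D \<union> {(p, q), (q, p)}"
      using crossing_pairs_created[of True] new crossing_pairs(2)[OF P.diagram] crossing_pairs(2)[OF P'.diagram]
      by simp
    then show ?thesis
      unfolding prechords_eq_linking[OF P.diagram] prechords_eq_linking[OF P'.diagram]
      using zero by (simp add: link image_Un insert_commute)
  qed
  have ends: "x \<notin> W" if "x \<in> \<Union>(fst ` ?X)" for x
    using that old_prechord_outside unfolding prechords_eq_linking[OF P.diagram] by auto
  have fresh: "({p, q}, 0) \<notin> ?X"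
  proof
    assume "({p, q}, 0) \<in> ?X"
    then have "p \<in> \<Union>(fst ` ?X)" by force
    then show False using ends pW by blast
  qed
  have "adjacent_ends (insert ({p, q}, 0) ?X) {p, q}"
  proof (subst adjacent_ends_iff[of _ _ 0])
    show "on_circle (insert ({p, q}, 0) ?X)"
      using on_circle_prechords[OF gauss_wf[OF P'.diagram]] unfolding X' .
    show "\<exists>a b. a \<noteq> b \<and> {p, q} = {a, b} \<and>
      (\<forall>x\<in>\<Union> (fst ` insert ({p, q}, 0) ?X) - {a, b}.
        \<forall>y\<in>\<Union> (fst ` insert ({p, q}, 0) ?X) - {a, b}. \<not> linked a b x y)"
      by (intro exI[of _ p] exI[of _ q] conjI pq refl ballI apart ends) auto
  qed simp
  then have "delete_all (prechords (gauss D')) = delete_all ?X"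
    unfolding X' by (intro delete_all_insert finite_prechords gauss_wf P.diagram fresh)
  then show ?thesis unfolding inv_I_def by simp
qed

text \<open>The reflection of the arcs exchanges the two new crossings. It reverses their signs and preserves
  how they are linked with a chord outside the window, so the sum of their contributions to a label
  equals its own negative.\<close>

lemma inv_I_R2:
  assumes "move_R2 D D'"
  shows "inv_I (gauss D) = inv_I (gauss D')"
proof -
  obtain s r L where rep: "replaces 2 parallel overlap s r D D'" and lay: "layered 2 overlap s r L D'"
    and L: "L 0 \<noteq> L 1"
    using assms unfolding move_R2_def by blast
  let ?d = "\<lambda>k t. Complex 1 (overlap_slope k t)"
  obtain \<phi> \<phi>' where R: "replacement 2 s r parallel (\<lambda>k t. Complex 1 0) overlap ?d \<phi> \<phi>' D D'"
    by (rule replacesE[OF rep arc_system_parallel arc_system_overlap])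
  have "creation 2 s r parallel (\<lambda>k t. Complex 1 0) overlap ?d \<phi> \<phi>' D D'"
    by (intro creation.intro[OF R] creation_axioms.intro) (auto simp: parallel_def split: if_splits)
  then interpret creation 2 s r parallel "\<lambda>k t. Complex 1 0" overlap ?d \<phi> \<phi>' D D' .
  have picture: "\<exists>i j t m m'. i < 2 \<and> j < 2 \<and> i \<noteq> j \<and> t \<in> {-1<..<1} \<and>
      u = pt i t + of_int m \<and> v = pt j t + of_int m' \<and>
      crossing D' (pt i t) (pt j t) \<and> crossing D' (pt i (- t)) (pt j (- t)) \<and>
      mark D' (pt i (- t)) = mark D' (pt i t) \<and> mark D' (pt i t) \<noteq> Pre"
    if cr: "crossing D' u v" and W: "u \<in> W" for u v
  proof -
    from P'.crossing_in_windowE[OF cr W] obtain i j t t' m m' where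
      i: "i < 2" "j < 2" "t \<in> {-1<..<1}" "u = pt i t + of_int m" "v = pt j t' + of_int m'"
        "overlap i t = overlap j t'" "(i, t) \<noteq> (j, t')" "crossing D' (pt i t) (pt j t')" by metis
    have t': "t' = t" and h: "overlap_height i t = overlap_height j t" and ne: "i \<noteq> j"
      using i(6,7) unfolding overlap_eq by auto
    have t: "t \<in> {-1..1}" "- t \<in> {-1..1}" using i(3) by auto
    have o: "overlap i t = overlap j t" "overlap i (- t) = overlap j (- t)"
      using h unfolding overlap_eq overlap_height_def by auto
    have mk: "mark D' (pt i \<tau>) = (if L i > L j then Over else if L i < L j then Under else Pre)"
      if "overlap i \<tau> = overlap j \<tau>" "\<tau> \<in> {-1..1}" for \<tau>
      using lay i(1,2) ne that unfolding layered_def by blast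
    have "L i \<noteq> L j"
    proof -
      have "i = 0 \<and> j = 1 \<or> i = 1 \<and> j = 0" using i(1,2) ne by auto
      then show ?thesis using L by auto
    qed
    then have "mark D' (pt i (- t)) = mark D' (pt i t)" "mark D' (pt i t) \<noteq> Pre"
      using mk[OF o(1) t(1)] mk[OF o(2) t(2)] by auto
    moreover have "crossing D' (pt i (- t)) (pt j (- t))"
      using P'.crossing_pt[OF i(1,2) t(2) t(2)] o(2) ne by simp
    ultimately show ?thesis using i(1-5,8) ne unfolding t' by blast
  qed
  show ?thesis
  proof (intro inv_I_eq_of_prechords prechords_unchanged)
    show "mark D' u \<noteq> Pre" if uv: "crossing D' u v" "u \<in> W" for u v
    proof -
      obtain i t m where "u = pt i t + of_int m" "mark D' (pt i t) \<noteq> Pre"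
        using picture[OF uv] by blast
      then show ?thesis by (simp add: pd_periodic[OF P'.diagram])
    qed
    fix a b assume ab: "a \<notin> W" "b \<notin> W"
    let ?N = "{p \<in> classical_pairs D'. fst p \<in> W}"
    let ?g = "\<lambda>(u, v). if linked a b u v then double_sign D' u v else 0"
    have flip: "slide_pair p \<in> ?N" "?g (slide_pair p) = - ?g p" "slide_pair (slide_pair p) = p"
      if p: "p \<in> ?N" for p
    proof -
      obtain u v where uv: "p = (u, v)" by (cases p)
      have u: "u \<in> {0..<1}" "v \<in> {0..<1}" "crossing D' u v" "u \<in> W"
        using p uv unfolding classical_pairs_def by auto
      show "slide_pair (slide_pair p) = p" using u(1,2) uv by (intro slide_pair_slide_pair) simp
      obtain i j t m m' where i: "i < 2" "j < 2" "i \<noteq> j" "t \<in> {-1<..<1}"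
        "u = pt i t + of_int m" "v = pt j t + of_int m'"
        "crossing D' (pt i t) (pt j t)" "crossing D' (pt i (- t)) (pt j (- t))"
        "mark D' (pt i (- t)) = mark D' (pt i t)" "mark D' (pt i t) \<noteq> Pre"
        using picture[OF u(3,4)] by blast
      have t: "t \<in> {-1..1}" "- t \<in> {-1<..<1}" using i(4) by auto
      have sl: "slide u = pt i (- t) + of_int m" "slide v = pt j (- t) + of_int m'"
        unfolding i(5,6) using slide_pt[OF i(1) t(1)] slide_pt[OF i(2) t(1)] by auto
      have cr: "crossing D' (slide u) (slide v)" unfolding sl P'.crossing_shift by (rule i(8))
      have mk: "mark D' (slide u) = mark D' u" "mark D' (slide u) \<noteq> Pre"
        unfolding sl unfolding i(5) pd_periodic[OF P'.diagram] using i(9,10) by auto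
      have "mark D' (slide u) \<in> {Over, Under}" using crossing_marks[OF P'.diagram cr] mk(2) by auto
      then show "slide_pair p \<in> ?N"
        using cr u(4) slide_window[of u] frac_unit[of "slide u"] frac_unit[of "slide v"]
        unfolding classical_pairs_def slide_pair_def uv
        by (simp add: crossing_frac[OF P'.diagram] pd_frac[OF P'.diagram] window_frac)
      \<comment> \<open>the two strands cross in opposite directions at the two ends of the bigon\<close>
      have "cross (?d i (- t)) (?d j (- t)) > 0 \<longleftrightarrow> \<not> cross (?d i t) (?d j t) > 0"
      proof -
        have "cross (?d i t) (?d j t) \<noteq> 0"
        proof -
          have "cross (vel D' (pt i t)) (vel D' (pt j t)) \<noteq> 0"
            by (rule crossing_transverse[OF P'.diagram i(7)])
          moreover have "overlap i t = overlap j t"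
            using P'.crossing_pt[OF i(1,2) t(1) t(1)] i(7) by simp
          ultimately show ?thesis using P'.cross_vel_pt[OF i(1,2,4,4)] by auto
        qed
        moreover have "cross (?d i (- t)) (?d j (- t)) = - cross (?d i t) (?d j t)"
          unfolding cross_def overlap_slope_def by simp
        ultimately show ?thesis by linarith
      qed
      then have "double_sign D' (pt i (- t)) (pt j (- t)) = - double_sign D' (pt i t) (pt j t)"
        unfolding double_sign_def P'.cross_vel_pt_pos[OF i(1,2,4,4,7)] P'.cross_vel_pt_pos[OF i(1,2) t(2) t(2) i(8)] i(9)
        by auto
      then have "double_sign D' (slide u) (slide v) = - double_sign D' u v"
        unfolding sl unfolding i(5,6) double_sign_shift[OF P'.diagram] .
      moreover have "linked a b (slide u) (slide v) = linked a b u v"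
      proof -
        have "linked a b (slide u) (slide v) = linked (slide a) (slide b) (slide u) (slide v)"
          using ab by (simp add: slide_outside)
        also have "\<dots> = linked a b u v"
          by (intro linked_cong slide_floor same_arc_outside) (use ab in auto)
        finally show ?thesis .
      qed
      ultimately show "?g (slide_pair p) = - ?g p"
        unfolding uv slide_pair_def by (simp add: double_sign_frac[OF P'.diagram])
    qed
    have "sum ?g ?N = sum (\<lambda>p. ?g (slide_pair p)) ?N"
      by (rule sum.reindex_bij_witness[of _ slide_pair slide_pair]) (use flip in auto)
    also have "\<dots> = - sum ?g ?N"
      unfolding sum_negf[symmetric] by (rule sum.cong[OF refl]) (rule flip(2))
    finally have "sum ?g ?N = 0" by simp
    then show "linking D' a b = linking D a b" unfolding linking_created by simp
  qed
qed

section \<open>Invariance\<close>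

lemma inv_I_elementary:
  assumes "elementary D D'"
  shows "inv_I (gauss D) = inv_I (gauss D')"
  using assms inv_I_isotopic inv_I_R1 inv_I_R2 inv_I_R3 inv_I_PR1 inv_I_PR2 inv_I_PR3
  unfolding elementary_def by blast

lemma inv_I_same_pseudoknot:
  assumes "same_pseudoknot D D'"
  shows "inv_I (gauss D) = inv_I (gauss D')"
  using assms unfolding same_pseudoknot_def
  by (induction rule: equivclp_induct) (auto dest: inv_I_elementary)

lemma inv_I_gauss_diagram_of:
  assumes "pseudodiagram D" "is_gauss_diagram_of P D"
  shows "inv_I P = inv_I (gauss D)"
  using assms inv_I_transport[OF _ gauss_wf[OF assms(1)]] unfolding is_gauss_diagram_of_def by blast

theorem corollary2:
  fixes D D' :: pdiagram and P P' :: gauss_diagram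
  assumes "pseudodiagram D" and "pseudodiagram D'"
    and "same_pseudoknot D D'"
    and "is_gauss_diagram_of P D" and "is_gauss_diagram_of P' D'"
  shows "inv_I P = inv_I P'"
  using inv_I_gauss_diagram_of[OF assms(1,4)] inv_I_gauss_diagram_of[OF assms(2,5)]
    inv_I_same_pseudoknot[OF assms(3)] by simp

end
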